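(* Let $n>3$ be an odd, square-free integer that is not a prime, and assume that every prime factor of $n$ is greater than $7$. Assume that $(x_0,\dots,x_4)\in G^5$ satisfies $(\tan x_0)^2=(\tan x_1)(\tan x_2)(\tan x_3)(\tan x_4)$ with $0<x_i<\frac{\pi}{2}$ and $\operatorname{den}(x_i)\in\{n,2n\}$ for each $0\le i\le 4$. Then there exist a permutation $\sigma$ of $\{1,2,3,4\}$ and rationals $s,t$ with $0<s<\frac12$, $0<t\le\frac14$ such that $x_0=x_{\sigma(1)}=x_{\sigma(2)}=s\pi$, $x_{\sigma(3)}=t\pi$ and $x_{\sigma(4)}=(\frac12-t)\pi$.
   Context: $G:=\mathbb{Q}\pi$; for nonzero $g\in G$, $\operatorname{den}(g)$ is the denominator of $g/\pi$ in lowest terms. *)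

theory Defs
  imports
    "HOL-Analysis.Analysis"
    "HOL-Computational_Algebra.Computational_Algebra"
    "HOL-Combinatorics.Permutations"
begin

definition rational_angles :: "real set" where
  "rational_angles = {of_rat q * pi | q. True}"

(* quotient_of returns numerator and (positive) denominator in lowest terms; the description is
   only meaningful for g in rational_angles. *)
definition den :: "real \<Rightarrow> int" where
  "den g = snd (quotient_of (THE q. of_rat q = g / pi))"

lemma den_of_rat_pi: "den (of_rat q * pi) = snd (quotient_of q)"
  by (simp add: den_def)

lemma den_frac_pi:
  assumes "b > 0" "coprime a b"
  shows "den (of_int a / of_int b * pi) = b"
proof -
  have "(of_int a / of_int b :: real) = of_rat (Rat.Fract a b)"
    using assms by (simp add: of_rat_rat)
  then show ?thesis
    using assms by (simp only: den_of_rat_pi) (simp add: quotient_of_Fract normalize_stable)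
qed

end

theory Submission
  imports Defs "HOL-Number_Theory.Cong" "HOL-Real_Asymp.Real_Asymp"
begin

text \<open>
  Up to passing to complementary angles, write the angles as \<open>\<pi> b\<^sub>i / n\<close> with \<open>b\<^sub>i\<close> prime to \<open>n\<close>,
  at the cost of exponents \<open>e\<^sub>i = \<plusminus>1\<close>. By irreducibility of the cyclotomic polynomial the relation
  survives all Galois conjugations, so the integer function
  \<open>c = 2 e\<^sub>0 [\<plusminus>b\<^sub>0] - \<Sum>\<^sub>i e\<^sub>i [\<plusminus>b\<^sub>i]\<close> on \<open>(\<int>/n)\<^sup>*\<close> is orthogonal to all translates of
  \<open>ln |tan (\<pi> a / n)|\<close>. The \<open>\<psi>\<close>-component of the latter is, for a primitive even character \<open>\<psi>\<close>, a
  nonzero multiple of \<open>L(1, cnj \<psi>)\<close>, which does not vanish. Hence \<open>c\<close> has no primitive components,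
  that is, \<open>c\<close> is killed by every product of differences \<open>c(u\<^sub>p a) - c(a)\<close> with one
  \<open>u\<^sub>p \<equiv> 1 mod n/p\<close> for each prime \<open>p | n\<close>. A nonzero function with this property, with values in any
  abelian group, has at least \<open>min (p - 1) \<ge> 10\<close> points in its support. As \<open>c\<close> has at most 8 odd
  values, it is even; but then its support has at most 6 points, so \<open>c = 0\<close>, and the cancellation
  pattern gives the claim.
\<close>

section \<open>Conjugates of roots of unity\<close>

text \<open>Primitive characters are singled out because the other components of
  \<open>ln |tan|\<close> carry Euler factors that may vanish. For the trivial character and
  composite squarefree \<open>n\<close>, the sum of \<open>ln |1 - z|\<close> over the primitive
  \<open>n\<close>-th roots of unity \<open>z\<close> is \<open>ln 1 = 0\<close>. Orthogonality
  alone therefore cannot give \<open>c = 0\<close>, and a statement about supports has to finish the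
  argument. Parity enters because the plain count decides nothing: five orbits
  \<open>{b, -b}\<close> can cover 10 points, just as many as the lower bound allows. Modulo 2 the
  coefficient \<open>2 e_0\<close> disappears and 8 points are left; once \<open>c\<close> is even,
  ten nonzero values would have total size at least 20, against the weight
  \<open>2 * 2 + 4 * 2 = 12\<close>. Complex characters do not see \<open>c\<close> modulo 2,
  whereas iterated differences have integer coefficients and survive the reduction; this is why the
  primitive part is described by differences. Working with tangents instead of sines costs only a
  factor \<open>1 - 2 \<psi>(2)\<close>, nonzero since \<open>|\<psi>(2)| = 1\<close>.\<close>

definition int_eval :: "int poly \<Rightarrow> 'a::comm_ring_1 \<Rightarrow> 'a" where
  "int_eval P z = poly (map_poly of_int P) z"

lemma int_eval_pCons [simp]: "int_eval (pCons a P) z = of_int a + z * int_eval P z"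
  by (simp add: int_eval_def map_poly_pCons)

lemma int_eval_0 [simp]: "int_eval 0 z = 0"
  by (simp add: int_eval_def)

lemma int_eval_1 [simp]: "int_eval 1 z = 1"
  by (simp add: one_pCons)

lemma int_eval_add [simp]: "int_eval (P + Q) z = int_eval P z + int_eval Q z"
  by (induction P Q rule: poly_induct2) (simp_all add: algebra_simps)

lemma int_eval_smult [simp]: "int_eval (smult c P) z = of_int c * int_eval P z"
  by (induction P) (simp_all add: algebra_simps)

lemma int_eval_minus [simp]: "int_eval (- P) z = - int_eval P z"
  using int_eval_smult[of "-1" P z] by simp

lemma int_eval_diff [simp]: "int_eval (P - Q) z = int_eval P z - int_eval Q z"
  using int_eval_add[of P "-Q" z] by simp

lemma int_eval_mult [simp]: "int_eval (P * Q) z = int_eval P z * int_eval Q z"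
  by (induction P) (simp_all add: algebra_simps)

lemma int_eval_power [simp]: "int_eval (P ^ k) z = int_eval P z ^ k"
  by (induction k) simp_all

lemma int_eval_monom [simp]: "int_eval (monom c k) z = of_int c * z ^ k"
  by (induction k) (simp_all add: monom_0 monom_Suc algebra_simps)

lemma int_eval_pcompose [simp]: "int_eval (pcompose P Q) z = int_eval P (int_eval Q z)"
  by (induction P) (simp_all add: pcompose_pCons)

section \<open>Frobenius modulo a prime and integer minimal polynomials\<close>

lemma prime_dvd_add_power_diff:
  fixes a b :: "'a :: comm_ring_1"
  assumes "prime p"
  shows "of_nat p dvd (a + b) ^ p - (a ^ p + b ^ p)"
proof -
  have p: "p > 0" using assms prime_gt_0_nat by blast
  have "(a + b) ^ p = (\<Sum>k\<le>p. of_nat (p choose k) * a ^ k * b ^ (p - k))"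
    by (rule binomial_ring)
  also have "{..p} = insert 0 (insert p {1..<p})" using p by auto
  also have "(\<Sum>k\<in>\<dots>. of_nat (p choose k) * a ^ k * b ^ (p - k)) =
      b ^ p + (a ^ p + (\<Sum>k\<in>{1..<p}. of_nat (p choose k) * a ^ k * b ^ (p - k)))"
    using p by simp
  finally have "(a + b) ^ p - (a ^ p + b ^ p) = (\<Sum>k\<in>{1..<p}. of_nat (p choose k) * a ^ k * b ^ (p - k))"
    by simp
  also have "of_nat p dvd \<dots>"
  proof (rule dvd_sum)
    fix k assume "k \<in> {1..<p}"
    hence "p dvd (p choose k)" using assms by (intro dvd_choose_prime) auto
    hence "of_nat p dvd (of_nat (p choose k) :: 'a)" by (auto elim!: dvdE)
    thus "of_nat p dvd of_nat (p choose k) * a ^ k * b ^ (p - k)" by (simp add: mult.assoc)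
  qed
  finally show ?thesis .
qed

lemma prime_dvd_int_power_diff:
  fixes a :: int assumes p: "prime (p::nat)"
  shows "int p dvd a ^ p - a"
proof (induction a rule: int_induct[where k = 0])
  case base
  show ?case using prime_gt_0_nat[OF p] by (simp add: power_0_left)
next
  case (step1 a)
  have "int p dvd ((a + 1) ^ p - (a ^ p + 1 ^ p)) + (a ^ p - a)"
    using prime_dvd_add_power_diff[OF p, of a 1] step1 by (intro dvd_add[of "int p"]) auto
  thus ?case by (simp add: algebra_simps)
next
  case (step2 a)
  have "int p dvd (a ^ p - a) - ((a - 1 + 1) ^ p - ((a - 1) ^ p + 1 ^ p))"
    using prime_dvd_add_power_diff[OF p, of "a - 1" 1] dvd_diff[OF step2(2)] by blast
  thus ?case by (simp add: algebra_simps)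
qed

text \<open>Induction on the coefficients: Fermat's congruence handles the constant term, and
  additivity of the \<open>p\<close>-th power modulo \<open>p\<close> separates it from the
  rest.\<close>

lemma frobenius_int_poly:
  fixes P :: "int poly" assumes p: "prime (p::nat)"
  shows "of_nat p dvd pcompose P (monom 1 p) - P ^ p"
proof (induction P)
  case 0
  thus ?case using prime_gt_0_nat[OF p] by (simp add: power_0_left)
next
  case (pCons a P)
  define X where "X = pCons 0 P"
  have X: "pCons a P = [:a:] + X" by (simp add: X_def)
  have XP: "X ^ p = monom 1 p * P ^ p"
    proof -
    have "X = [:0, 1:] * P" by (simp add: X_def)
    thus ?thesis by (simp only: power_mult_distrib monom_altdef smult_1_left)
  qed
  have 1: "of_nat p dvd ([:a:] + X) ^ p - ([:a:] ^ p + X ^ p)"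
    by (rule prime_dvd_add_power_diff[OF p])
  have "int p dvd a ^ p - a" by (rule prime_dvd_int_power_diff[OF p])
  hence 2: "(of_nat p :: int poly) dvd [:a:] ^ p - [:a:]"
    by (simp add: of_nat_poly poly_const_pow)
  have 3: "(of_nat p :: int poly) dvd monom 1 p * (pcompose P (monom 1 p) - P ^ p)"
    using pCons.IH by (rule dvd_mult)
  have "pcompose (pCons a P) (monom 1 p) - (pCons a P) ^ p =
     monom 1 p * (pcompose P (monom 1 p) - P ^ p) - ([:a:] ^ p - [:a:]) - (([:a:] + X) ^ p - ([:a:] ^ p + X ^ p))"
  proof -
    have "pcompose (pCons a P) (monom 1 p) = [:a:] + monom 1 p * pcompose P (monom 1 p)"
      by (simp add: pcompose_pCons)
    thus ?thesis unfolding X XP by (simp only: algebra_simps)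
  qed
  thus ?case using 1 2 3 by (simp only: dvd_diff)
qed

text \<open>The primitive part of an annihilating polynomial of least degree generates the whole
  annihilator over the integers. Integrality is what allows the later reduction modulo
  \<open>p\<close>.\<close>

lemma exists_int_min_poly:
  fixes z :: "'a :: {idom, ring_char_0}"
  assumes "P0 \<noteq> 0" "int_eval P0 z = 0"
  shows "\<exists>E. E \<noteq> 0 \<and> (\<forall>P. int_eval P z = 0 \<longleftrightarrow> E dvd P)"
proof -
  define S where "S = {P. P \<noteq> 0 \<and> int_eval P z = 0}"
  have "P0 \<in> S" using assms by (simp add: S_def)
  then obtain F where F: "F \<in> S" "\<And>P. P \<in> S \<Longrightarrow> degree F \<le> degree P"
    using ex_has_least_nat[of "\<lambda>P. P \<in> S" P0 degree] by blast
  define E where "E = primitive_part F"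
  have FE: "F = smult (content F) E" by (simp add: E_def)
  have F0: "F \<noteq> 0" using F(1) by (simp add: S_def)
  hence E0: "E \<noteq> 0" by (simp add: E_def)
  have cE: "content E = 1" using F0 by (simp add: E_def)
  have "of_int (content F) * int_eval E z = 0"
    using F(1) FE unfolding S_def by (metis (mono_tags, lifting) int_eval_smult mem_Collect_eq)
  hence Ez: "int_eval E z = 0" using F0 by simp
  have dE: "degree E = degree F" by (simp add: E_def)
  have "E dvd P" if P: "int_eval P z = 0" for P
  proof -
    obtain a q where aq: "a \<noteq> 0" "smult a P = E * q + pseudo_mod P E"
      using pseudo_mod(1)[OF E0] by blast
    have "int_eval (pseudo_mod P E) z = int_eval (smult a P - E * q) z" using aq(2) by simp
    also have "\<dots> = 0" using P Ez by simp
    finally have "pseudo_mod P E = 0"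
      using pseudo_mod(2)[OF E0, of P] F(2)[of "pseudo_mod P E"] dE by (force simp: S_def)
    hence eq: "smult a P = E * q" using aq(2) by simp
    hence "content (smult a P) = content (E * q)" by simp
    \<comment> \<open>Gauss's lemma with \<open>content E = 1\<close>: the multiplier
      \<open>a\<close> of the pseudo-division divides \<open>q\<close> and can be cancelled.\<close>
    hence "normalize a * content P = content q" by (simp add: content_mult cE)
    hence "a dvd content q" by (metis dvd_triv_left normalize_dvd_iff)
    then obtain q' where "q = smult a q'" 
      unfolding const_poly_dvd_iff_dvd_content[symmetric] by (auto elim!: dvdE)
    hence "smult a P = smult a (E * q')" using eq by simp
    hence "smult a (P - E * q') = 0" by (simp add: smult_diff_right)
    hence "P = E * q'" using aq(1) by simp
    thus ?thesis by simp
  qed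
  moreover have "int_eval P z = 0" if "E dvd P" for P
    using that Ez by (auto elim!: dvdE)
  ultimately show ?thesis using E0 by blast
qed

lemma lead_coeff_dvd: "(p :: 'a::idom poly) dvd q \<Longrightarrow> lead_coeff p dvd lead_coeff q"
  by (auto elim!: dvdE simp: lead_coeff_mult)

text \<open>Division with a unit leading coefficient, read modulo \<open>m\<close>: the top
  coefficient of \<open>S\<close> is peeled off repeatedly. Testing only the indices from
  \<open>degree E\<close> on expresses that a multiple of \<open>E\<close> congruent to a polynomial
  of smaller degree must be zero modulo \<open>m\<close>.\<close>

lemma dvd_coeffs_unit_lead_coeff:
  fixes E :: "'a :: idom poly"
  assumes "lead_coeff E dvd 1" "\<And>i. i \<ge> degree E \<Longrightarrow> m dvd coeff (E * S) i"
  shows "m dvd coeff S j"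
  using assms(2)
proof (induction "degree S" arbitrary: S j rule: less_induct)
  case less
  define T where "T = S - monom (lead_coeff S) (degree S)"
  have "m dvd lead_coeff E * lead_coeff S"
    using less.prems[of "degree E + degree S"] by (simp add: coeff_mult_degree_sum)
  obtain u where u: "1 = lead_coeff E * u" using assms(1) by (elim dvdE)
  have "m dvd u * (lead_coeff E * lead_coeff S)" by (rule dvd_mult) fact
  also have "u * (lead_coeff E * lead_coeff S) = lead_coeff S"
    using u by (simp add: mult.assoc[symmetric] mult.commute[of u])
  finally have mS: "m dvd lead_coeff S" .
  show ?case
  proof (cases "degree S = 0")
    case True
    thus ?thesis using mS by (cases "j = 0") (auto simp: coeff_eq_0)
  next
    case False
    hence "degree T < degree S" unfolding T_def
      by (intro degree_lessI) (auto simp: coeff_eq_0)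
    moreover have "m dvd coeff (E * T) i" if "i \<ge> degree E" for i
    proof -
      have "E * T = E * S - E * monom (lead_coeff S) (degree S)" by (simp add: T_def algebra_simps)
      thus ?thesis using less.prems[OF that] mS by (auto simp: mult.commute[of E] coeff_monom_mult intro!: dvd_diff)
    qed
    ultimately have "m dvd coeff T j" using less.hyps by blast
    moreover have "coeff S j = coeff T j + coeff (monom (lead_coeff S) (degree S)) j" by (simp add: T_def)
    moreover have "m dvd coeff (monom (lead_coeff S) (degree S)) j" using mS by auto
    ultimately show ?thesis by (simp only: dvd_add)
  qed
qed

text \<open>
  Let \<open>E\<close> be the minimal polynomial of \<open>z\<close> and \<open>X^n - 1 = E G\<close>. If \<open>E(z^p) \<noteq> 0\<close> then \<open>G(z^p) = 0\<close>, and
  differentiating at \<open>z^p\<close> gives \<open>n = E(z^p) G'(z^p) z^p\<close>, where \<open>E(z^p) \<equiv> E(z)^p = 0\<close> modulo \<open>p\<close>.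
  So \<open>E\<close> divides a polynomial congruent to the constant \<open>n\<close> modulo \<open>p\<close>, which is impossible.
\<close>

lemma prime_power_conj_root:
  fixes z :: "'a :: {idom, ring_char_0}"
  assumes n: "n > 0" and z: "z ^ n = 1" and p: "prime p" "\<not> p dvd n"
    and P: "int_eval P z = 0"
  shows "int_eval P (z ^ p) = 0"
proof -
  define X where "X = (monom 1 n - 1 :: int poly)"
  have X0: "X \<noteq> 0"
    using n by (auto simp: X_def poly_eq_iff coeff_eq_0 intro!: exI[of _ n])
  have Xz: "int_eval X w = w ^ n - 1" for w :: 'a by (simp add: X_def)
  obtain E where E: "E \<noteq> 0" "\<And>P. int_eval P z = 0 \<longleftrightarrow> E dvd P"
    using exists_int_min_poly[OF X0, of z] Xz[of z] z by force
  have EX: "E dvd X" using E(2)[of X] Xz[of z] z by simp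
  then obtain G where G: "X = E * G" by (elim dvdE)
  have dX: "degree X = n" using n unfolding X_def
    using degree_add_eq_left[of "-1 :: int poly" "monom 1 n"] by (simp add: degree_monom_eq)
  have "lead_coeff X = 1" using n dX by (simp add: X_def)
  hence lE: "lead_coeff E dvd 1" using lead_coeff_dvd[OF EX] by simp
  have Ez: "int_eval E z = 0" using E(2)[of E] by simp
  have dE: "degree E > 0"
  proof (rule ccontr)
    assume "\<not> degree E > 0"
    then obtain c where "E = [:c:]" by (meson degree_eq_zeroE neq0_conv)
    thus False using Ez E(1) by simp
  qed
  have "int_eval E (z ^ p) = 0"
  proof (rule ccontr)
    assume nz: "int_eval E (z ^ p) \<noteq> 0"
    have "int_eval E (z ^ p) * int_eval G (z ^ p) = int_eval X (z ^ p)" by (simp add: G)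
    also have "\<dots> = (z ^ n) ^ p - 1" by (simp add: Xz mult.commute flip: power_mult)
    finally have Gz: "int_eval G (z ^ p) = 0" using nz z by simp
    have "pderiv X = monom (int n) (n - 1)" by (simp add: X_def pderiv_diff pderiv_monom)
    hence "monom (int n) (n - 1) = E * pderiv G + G * pderiv E" by (simp add: G pderiv_mult)
    hence "int_eval (monom (int n) (n - 1)) (z ^ p) = int_eval (E * pderiv G + G * pderiv E) (z ^ p)" by simp
    hence "of_nat n * (z ^ p) ^ (n - 1) = int_eval E (z ^ p) * int_eval (pderiv G) (z ^ p)"
      using Gz by simp
    hence "of_nat n * (z ^ p) ^ (n - 1) * z ^ p = int_eval E (z ^ p) * int_eval (pderiv G) (z ^ p) * z ^ p" by simp
    moreover have "(z ^ p) ^ (n - 1) * z ^ p = (z ^ n) ^ p"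
      using n by (metis Suc_diff_1 power_Suc2 power_mult mult.commute)
    ultimately have 1: "of_nat n = int_eval E (z ^ p) * int_eval (pderiv G) (z ^ p) * z ^ p"
      using z by (simp only: mult.assoc power_one mult_1_right)
    obtain R where R: "pcompose E (monom 1 p) - E ^ p = of_nat p * R"
      using frobenius_int_poly[OF p(1), of E] by (elim dvdE)
    have "int_eval (pcompose E (monom 1 p) - E ^ p) z = int_eval (smult (int p) R) z"
      unfolding R by (simp add: of_nat_poly)
    hence "int_eval E (z ^ p) = of_nat p * int_eval R z"
      using Ez prime_gt_0_nat[OF p(1)] by (simp add: power_0_left)
    \<comment> \<open>\<open>W\<close> expresses the product
      \<open>int_eval E (z ^ p) * ...\<close>, with its factor \<open>p\<close> removed, as a
      polynomial in \<open>z\<close> itself, so that \<open>E\<close> can be applied to it.\<close>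
    define W where "W = R * pcompose (pderiv G) (monom 1 p) * monom 1 p"
    have "int_eval ([:int n:] - smult (int p) W) z = 0"
      using 1 \<open>int_eval E (z ^ p) = of_nat p * int_eval R z\<close> by (simp add: W_def mult.assoc)
    hence "E dvd [:int n:] - smult (int p) W" using E(2) by blast
    then obtain S where S: "[:int n:] - smult (int p) W = E * S" by (elim dvdE)
    \<comment> \<open>Since \<open>degree E > 0\<close>, the constant \<open>n\<close> lies below
      the tested indices; there only multiples of \<open>p\<close> remain.\<close>
    have "int p dvd coeff (E * S) i" if "i \<ge> degree E" for i
      unfolding S[symmetric] using that dE by (cases i) (auto simp: coeff_pCons)
    hence "int p dvd coeff S i" for i using dvd_coeffs_unit_lead_coeff[OF lE] by blast
    hence "int p dvd coeff (E * S) 0" by (simp add: coeff_mult)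
    hence "int p dvd (int n - int p * coeff W 0) + int p * coeff W 0"
      unfolding S[symmetric] by (intro dvd_add) auto
    hence "int p dvd int n" by simp
    thus False using p(2) by simp
  qed
  have "E dvd P" using P E(2)[of P] by simp
  then obtain T where "P = E * T" by (elim dvdE)
  thus ?thesis using \<open>int_eval E (z ^ p) = 0\<close> by simp
qed

text \<open>An exponent prime to \<open>n\<close> is a product of primes not dividing
  \<open>n\<close>, and each of them moves \<open>z\<close> to another root of the same integer
  polynomials.\<close>

theorem root_of_unity_conj_root:
  fixes z :: "'a :: {idom, ring_char_0}"
  assumes "n > 0" "z ^ n = 1" "int_eval P z = 0" "coprime b n" "b > 0"
  shows "int_eval P (z ^ b) = 0"
  using assms(2-)
proof (induction b arbitrary: z rule: prime_divisors_induct)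
  case zero
  thus ?case by simp
next
  case (unit x)
  thus ?case by simp
next
  case (factor p x)
  have "int_eval P (z ^ p) = 0"
  proof (rule prime_power_conj_root)
    show "\<not> p dvd n" using factor.prems(3) factor.hyps
      by (metis coprime_common_divisor dvd_triv_left not_prime_unit)
  qed (use assms(1) factor.hyps factor.prems in simp_all)
  moreover have "(z ^ p) ^ n = 1" using factor.prems(1)
    by (metis mult.commute power_mult power_one)
  ultimately have "int_eval P ((z ^ p) ^ x) = 0"
    using factor.prems by (intro factor.IH) auto
  thus ?case by (simp add: power_mult)
qed

section \<open>Summation by parts and the Euler product\<close>

text \<open>Stated with total variation because the weights \<open>1 / k - k powr - s\<close> needed
  later are not monotone.\<close>

lemma summation_by_parts_bounded:
  fixes a :: "nat \<Rightarrow> 'a :: banach" and w :: "nat \<Rightarrow> real"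
  assumes A: "\<And>N. norm (\<Sum>k<N. a k) \<le> M" and w: "w \<longlonglongrightarrow> 0"
    and V: "summable (\<lambda>k. \<bar>w k - w (Suc k)\<bar>)" "(\<Sum>k. \<bar>w k - w (Suc k)\<bar>) \<le> V"
  shows "summable (\<lambda>k. w k *\<^sub>R a k)" "norm (\<Sum>k. w k *\<^sub>R a k) \<le> M * V"
proof -
  define g where "g k = (w k - w (Suc k)) *\<^sub>R (\<Sum>j<Suc k. a j)" for k
  have M: "M \<ge> 0" using A[of 0] by simp
  have eq: "(\<Sum>k<N. w k *\<^sub>R a k) = w N *\<^sub>R (\<Sum>k<N. a k) + (\<Sum>k<N. g k)" for N
    by (induction N) (simp_all add: g_def algebra_simps)
  have ng: "norm (g k) \<le> \<bar>w k - w (Suc k)\<bar> * M" for k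
    unfolding g_def norm_scaleR by (intro mult_left_mono A) auto
  have sM: "summable (\<lambda>k. \<bar>w k - w (Suc k)\<bar> * M)" by (intro summable_mult2 V)
  have sg: "summable (\<lambda>k. norm (g k))"
    by (rule summable_comparison_test'[OF sM]) (use ng in auto)
  have "(\<lambda>N. w N *\<^sub>R (\<Sum>k<N. a k)) \<longlonglongrightarrow> 0"
  proof (rule Lim_null_comparison)
    show "\<forall>\<^sub>F N in sequentially. norm (w N *\<^sub>R (\<Sum>k<N. a k)) \<le> \<bar>w N\<bar> * M"
      by (intro always_eventually allI) (auto intro!: mult_left_mono A)
    show "(\<lambda>N. \<bar>w N\<bar> * M) \<longlonglongrightarrow> 0" using tendsto_mult_left_zero[OF tendsto_rabs_zero[OF w]] by simp
  qed
  moreover have "(\<lambda>N. \<Sum>k<N. g k) \<longlonglongrightarrow> suminf g"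
    using summable_LIMSEQ summable_norm_cancel[OF sg] by blast
  ultimately have "(\<lambda>N. \<Sum>k<N. w k *\<^sub>R a k) \<longlonglongrightarrow> 0 + suminf g"
    unfolding eq by (rule tendsto_add)
  hence s: "(\<lambda>k. w k *\<^sub>R a k) sums suminf g" by (simp add: sums_def)
  show "summable (\<lambda>k. w k *\<^sub>R a k)" using s by (rule sums_summable)
  have "norm (suminf g) \<le> (\<Sum>k. norm (g k))" by (rule summable_norm[OF sg])
  also have "\<dots> \<le> (\<Sum>k. \<bar>w k - w (Suc k)\<bar> * M)" by (intro suminf_le ng sg sM)
  also have "\<dots> = (\<Sum>k. \<bar>w k - w (Suc k)\<bar>) * M" by (rule suminf_mult2[symmetric, OF V(1)])
  also have "\<dots> \<le> V * M" by (intro mult_right_mono V M)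
  finally show "norm (\<Sum>k. w k *\<^sub>R a k) \<le> M * V" using s by (simp add: sums_unique[symmetric] mult.commute)
qed

lemma summation_by_parts_decreasing:
  fixes a :: "nat \<Rightarrow> 'a :: banach" and w :: "nat \<Rightarrow> real"
  assumes A: "\<And>N. norm (\<Sum>k<N. a k) \<le> M" and w: "w \<longlonglongrightarrow> 0" and d: "\<And>k. w (Suc k) \<le> w k"
  shows "summable (\<lambda>k. w k *\<^sub>R a k)" "norm (\<Sum>k. w k *\<^sub>R a k) \<le> M * w 0"
proof -
  have "(\<lambda>k. w k - w (Suc k)) sums (w 0 - 0)" by (rule telescope_sums'[OF w])
  moreover have "\<bar>w k - w (Suc k)\<bar> = w k - w (Suc k)" for k using d[of k] by simp
  ultimately have "(\<lambda>k. \<bar>w k - w (Suc k)\<bar>) sums w 0" by simp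
  thus "summable (\<lambda>k. w k *\<^sub>R a k)" "norm (\<Sum>k. w k *\<^sub>R a k) \<le> M * w 0"
    using summation_by_parts_bounded[OF A w] by (auto simp: sums_iff)
qed

text \<open>Real part of the power series of \<open>- Ln (1 - z)\<close>; the term at
  \<open>k = 0\<close> is \<open>0\<close> because division by \<open>0\<close> gives
  \<open>0\<close>.\<close>

lemma ln_norm_one_minus_sums:
  fixes z :: complex assumes "norm z < 1"
  shows "(\<lambda>k. Re (z ^ k) / real k) sums (- ln (norm (1 - z)))"
proof -
  have "(\<lambda>k. - ((z)^k) / of_nat k) sums ln (1 - z)"
    using Ln_series'[of "-z"] assms by simp
  hence "(\<lambda>k. - (- (z^k) / of_nat k)) sums - ln (1 - z)" by (rule sums_minus)
  hence "(\<lambda>k. Re (- (- (z^k) / of_nat k))) sums Re (- ln (1 - z))" by (rule sums_Re)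
  moreover have "1 - z \<noteq> 0" using assms by auto
  moreover have "Re (- (- (z^k) / of_nat k)) = Re (z ^ k) / real k" for k by simp
  ultimately show ?thesis by (simp add: Re_Ln)
qed

text \<open>After taking logarithms each coefficient is \<open>3 + 4 Re w + Re (w^2)\<close> with
  \<open>w = z^k\<close>, which is \<open>2 (1 + Re w)^2 + (1 - |w|^2)\<close>. The closed disc
  covers character values of modulus 1 as well as the value 0.\<close>

lemma three_four_one:
  fixes z :: complex
  assumes r: "0 \<le> r" "r < 1" and z: "norm z \<le> 1"
  shows "norm (1 - of_real r :: complex) ^ 3 * norm (1 - of_real r * z) ^ 4 * norm (1 - of_real r * z\<^sup>2) \<le> 1"
proof -
  have n: "norm (of_real r :: complex) < 1" "norm (of_real r * z) < 1" "norm (of_real r * z\<^sup>2) < 1"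
    using r z mult_le_one[of "norm z" "norm z"] mult_left_mono[of "norm z" 1 r] mult_left_mono[of "norm z ^ 2" 1 r]
    by (auto simp: norm_mult norm_power power2_eq_square)
  define u where "u k = r ^ k / real k * (3 + 4 * Re (z ^ k) + Re ((z ^ k)\<^sup>2))" for k
  have "(\<lambda>k. 3 * (Re (of_real r ^ k) / real k) + 4 * (Re ((of_real r * z) ^ k) / real k) + Re ((of_real r * z\<^sup>2) ^ k) / real k)
    sums (3 * (- ln (norm (1 - of_real r :: complex))) + 4 * (- ln (norm (1 - of_real r * z))) + (- ln (norm (1 - of_real r * z\<^sup>2))))"
    by (intro sums_add sums_mult ln_norm_one_minus_sums n)
  moreover have "3 * (Re (of_real r ^ k) / real k) + 4 * (Re ((of_real r * z) ^ k) / real k) + Re ((of_real r * z\<^sup>2) ^ k) / real k = u k" for k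
    by (simp add: u_def power_mult_distrib power_mult[symmetric] mult.commute[of 2] algebra_simps add_divide_distrib flip: of_real_power)
  ultimately have s: "u sums (3 * (- ln (norm (1 - of_real r :: complex))) + 4 * (- ln (norm (1 - of_real r * z))) + (- ln (norm (1 - of_real r * z\<^sup>2))))"
    by simp
  have "u k \<ge> 0" for k
  proof -
    have "norm (z ^ k) \<le> 1" using z by (simp add: norm_power power_le_one)
    hence "(norm (z ^ k))\<^sup>2 \<le> 1" by (simp add: power_le_one)
    hence "(Re (z ^ k))\<^sup>2 + (Im (z ^ k))\<^sup>2 \<le> 1" by (simp add: cmod_power2)
    moreover have "3 + 4 * Re (z ^ k) + Re ((z ^ k)\<^sup>2) = 2 * (1 + Re (z ^ k))\<^sup>2 + (1 - (Re (z ^ k))\<^sup>2 - (Im (z ^ k))\<^sup>2)"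
      by (simp add: power2_eq_square algebra_simps)
    ultimately have "3 + 4 * Re (z ^ k) + Re ((z ^ k)\<^sup>2) \<ge> 0"
      by (smt (verit) zero_le_power2)
    thus ?thesis unfolding u_def using r by (intro mult_nonneg_nonneg divide_nonneg_nonneg) auto
  qed
  hence "0 \<le> 3 * (- ln (norm (1 - of_real r :: complex))) + 4 * (- ln (norm (1 - of_real r * z))) + (- ln (norm (1 - of_real r * z\<^sup>2)))"
    using s sums_le[of "\<lambda>_. 0" u] sums_zero by blast
  moreover have "norm (1 - of_real r :: complex) > 0" "norm (1 - of_real r * z) > 0" "norm (1 - of_real r * z\<^sup>2) > 0"
    using n by auto
  ultimately have "ln (norm (1 - of_real r :: complex) ^ 3 * norm (1 - of_real r * z) ^ 4 * norm (1 - of_real r * z\<^sup>2)) \<le> 0"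
    by (simp add: ln_mult ln_realpow)
  thus ?thesis using \<open>norm (1 - of_real r :: complex) > 0\<close> \<open>norm (1 - of_real r * z) > 0\<close> \<open>norm (1 - of_real r * z\<^sup>2) > 0\<close>
    by (subst (asm) ln_le_zero_iff) (auto intro!: mult_pos_pos)
qed

text \<open>Each factor \<open>1 - f p\<close> removes the multiples of \<open>p\<close> from the
  sum. After all primes up to \<open>N\<close> only \<open>1\<close> and numbers beyond
  \<open>N\<close> are left, and the latter form a tail. Keeping the product on the side of the sum
  avoids any discussion of infinite products.\<close>

lemma euler_sieve:
  fixes f :: "nat \<Rightarrow> complex"
  assumes s: "(\<lambda>k. norm (f k)) summable_on UNIV" and f0: "f 0 = 0" and f1: "f 1 = 1"
    and mult: "\<And>a b. f (a * b) = f a * f b"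
  shows "(\<lambda>N. infsum f UNIV * (\<Prod>p | prime p \<and> p \<le> N. 1 - f p)) \<longlonglongrightarrow> 1"
proof -
  define S where "S A = {k::nat. k > 0 \<and> (\<forall>p\<in>A. \<not> p dvd k)}" for A
  have sf: "f summable_on B" for B
    using s abs_summable_summable summable_on_subset_banach by blast
  have prod: "infsum f UNIV * (\<Prod>p\<in>A. 1 - f p) = infsum f (S A)" if "finite A" "\<forall>p\<in>A. prime p" for A
    using that
  proof (induction A rule: finite_induct)
    case empty
    have "infsum f UNIV = infsum f (S {})"
      by (intro infsum_cong_neutral) (auto simp: S_def f0 intro!: Nat.gr0I)
    thus ?case by simp
  next
    case (insert p A)
    have pp: "prime p" using insert by simp
    have *: "S A = S (insert p A) \<union> (*) p ` S A" "S (insert p A) \<inter> (*) p ` S A = {}"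
    proof -
      have "k \<in> (*) p ` S A" if k: "k \<in> S A" "p dvd k" for k
      proof -
        obtain j where "k = p * j" using k(2) by (elim dvdE)
        thus ?thesis using k(1) by (auto simp: S_def intro!: image_eqI[of _ _ j])
      qed
      moreover have "p * j \<in> S A" if "j \<in> S A" for j
      proof -
        have "\<not> q dvd p" if "q \<in> A" for q
          using that insert.prems insert.hyps pp by (metis insertCI primes_dvd_imp_eq)
        thus ?thesis using that pp prime_gt_0_nat[OF pp] insert.prems by (auto simp: S_def prime_dvd_mult_iff)
      qed
      ultimately show "S A = S (insert p A) \<union> (*) p ` S A" by (auto simp: S_def)
    qed (auto simp: S_def)
    have e1: "infsum f (S A) = infsum f (S (insert p A)) + infsum f ((*) p ` S A)"
      using *(2) by (subst *(1), subst infsum_Un_disjoint) (auto intro: sf)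
    have e2: "infsum f ((*) p ` S A) = infsum (\<lambda>j. f p * f j) (S A)"
      using prime_gt_0_nat[OF pp] by (subst infsum_reindex) (auto simp: inj_on_def o_def mult)
    have e3: "infsum (\<lambda>j. f p * f j) (S A) = f p * infsum f (S A)" by (rule infsum_cmult_right) (auto intro: sf)
    have split: "infsum f (S (insert p A)) = (1 - f p) * infsum f (S A)"
      using e1 unfolding e2 e3 by (simp add: algebra_simps)
    have IH: "infsum f UNIV * (\<Prod>p\<in>A. 1 - f p) = infsum f (S A)"
      by (rule insert.IH) (use insert.prems in blast)
    have "infsum f UNIV * (\<Prod>p\<in>insert p A. 1 - f p) = (1 - f p) * (infsum f UNIV * (\<Prod>p\<in>A. 1 - f p))"
      using insert.hyps by (simp add: mult_ac)
    thus ?case unfolding IH split .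
  qed
  define P where "P N = {p::nat. prime p \<and> p \<le> N}" for N
  have bound: "norm (infsum f UNIV * (\<Prod>p\<in>P N. 1 - f p) - 1) \<le> infsum (\<lambda>k. norm (f k)) UNIV - (\<Sum>k<Suc N. norm (f k))" for N
  proof -
    have "finite (P N)" by (rule finite_subset[of _ "{..N}"]) (auto simp: P_def)
    hence 0: "infsum f UNIV * (\<Prod>p\<in>P N. 1 - f p) = infsum f (S (P N))"
      by (intro prod) (auto simp: P_def)
    have "1 \<in> S (P N)" by (auto simp: S_def P_def)
    hence 1: "S (P N) = {1} \<union> (S (P N) - {1})" by blast
    have "infsum f (S (P N)) = infsum f ({1} \<union> (S (P N) - {1}))" using 1 by (rule arg_cong)
    also have "\<dots> = 1 + infsum f (S (P N) - {1})"
      by (subst infsum_Un_disjoint) (auto intro: sf simp: f1[unfolded One_nat_def])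
    finally have "norm (infsum f UNIV * (\<Prod>p\<in>P N. 1 - f p) - 1) = norm (infsum f (S (P N) - {1}))" unfolding 0 by simp
    also have "\<dots> \<le> infsum (\<lambda>k. norm (f k)) (S (P N) - {1})"
      by (rule norm_infsum_bound) (rule summable_on_subset_banach[OF s], simp)
    also have "\<dots> \<le> infsum (\<lambda>k. norm (f k)) (- {..<Suc N})"
    proof (rule infsum_mono_neutral)
      fix k assume k: "k \<in> S (P N) - {1} - - {..<Suc N}"
      hence "k \<noteq> 1" "k > 0" "k \<le> N" by (auto simp: S_def)
      then obtain p where "prime p" "p dvd k" using prime_factor_nat by blast
      moreover have "p \<le> k" using \<open>p dvd k\<close> \<open>k > 0\<close> by (rule dvd_imp_le)
      ultimately have "p \<in> P N" using \<open>k \<le> N\<close> by (simp add: P_def)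
      thus "norm (f k) \<le> 0" using k \<open>p dvd k\<close> by (auto simp: S_def)
    qed (auto intro: summable_on_subset_banach[OF s])
    also have "\<dots> = infsum (\<lambda>k. norm (f k)) UNIV - (\<Sum>k<Suc N. norm (f k))"
      using infsum_Diff[OF s, of "{..<Suc N}"] by (simp add: Compl_eq_Diff_UNIV)
    finally show ?thesis .
  qed
  have "(\<lambda>N. \<Sum>k<N. norm (f k)) \<longlonglongrightarrow> infsum (\<lambda>k. norm (f k)) UNIV"
    using has_sum_imp_sums[OF has_sum_infsum[OF s]] by (simp add: sums_def)
  hence tail: "(\<lambda>N. infsum (\<lambda>k. norm (f k)) UNIV - (\<Sum>k<Suc N. norm (f k))) \<longlonglongrightarrow> infsum (\<lambda>k. norm (f k)) UNIV - infsum (\<lambda>k. norm (f k)) UNIV"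
    by (intro tendsto_diff tendsto_const LIMSEQ_Suc)
  have "(\<lambda>N. infsum f UNIV * (\<Prod>p\<in>P N. 1 - f p) - 1) \<longlonglongrightarrow> 0"
  proof (rule Lim_null_comparison[OF _ tail[unfolded diff_self]])
    show "\<forall>\<^sub>F N in sequentially. norm (infsum f UNIV * (\<Prod>p\<in>P N. 1 - f p) - 1)
        \<le> infsum (\<lambda>k. norm (f k)) UNIV - (\<Sum>k<Suc N. norm (f k))"
      by (intro always_eventually allI bound)
  qed
  hence "(\<lambda>N. infsum f UNIV * (\<Prod>p\<in>P N. 1 - f p)) \<longlonglongrightarrow> 1" by (simp add: LIM_zero_iff)
  thus ?thesis by (simp add: P_def)
qed

section \<open>Dirichlet characters and their L-series\<close>

text \<open>Non-principality enters separately, as the vanishing of the sum over one period, because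
  the square of a character is again an instance and may be principal.\<close>

locale dirichlet_character =
  fixes n :: nat and \<psi> :: "nat \<Rightarrow> complex"
  assumes n_gt_1: "n > 1"
    and periodic: "\<psi> (k + n) = \<psi> k"
    and mult: "\<psi> (a * b) = \<psi> a * \<psi> b"
    and nonzero_iff: "\<psi> k \<noteq> 0 \<longleftrightarrow> coprime k n"
begin

lemma psi_0 [simp]: "\<psi> 0 = 0"
  using nonzero_iff[of 0] n_gt_1 by auto

lemma psi_1 [simp]: "\<psi> (Suc 0) = 1"
  using mult[of 1 1] nonzero_iff[of 1] by auto

lemma periodic_mult: "\<psi> (k + n * q) = \<psi> k"
  by (induction q) (use periodic[of "k + n * _"] in \<open>simp_all add: algebra_simps\<close>)

lemma psi_mod: "\<psi> (k mod n) = \<psi> k"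
  using periodic_mult[of "k mod n" "k div n"] by simp

lemma psi_power: "\<psi> (a ^ j) = \<psi> a ^ j"
  by (induction j) (simp_all add: mult)

text \<open>Otherwise the values at the powers of \<open>k\<close> would be unbounded, while
  periodicity leaves finitely many values.\<close>

lemma norm_le_1: "norm (\<psi> k) \<le> 1"
proof (rule ccontr)
  assume "\<not> norm (\<psi> k) \<le> 1"
  define B where "B = Max ((\<lambda>j. norm (\<psi> j)) ` {..<n})"
  have B: "norm (\<psi> j) \<le> B" for j
    using n_gt_1 by (subst psi_mod[symmetric]) (auto simp: B_def)
  obtain j where "norm (\<psi> k) ^ j > B"
    using \<open>\<not> norm (\<psi> k) \<le> 1\<close> real_arch_pow[of "norm (\<psi> k)" B] by auto
  thus False using B[of "k ^ j"] by (simp add: psi_power norm_power)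
qed

lemma norm_partial_sum_le:
  assumes "(\<Sum>k<n. \<psi> k) = 0"
  shows "norm (\<Sum>k<N. \<psi> k) \<le> n"
proof (induction N rule: less_induct)
  case (less N)
  show ?case
  proof (cases "N < n")
    case True
    have "norm (\<Sum>k<N. \<psi> k) \<le> (\<Sum>k<N. 1)"
      by (rule order_trans[OF norm_sum]) (intro sum_mono norm_le_1)
    thus ?thesis using True by simp
  next
    case False
    have shift: "(\<Sum>k<m + n. \<psi> k) = (\<Sum>k<n. \<psi> k) + (\<Sum>k<m. \<psi> k)" for m
      by (induction m) (simp_all add: periodic)
    have "(\<Sum>k<N. \<psi> k) = (\<Sum>k<N - n. \<psi> k)"
      using shift[of "N - n"] False assms by simp
    thus ?thesis using less[of "N - n"] False n_gt_1 by simp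
  qed
qed

lemma norm_partial_sum_Suc_le:
  assumes "(\<Sum>k<n. \<psi> k) = 0"
  shows "norm (\<Sum>k<N. \<psi> (Suc k)) \<le> n"
proof -
  have "(\<Sum>k<N. \<psi> (Suc k)) = (\<Sum>k<Suc N. \<psi> k)"
    by (subst sum.lessThan_Suc_shift) simp
  thus ?thesis using norm_partial_sum_le[OF assms, of "Suc N"] by (simp only:)
qed

lemma psi_square: "dirichlet_character n (\<lambda>k. (\<psi> k)\<^sup>2)"
  by unfold_locales (use n_gt_1 nonzero_iff in \<open>simp_all add: periodic mult power_mult_distrib\<close>)

lemma summable_powr:
  assumes "s > 1"
  shows "(\<lambda>k. norm (\<psi> k * of_real (real k powr - s))) summable_on UNIV"
proof -
  have "summable (\<lambda>k. real k powr - s)" using assms by (simp add: summable_real_powr_iff)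
  hence "summable (\<lambda>k. norm (\<psi> k * of_real (real k powr - s)))"
    by (rule summable_comparison_test'[where N = 0])
       (auto simp: norm_mult intro: mult_left_le_one_le norm_le_1)
  thus ?thesis by (subst summable_on_UNIV_nonneg_real_iff) auto
qed

definition L_series :: "real \<Rightarrow> complex" where
  "L_series s = (\<Sum>\<^sub>\<infinity>k. \<psi> k * of_real (real k powr - s))"

lemma L_series_sums:
  assumes "s > 1"
  shows "(\<lambda>k. real (Suc k) powr - s *\<^sub>R \<psi> (Suc k)) sums L_series s"
proof -
  have "(\<lambda>k. \<psi> k * of_real (real k powr - s)) summable_on UNIV"
    using summable_powr[OF assms] by (rule abs_summable_summable)
  hence "(\<lambda>k. \<psi> k * of_real (real k powr - s)) sums L_series s"
    unfolding L_series_def by (intro has_sum_imp_sums has_sum_infsum)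
  hence "(\<lambda>k. \<psi> (Suc k) * of_real (real (Suc k) powr - s)) sums L_series s"
    by (subst sums_Suc_iff) simp
  thus ?thesis by (simp add: scaleR_conv_of_real mult.commute)
qed

text \<open>The bound is uniform in \<open>s\<close>: partial sums of the character are at most
  \<open>n\<close>, and the first weight is \<open>1\<close>.\<close>

lemma norm_L_series_le:
  assumes "(\<Sum>k<n. \<psi> k) = 0" "s > 1"
  shows "norm (L_series s) \<le> n"
proof -
  have "(\<lambda>k. real (Suc k) powr - s) \<longlonglongrightarrow> 0"
    using assms(2) by real_asymp
  moreover have "real (Suc (Suc k)) powr - s \<le> real (Suc k) powr - s" for k
    using assms(2) by (intro powr_mono2') auto
  ultimately have "norm (\<Sum>k. real (Suc k) powr - s *\<^sub>R \<psi> (Suc k)) \<le> n * (real (Suc 0) powr - s)"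
    by (intro summation_by_parts_decreasing(2) norm_partial_sum_Suc_le assms)
  thus ?thesis using sums_unique[OF L_series_sums[OF assms(2)]] by simp
qed

end

section \<open>Estimates as \<open>s\<close> decreases to 1\<close>

lemma powr_weight_diff_bound:
  fixes s :: real
  defines "w \<equiv> \<lambda>k. 1 / real (Suc k) - real (Suc k) powr - s"
  assumes s: "s > 1"
  shows "\<bar>w k - w (Suc k)\<bar> \<le> (s - 1) * (3 * real (Suc k) powr - (3/2))"
proof -
  define K e where "K = real (Suc k)" and "e = s - 1"
  have K: "K \<ge> 1" "real (Suc (Suc k)) = K + 1" and e: "e > 0" using s by (simp_all add: K_def e_def)
  \<comment> \<open>The weight at \<open>t\<close> is \<open>y t / t\<close>. A discrete product
    rule splits its difference into two parts, each carrying a factor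
    \<open>e = s - 1\<close>.\<close>
  define y where "y t = 1 - t powr - e" for t :: real
  have w: "1 / t - t powr - s = (1 / t) * y t" if "t > 0" for t
  proof -
    have "t powr - s = t powr (- e + - 1)" by (simp add: e_def)
    also have "\<dots> = t powr - e * t powr - 1" by (rule powr_add)
    also have "t powr - 1 = 1 / t" using that by (simp add: powr_minus_divide)
    finally show ?thesis by (simp add: y_def algebra_simps)
  qed
  have y_le: "y t \<le> e * ln t" if "t > 0" for t
    using that exp_ge_add_one_self[of "- e * ln t"] by (simp add: y_def powr_def)
  have y0: "y K \<ge> 0" using K e by (simp add: y_def powr_le_one_le powr_minus divide_simps ge_one_powr_ge_zero)
  have step: "0 \<le> y (K + 1) - y K" "y (K + 1) - y K \<le> e / K"
  proof -
    show "0 \<le> y (K + 1) - y K" using K e by (auto simp: y_def intro!: powr_mono2')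
    have "K + 1 = K * (1 + 1 / K)" using K by (simp add: field_simps)
    hence "(K + 1) powr - e = K powr - e * (1 + 1 / K) powr - e"
      using K by (simp add: powr_mult)
    hence "y (K + 1) - y K = K powr - e * y (1 + 1 / K)" by (simp add: y_def algebra_simps)
    also have "\<dots> \<le> 1 * (e * ln (1 + 1 / K))"
    proof (rule mult_mono)
      show "K powr - e \<le> 1" using y0 by (simp add: y_def)
      show "y (1 + 1 / K) \<le> e * ln (1 + 1 / K)" using K by (intro y_le) (simp add: add_pos_nonneg)
      show "0 \<le> y (1 + 1 / K)"
        using K e by (simp add: y_def powr_minus divide_simps ge_one_powr_ge_zero)
    qed simp
    also have "\<dots> \<le> e / K" using K e ln_add_one_self_le_self[of "1 / K"] by (simp add: field_simps)
    finally show "y (K + 1) - y K \<le> e / K" .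
  qed
  have wk: "w k = (1 / K) * y K" "w (Suc k) = (1 / (K + 1)) * y (K + 1)"
    using w[of K] w[of "K + 1"] K unfolding w_def K_def[symmetric] K(2) by auto
  have "w k - w (Suc k) = (1 / K - 1 / (K + 1)) * y K - (1 / (K + 1)) * (y (K + 1) - y K)"
    unfolding wk by (simp add: algebra_simps)
  hence "\<bar>w k - w (Suc k)\<bar> \<le> \<bar>(1 / K - 1 / (K + 1)) * y K\<bar> + \<bar>(1 / (K + 1)) * (y (K + 1) - y K)\<bar>"
    by linarith
  also have "\<dots> = (1 / K - 1 / (K + 1)) * y K + (1 / (K + 1)) * (y (K + 1) - y K)"
    using y0 step(1) K by (simp add: abs_mult divide_simps)
  also have "\<dots> \<le> (1 / K / K) * (e * (2 * K powr (1/2))) + (1 / K) * (e / K)"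
  proof (intro add_mono mult_mono)
    show "1 / K - 1 / (K + 1) \<le> 1 / K / K" using K by (simp add: divide_simps)
    \<comment> \<open>Trading the logarithm for a square root leaves a pure power; this is the
      origin of the exponent \<open>3/2\<close>.\<close>
    have "ln K \<le> 2 * K powr (1/2)" using ln_powr_bound[of K "1/2"] K by simp
    thus "y K \<le> e * (2 * K powr (1/2))" using y_le[of K] K e
      by (smt (verit) mult_left_mono)
    show "1 / (K + 1) \<le> 1 / K" using K by (simp add: divide_simps)
  qed (use K step y0 e in auto)
  also have "\<dots> = e * ((2 * K powr (1/2) + 1) / K\<^sup>2)" using K by (simp add: power2_eq_square field_simps)
  also have "\<dots> \<le> e * (3 * K powr - (3/2))"
  proof (intro mult_left_mono)
    have "K powr (1/2) \<ge> 1" using K by (simp add: ge_one_powr_ge_zero)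
    hence "(2 * K powr (1/2) + 1) / K\<^sup>2 \<le> 3 * (K powr (1/2) / K\<^sup>2)"
      using K by (simp add: divide_simps)
    also have "K powr (1/2) / K\<^sup>2 = K powr (1/2 - 2)" unfolding powr_diff using K by simp
    finally show "(2 * K powr (1/2) + 1) / K\<^sup>2 \<le> 3 * K powr - (3/2)" by simp
  qed (use e in auto)
  finally show ?thesis by (simp add: e_def K_def)
qed

text \<open>Comparison with the telescoping sequence \<open>k powr - (s - 1) / (s - 1)\<close>, an
  antiderivative of \<open>- (k powr - s)\<close>.\<close>

lemma zeta_le:
  fixes s :: real assumes s: "s > 1"
  shows "(\<Sum>k. real (Suc k) powr - s) \<le> 1 + 1 / (s - 1)"
proof -
  define e where "e = s - 1"
  have e: "e > 0" using s by (simp add: e_def)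
  define u where "u k = real (Suc k) powr - e / e" for k
  have "u \<longlonglongrightarrow> 0" unfolding u_def using e by real_asymp
  hence t: "(\<lambda>k. u k - u (Suc k)) sums (u 0 - 0)" by (rule telescope_sums')
  have sm: "summable (\<lambda>k. real (Suc k) powr - s)"
    using s summable_Suc_iff[of "\<lambda>k. real k powr - s"] by (simp add: summable_real_powr_iff)
  have le: "real (Suc (Suc k)) powr - s \<le> u k - u (Suc k)" for k
  proof -
    define K where "K = real (Suc k)"
    have K: "K \<ge> 1" "real (Suc (Suc k)) = K + 1" by (simp_all add: K_def)
    have eq: "K = (K + 1) * (K / (K + 1))" using K by simp
    have "K powr - e = (K + 1) powr - e * (K / (K + 1)) powr - e"
      using K by (subst eq, subst powr_mult) auto
    moreover have "(K / (K + 1)) powr - e \<ge> 1 + e / (K + 1)"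
    proof -
      have "- ln (K / (K + 1)) \<ge> 1 / (K + 1)"
        using ln_le_minus_one[of "K / (K + 1)"] K by (simp add: field_simps)
      hence "1 + e / (K + 1) \<le> 1 + (- e * ln (K / (K + 1)))"
        using e mult_left_mono[of "1 / (K + 1)" "- ln (K / (K + 1))" e] by simp
      also have "\<dots> \<le> exp (- e * ln (K / (K + 1)))" by (rule exp_ge_add_one_self)
      also have "\<dots> = (K / (K + 1)) powr - e" using K by (simp add: powr_def)
      finally show ?thesis .
    qed
    ultimately have "K powr - e \<ge> (K + 1) powr - e * (1 + e / (K + 1))"
      by (simp add: mult_left_mono)
    hence "(K powr - e - (K + 1) powr - e) / e \<ge> (K + 1) powr - e / (K + 1)"
      using e K by (simp add: field_simps)
    moreover have "(K + 1) powr - s = (K + 1) powr - e / (K + 1)"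
      using K powr_diff[of "K + 1" "- e" 1] by (simp add: e_def)
    ultimately show ?thesis unfolding u_def K(2) K_def[symmetric] by (simp add: diff_divide_distrib)
  qed
  have sm': "summable (\<lambda>k. real (Suc (Suc k)) powr - s)" using sm by (subst summable_Suc_iff)
  have "(\<Sum>k. real (Suc k) powr - s) = 1 + (\<Sum>k. real (Suc (Suc k)) powr - s)"
    using suminf_split_head[OF sm] by simp
  also have "(\<Sum>k. real (Suc (Suc k)) powr - s) \<le> (\<Sum>k. u k - u (Suc k))"
    by (intro suminf_le le sm' sums_summable[OF t])
  also have "\<dots> = 1 / e" using sums_unique[OF t] by (simp add: u_def)
  finally show ?thesis by (simp add: e_def)
qed

context dirichlet_character
begin

text \<open>Subtracting the vanishing series at \<open>1\<close> changes the weights to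
  \<open>1 / k - k powr - s\<close>, whose total variation is of order \<open>s - 1\<close>. Thus a
  zero at \<open>1\<close> has order at least one, without any differentiation.\<close>

lemma norm_L_series_le_linear:
  assumes sum0: "(\<Sum>k<n. \<psi> k) = 0" and L1: "(\<lambda>k. \<psi> (Suc k) / of_nat (Suc k)) sums 0"
  obtains C where "C > 0" "\<And>s. s > 1 \<Longrightarrow> norm (L_series s) \<le> C * (s - 1)"
proof -
  have sm: "summable (\<lambda>k. real (Suc k) powr - (3/2))"
    using summable_Suc_iff[of "\<lambda>k. real k powr - (3/2)"] by (simp add: summable_real_powr_iff)
  define V where "V = (\<Sum>k. 3 * real (Suc k) powr - (3/2))"
  have "norm (L_series s) \<le> (n * V) * (s - 1)" if s: "s > 1" for s
  proof -
    define w where "w k = 1 / real (Suc k) - real (Suc k) powr - s" for k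
    have le: "\<bar>w k - w (Suc k)\<bar> \<le> (s - 1) * (3 * real (Suc k) powr - (3/2))" for k
      unfolding w_def by (rule powr_weight_diff_bound[OF s])
    have sm': "summable (\<lambda>k. (s - 1) * (3 * real (Suc k) powr - (3/2)))"
      by (intro summable_mult sm)
    have sw: "summable (\<lambda>k. \<bar>w k - w (Suc k)\<bar>)"
      by (rule summable_comparison_test'[OF sm']) (use le in auto)
    have "(\<Sum>k. \<bar>w k - w (Suc k)\<bar>) \<le> (\<Sum>k. (s - 1) * (3 * real (Suc k) powr - (3/2)))"
      by (intro suminf_le le sw sm')
    also have "\<dots> = (s - 1) * V" unfolding V_def by (intro suminf_mult summable_mult sm)
    finally have V: "(\<Sum>k. \<bar>w k - w (Suc k)\<bar>) \<le> (s - 1) * V" .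
    have "w \<longlonglongrightarrow> 0" unfolding w_def using s by real_asymp
    hence "norm (\<Sum>k. w k *\<^sub>R \<psi> (Suc k)) \<le> n * ((s - 1) * V)"
      by (rule summation_by_parts_bounded(2)[OF norm_partial_sum_Suc_le[OF sum0] _ sw V])
    moreover have "(\<lambda>k. \<psi> (Suc k) / of_nat (Suc k) - real (Suc k) powr - s *\<^sub>R \<psi> (Suc k)) sums (0 - L_series s)"
      by (intro sums_diff L1 L_series_sums s)
    hence "(\<lambda>k. w k *\<^sub>R \<psi> (Suc k)) sums (- L_series s)"
      by (simp add: w_def scaleR_conv_of_real algebra_simps)
    ultimately show ?thesis by (simp add: sums_iff mult_ac)
  qed
  moreover have "V \<ge> 0" unfolding V_def by (intro suminf_nonneg summable_mult sm) auto
  ultimately have "norm (L_series s) \<le> (n * V + 1) * (s - 1)" if "s > 1" for s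
    using that by (smt (verit) mult_right_mono)
  thus ?thesis using \<open>V \<ge> 0\<close> by (intro that[of "n * V + 1"]) (auto intro: add_nonneg_pos)
qed

lemma euler_sieve_L_series:
  assumes "s > 1"
  shows "(\<lambda>N. L_series s * (\<Prod>p | prime p \<and> p \<le> N. 1 - \<psi> p * of_real (real p powr - s))) \<longlonglongrightarrow> 1"
  unfolding L_series_def
  by (rule euler_sieve) (use summable_powr[OF assms] in \<open>simp_all add: mult powr_mult\<close>)

text \<open>
  If \<open>L(1) = 0\<close>, then \<open>\<zeta>(s)^3 L(s, \<psi>)^4 L(s, \<psi>^2)\<close> is \<open>O(s - 1)\<close> as \<open>s\<close> decreases to \<open>1\<close>, while by the
  Euler products and the 3-4-1 inequality its modulus is at least \<open>1\<close>.
\<close>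

theorem L1_nonzero_of_nonprincipal_square:
  assumes sum0: "(\<Sum>k<n. \<psi> k) = 0" and sum0': "(\<Sum>k<n. (\<psi> k)\<^sup>2) = 0"
  shows "\<not> (\<lambda>k. \<psi> (Suc k) / of_nat (Suc k)) sums 0"
proof
  assume "(\<lambda>k. \<psi> (Suc k) / of_nat (Suc k)) sums 0"
  then obtain C where C: "C > 0" "\<And>s. s > 1 \<Longrightarrow> norm (L_series s) \<le> C * (s - 1)"
    using norm_L_series_le_linear[OF sum0] by blast
  interpret sq: dirichlet_character n "\<lambda>k. (\<psi> k)\<^sup>2" by (rule psi_square)
  define Z where "Z s = (\<Sum>\<^sub>\<infinity>k. complex_of_real (real k powr - s))" for s
  have key: "1 \<le> norm (Z s) ^ 3 * norm (L_series s) ^ 4 * norm (sq.L_series s)"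
    and Zle: "norm (Z s) \<le> 1 + 1 / (s - 1)" if s: "s > 1" for s
  proof -
    have "summable (\<lambda>k. real k powr - s)" using s by (simp add: summable_real_powr_iff)
    hence sm: "(\<lambda>k. norm (complex_of_real (real k powr - s))) summable_on UNIV"
      by (subst summable_on_UNIV_nonneg_real_iff) auto
    have "Z s = of_real (\<Sum>\<^sub>\<infinity>k. real k powr - s)"
      unfolding Z_def using sm by (intro infsumI has_sum_of_real has_sum_infsum) simp
    moreover have "(\<Sum>\<^sub>\<infinity>k. real k powr - s) = (\<Sum>k. real (Suc k) powr - s)"
    proof -
      have "(\<lambda>k. real k powr - s) sums (\<Sum>\<^sub>\<infinity>k. real k powr - s)"
        using sm by (intro has_sum_imp_sums has_sum_infsum) simp
      hence "(\<lambda>k. real (Suc k) powr - s) sums (\<Sum>\<^sub>\<infinity>k. real k powr - s)"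
        by (subst sums_Suc_iff) simp
      thus ?thesis by (rule sums_unique)
    qed
    ultimately have Z: "norm (Z s) = (\<Sum>k. real (Suc k) powr - s)"
      using suminf_nonneg[of "\<lambda>k. real (Suc k) powr - s"] s summable_Suc_iff[of "\<lambda>k. real k powr - s"]
      by (simp add: summable_real_powr_iff)
    thus "norm (Z s) \<le> 1 + 1 / (s - 1)" using zeta_le[OF s] by simp
    define P where "P N = {p::nat. prime p \<and> p \<le> N}" for N
    define r where "r p = real p powr - s" for p :: nat
    have l1: "(\<lambda>N. Z s * (\<Prod>p\<in>P N. 1 - of_real (r p))) \<longlonglongrightarrow> 1"
      unfolding Z_def P_def r_def by (rule euler_sieve[OF sm]) (auto simp: powr_mult)
    have l2: "(\<lambda>N. L_series s * (\<Prod>p\<in>P N. 1 - of_real (r p) * \<psi> p)) \<longlonglongrightarrow> 1"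
      using euler_sieve_L_series[OF s] unfolding P_def r_def by (simp add: mult.commute)
    have l3: "(\<lambda>N. sq.L_series s * (\<Prod>p\<in>P N. 1 - of_real (r p) * (\<psi> p)\<^sup>2)) \<longlonglongrightarrow> 1"
      using sq.euler_sieve_L_series[OF s] unfolding P_def r_def by (simp add: mult.commute)
    have "(\<lambda>N. norm (Z s * (\<Prod>p\<in>P N. 1 - of_real (r p))) ^ 3 *
        norm (L_series s * (\<Prod>p\<in>P N. 1 - of_real (r p) * \<psi> p)) ^ 4 *
        norm (sq.L_series s * (\<Prod>p\<in>P N. 1 - of_real (r p) * (\<psi> p)\<^sup>2)))
      \<longlonglongrightarrow> norm (1::complex) ^ 3 * norm (1::complex) ^ 4 * norm (1::complex)" (is "?F \<longlonglongrightarrow> _")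
      by (intro tendsto_mult tendsto_power tendsto_norm l1 l2 l3)
    moreover have "?F N \<le> norm (Z s) ^ 3 * norm (L_series s) ^ 4 * norm (sq.L_series s)" for N
    proof -
      have "?F N = (norm (Z s) ^ 3 * norm (L_series s) ^ 4 * norm (sq.L_series s)) *
          (\<Prod>p\<in>P N. norm (1 - of_real (r p) :: complex) ^ 3 * norm (1 - of_real (r p) * \<psi> p) ^ 4 *
            norm (1 - of_real (r p) * (\<psi> p)\<^sup>2))"
        by (simp add: norm_mult power_mult_distrib prod_norm[symmetric] prod.distrib prod_power_distrib mult_ac)
      also have "\<dots> \<le> (norm (Z s) ^ 3 * norm (L_series s) ^ 4 * norm (sq.L_series s)) * 1"
      proof (intro mult_left_mono prod_le_1 conjI)
        fix p assume "p \<in> P N"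
        hence "real p > 1" by (auto simp: P_def dest: prime_gt_1_nat)
        hence "r p < 1" "r p \<ge> 0" using s powr_less_one[of "real p" "- s"] by (auto simp: r_def)
        thus "norm (1 - of_real (r p) :: complex) ^ 3 * norm (1 - of_real (r p) * \<psi> p) ^ 4 *
            norm (1 - of_real (r p) * (\<psi> p)\<^sup>2) \<le> 1"
          by (intro three_four_one norm_le_1)
      qed auto
      finally show ?thesis by simp
    qed
    ultimately show "1 \<le> norm (Z s) ^ 3 * norm (L_series s) ^ 4 * norm (sq.L_series s)"
      using LIMSEQ_le_const2 by (metis (no_types, lifting) mult_1 norm_one power_one)
  qed
  have bound: "1 \<le> 8 * C ^ 4 * real n * e" if e: "0 < e" "e \<le> 1" for e
  proof -
    have "1 \<le> norm (Z (1 + e)) ^ 3 * norm (L_series (1 + e)) ^ 4 * norm (sq.L_series (1 + e))"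
      using e by (intro key) auto
    also have "\<dots> \<le> (2 / e) ^ 3 * (C * e) ^ 4 * n"
    proof (intro mult_mono power_mono)
      have "norm (Z (1 + e)) \<le> 1 + 1 / e" using Zle[of "1 + e"] e by simp
      also have "\<dots> \<le> 2 / e" using e by (simp add: field_simps)
      finally show "norm (Z (1 + e)) \<le> 2 / e" .
      show "norm (L_series (1 + e)) \<le> C * e" using C(2)[of "1 + e"] e by simp
      show "norm (sq.L_series (1 + e)) \<le> n" using e by (intro sq.norm_L_series_le sum0') auto
    qed (use e C in auto)
    also have "\<dots> = 8 * C ^ 4 * real n * e" using e by (simp add: field_simps power_numeral_reduce)
    finally show ?thesis .
  qed
  define D where "D = 8 * C ^ 4 * real n"
  have D: "D > 0" using C n_gt_1 by (simp add: D_def)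
  have "1 \<le> D * min 1 (1 / (2 * D))" unfolding D_def using D by (intro bound) (auto simp: D_def[symmetric])
  also have "\<dots> \<le> D * (1 / (2 * D))" using D by (intro mult_left_mono) auto
  finally show False using D by simp
qed

end

section \<open>Nonvanishing of L(1) for real characters\<close>

text \<open>Raising the exponent to \<open>e + 1\<close> adds exactly the divisors
  \<open>p ^ Suc e * d\<close> with \<open>d\<close> dividing \<open>m\<close>.\<close>

lemma divisor_sum_prime_power_mult:
  fixes h :: "nat \<Rightarrow> real"
  assumes p: "prime p" and m: "\<not> p dvd m" and mult: "\<And>a b. h (a * b) = h a * h b" and h1: "h 1 = 1"
  shows "(\<Sum>d | d dvd p ^ e * m. h d) = (\<Sum>i\<le>e. h p ^ i) * (\<Sum>d | d dvd m. h d)"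
proof (induction e)
  case 0
  show ?case by simp
next
  case (Suc e)
  have m0: "m > 0" using m by (cases m) auto
  have p0: "p > 0" using p prime_gt_0_nat by blast
  have hp: "h (p ^ j) = h p ^ j" for j by (induction j) (use h1 in \<open>simp_all add: mult\<close>)
  have split: "{d. d dvd p ^ Suc e * m} = {d. d dvd p ^ e * m} \<union> (\<lambda>d. p ^ Suc e * d) ` {d. d dvd m}"
  proof (intro equalityI subsetI)
    fix d assume "d \<in> {d. d dvd p ^ Suc e * m}"
    hence d: "d dvd p ^ Suc e * m" by simp
    have d0: "d \<noteq> 0" using d m0 p0 by (intro notI) simp
    have np: "\<not> is_unit p" using p by auto
    obtain c where c: "d = p ^ multiplicity p d * c" "\<not> p dvd c"
      using multiplicity_decompose'[OF d0 np] by metis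
    have "coprime p c" using c(2) p by (rule prime_imp_coprime[rotated])
    hence "coprime c (p ^ Suc e)" by (simp only: coprime_commute[of c] coprime_power_left_iff) simp
    moreover have "c dvd p ^ Suc e * m" using d c(1) dvd_mult_right by metis
    ultimately have cm: "c dvd m" by (simp add: coprime_dvd_mult_right_iff)
    have "coprime (p ^ multiplicity p d) m"
      using m p by (simp add: prime_imp_coprime)
    moreover have "p ^ multiplicity p d dvd p ^ Suc e * m" using d c(1) dvd_mult_left by metis
    ultimately have "p ^ multiplicity p d dvd p ^ Suc e" by (simp only: coprime_dvd_mult_left_iff)
    hence "multiplicity p d \<le> Suc e" using prime_gt_1_nat[OF p] by (simp only: dvd_power_iff_le)
    then consider "multiplicity p d \<le> e" | "multiplicity p d = Suc e" by linarith
    thus "d \<in> {d. d dvd p ^ e * m} \<union> (\<lambda>d. p ^ Suc e * d) ` {d. d dvd m}"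
    proof cases
      case 1
      hence "d dvd p ^ e * m" using cm c(1) by (metis le_imp_power_dvd mult_dvd_mono)
      thus ?thesis by simp
    next
      case 2
      thus ?thesis using cm c(1) by auto
    qed
  qed (auto intro: dvd_trans)
  have disj: "{d. d dvd p ^ e * m} \<inter> (\<lambda>d. p ^ Suc e * d) ` {d. d dvd m} = {}"
  proof -
    have False if "p ^ Suc e * d dvd p ^ e * m" for d
    proof -
      have "p ^ e * (p * d) dvd p ^ e * m" using that by (simp add: mult_ac)
      hence "p * d dvd m" using p0 by simp
      thus False using m dvd_mult_left by blast
    qed
    thus ?thesis by blast
  qed
  have "(\<Sum>d | d dvd p ^ Suc e * m. h d) = (\<Sum>d | d dvd p ^ e * m. h d) + sum h ((\<lambda>d. p ^ Suc e * d) ` {d. d dvd m})"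
    unfolding split using m0 p0 by (intro sum.union_disjoint disj) auto
  also have "sum h ((\<lambda>d. p ^ Suc e * d) ` {d. d dvd m}) = (\<Sum>d | d dvd m. h p ^ Suc e * h d)"
    using p0 by (subst sum.reindex) (auto simp: inj_on_def mult hp)
  also have "\<dots> = h p ^ Suc e * (\<Sum>d | d dvd m. h d)" by (simp only: sum_distrib_left)
  finally show ?case unfolding Suc by (simp add: algebra_simps)
qed

text \<open>These are the coefficients of \<open>\<zeta>(s) L(s, h)\<close>. The factor at
  \<open>p\<close> is a geometric sum with ratio \<open>1\<close>, \<open>0\<close> or
  \<open>-1\<close>: always nonnegative, and at least \<open>1\<close> when the exponent is
  even.\<close>

lemma divisor_sum_real_character:
  fixes h :: "nat \<Rightarrow> real"
  assumes mult: "\<And>a b. h (a * b) = h a * h b" and h1: "h 1 = 1" and h: "\<And>k. h k \<in> {-1, 0, 1}"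
    and m: "m > 0"
  shows "(\<Sum>d | d dvd m. h d) \<ge> 0 \<and> (\<Sum>d | d dvd m\<^sup>2. h d) \<ge> 1"
  using m
proof (induction m rule: less_induct)
  case (less m)
  show ?case
  proof (cases "m = 1")
    case True
    thus ?thesis using h1 by simp
  next
    case False
    then obtain p where p: "prime p" "p dvd m" using prime_factor_nat by blast
    have np: "\<not> is_unit p" using p by auto
    define e where "e = multiplicity p m"
    obtain c where c: "m = p ^ e * c" "\<not> p dvd c"
      unfolding e_def using multiplicity_decompose'[of m p] less.prems np by blast
    have "e > 0" using c p(2) by (cases e) auto
    hence "p ^ e > 1" using prime_gt_1_nat[OF p(1)] by (intro one_less_power)
    moreover have "c > 0" using c(1) less.prems by (cases c) auto
    ultimately have IH: "(\<Sum>d | d dvd c. h d) \<ge> 0" "(\<Sum>d | d dvd c\<^sup>2. h d) \<ge> 1"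
      using less.IH[of c] c(1) by auto
    have geom: "(\<Sum>i\<le>e. h p ^ i) \<ge> 0" "(\<Sum>i\<le>2 * e. h p ^ i) \<ge> 1" for e
    proof -
      consider "h p = 1" | "h p = 0" | "h p = -1" using h[of p] by auto
      thus "(\<Sum>i\<le>e. h p ^ i) \<ge> 0"
      proof cases
        case 3
        have "(\<Sum>i\<le>e. (-1::real) ^ i) = (if even e then 1 else 0)" for e by (induction e) auto
        thus ?thesis using 3 by simp
      qed (simp_all add: sum_nonneg)
      consider "h p = 1" | "h p = 0" | "h p = -1" using h[of p] by auto
      thus "(\<Sum>i\<le>2 * e. h p ^ i) \<ge> 1"
      proof cases
        case 3
        have "(\<Sum>i\<le>e. (-1::real) ^ i) = (if even e then 1 else 0)" for e by (induction e) auto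
        thus ?thesis using 3 by simp
      qed (simp_all add: power_0_left)
    qed
    have c2: "\<not> p dvd c\<^sup>2" using c(2) p(1) prime_dvd_power by blast
    have "m\<^sup>2 = p ^ (2 * e) * c\<^sup>2" using c(1) by (simp add: power_mult_distrib power_mult[symmetric] mult.commute)
    hence "(\<Sum>d | d dvd m\<^sup>2. h d) = (\<Sum>i\<le>2 * e. h p ^ i) * (\<Sum>d | d dvd c\<^sup>2. h d)"
      using divisor_sum_prime_power_mult[OF p(1) c2 mult h1] by simp
    moreover have "(\<Sum>d | d dvd m. h d) = (\<Sum>i\<le>e. h p ^ i) * (\<Sum>d | d dvd c. h d)"
      unfolding c(1) using divisor_sum_prime_power_mult[OF p(1) c(2) mult h1] by simp
    ultimately show ?thesis using IH geom
      mult_mono[OF geom(2)[of e] IH(2)] by auto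
  qed
qed

text \<open>The double sum of \<open>h k * t ^ m\<close> over pairs with \<open>k dvd m\<close>,
  evaluated in both orders; it converges absolutely because \<open>m\<close> has at most
  \<open>m\<close> divisors.\<close>

lemma lambert_series:
  fixes h :: "nat \<Rightarrow> real" and t :: real
  assumes t: "0 < t" "t < 1" and h: "\<And>k. \<bar>h k\<bar> \<le> 1"
  defines "A \<equiv> \<lambda>m. \<Sum>d | d dvd m. h d"
  shows "(\<lambda>m. A m * t ^ m) summable_on {1..}"
    and "(\<lambda>k. h (Suc k) * (t ^ Suc k / (1 - t ^ Suc k))) sums (\<Sum>\<^sub>\<infinity>m\<in>{1..}. A m * t ^ m)"
proof -
  define F where "F = (\<lambda>(m, k). h k * t ^ m)"
  define S where "S = Sigma {1::nat..} (\<lambda>m. {k. k dvd m})"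
  have fin: "finite {k. k dvd m}" if "m \<in> {1..}" for m :: nat using that by auto
  have abs: "(\<lambda>x. norm (F x)) summable_on S"
    unfolding S_def
  proof (subst Infinite_Sum.abs_summable_on_Sigma_iff, intro conjI ballI)
    fix m :: nat assume "m \<in> {1..}"
    thus "(\<lambda>y. norm (F (m, y))) summable_on {k. k dvd m}" by (intro summable_on_finite fin)
  next
    have "summable (\<lambda>m. norm (real m * t ^ m))"
    proof -
      have "summable (\<lambda>m. of_nat m * t ^ m)"
      proof -
        have "summable (\<lambda>m. t * (of_nat (Suc m) * t ^ m))"
          using geometric_deriv_sums[of t] t by (intro summable_mult) (auto simp: sums_iff)
        hence "summable (\<lambda>m. of_nat (Suc m) * t ^ Suc m)" by (simp add: mult_ac)
        thus ?thesis by (subst (asm) summable_Suc_iff)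
      qed
      thus ?thesis using t by (simp add: abs_mult)
    qed
    hence s: "(\<lambda>m. real m * t ^ m) summable_on {1..}"
      by (intro norm_summable_imp_summable_on[THEN summable_on_subset_banach]) auto
    show "(\<lambda>m. norm (\<Sum>\<^sub>\<infinity>y\<in>{k. k dvd m}. norm (F (m, y)))) summable_on {1..}"
    proof (rule summable_on_comparison_test[OF s])
      fix m :: nat assume m: "m \<in> {1..}"
      have "norm (\<Sum>\<^sub>\<infinity>y\<in>{k. k dvd m}. norm (F (m, y))) = (\<Sum>k | k dvd m. \<bar>h k\<bar> * t ^ m)"
        using fin[OF m] t by (simp add: F_def abs_mult sum_nonneg)
      also have "\<dots> \<le> (\<Sum>k | k dvd m. t ^ m)"
        using h t by (intro sum_mono) (auto intro: mult_left_le_one_le)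
      also have "\<dots> \<le> (\<Sum>k \<in> {1..m}. t ^ m)"
        using m t by (intro sum_mono2) (auto simp: dvd_imp_le Suc_le_eq dvd_pos_nat)
      finally show "norm (\<Sum>\<^sub>\<infinity>y\<in>{k. k dvd m}. norm (F (m, y))) \<le> real m * t ^ m" by simp
    qed auto
  qed
  have sF: "F summable_on S" using abs by (rule abs_summable_summable)
  have inner: "(\<Sum>\<^sub>\<infinity>k\<in>{k. k dvd m}. F (m, k)) = A m * t ^ m" if "m \<in> {1..}" for m
    using fin[OF that] by (simp add: F_def A_def sum_distrib_right)
  have "(\<lambda>m. \<Sum>\<^sub>\<infinity>k\<in>{k. k dvd m}. F (m, k)) summable_on {1..}"
    using summable_on_Sigma_banach[of "\<lambda>m k. F (m, k)" "{1..}" "\<lambda>m. {k. k dvd m}"] sF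
    unfolding S_def by simp
  thus "(\<lambda>m. A m * t ^ m) summable_on {1..}" by (rule summable_on_cong[THEN iffD1, rotated]) (rule inner)
  have e1: "(\<Sum>\<^sub>\<infinity>m\<in>{1..}. A m * t ^ m) = infsum F S"
  proof -
    have "(\<Sum>\<^sub>\<infinity>m\<in>{1..}. A m * t ^ m) = (\<Sum>\<^sub>\<infinity>m\<in>{1..}. \<Sum>\<^sub>\<infinity>k\<in>{k. k dvd m}. F (m, k))"
      by (intro infsum_cong inner[symmetric])
    also have "\<dots> = infsum F S"
      using infsum_Sigma'_banach[of "\<lambda>m k. F (m, k)" "{1..}" "\<lambda>m. {k. k dvd m}"] sF
      unfolding S_def by simp
    finally show ?thesis .
  qed
  \<comment> \<open>The same pairs, now listed by \<open>k\<close> and its positive multiples, so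
    that the inner sums are geometric.\<close>
  define T where "T = Sigma {1::nat..} (\<lambda>k. (*) k ` {1..})"
  have ST: "S = prod.swap ` T"
    unfolding S_def T_def by (auto simp: image_iff elim!: dvdE intro: dvd_pos_nat Suc_leI)
  have sG: "(\<lambda>x. F (prod.swap x)) summable_on T"
    using sF unfolding ST by (subst (asm) summable_on_reindex) (auto simp: o_def)
  have e2: "infsum F S = infsum (\<lambda>x. F (prod.swap x)) T"
    unfolding ST by (subst infsum_reindex) (auto simp: o_def)
  have geo: "((\<lambda>m. F (m, k)) has_sum (h k * (t ^ k / (1 - t ^ k)))) ((*) k ` {1..})" if "k \<in> {1..}" for k
  proof -
    have tk: "0 < t ^ k" "t ^ k < 1" using that t by (auto simp: power_less_one_iff)
    have "((\<lambda>j. (t ^ k) ^ Suc j) has_sum (t ^ k * (1 / (1 - t ^ k)))) UNIV"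
      unfolding power_Suc using tk
      by (intro has_sum_cmult_right norm_summable_imp_has_sum geometric_sums) (auto simp: summable_geometric)
    hence "((\<lambda>j. h k * t ^ (k * Suc j)) has_sum (h k * (t ^ k * (1 / (1 - t ^ k))))) UNIV"
      unfolding power_mult[symmetric] by (rule has_sum_cmult_right)
    moreover have "(*) k ` {1..} = (\<lambda>j. k * Suc j) ` UNIV"
    proof -
      have "{1::nat..} = range Suc" by (metis One_nat_def atLeast_Suc_greaterThan greaterThan_0)
      thus ?thesis by (simp add: image_image)
    qed
    ultimately show ?thesis using that by (simp add: has_sum_reindex inj_on_def o_def F_def del: mult_Suc_right)
  qed
  have "((\<lambda>k. h k * (t ^ k / (1 - t ^ k))) has_sum (infsum (\<lambda>x. F (prod.swap x)) T)) {1..}"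
    using has_sum_SigmaD[OF has_sum_infsum[OF sG, unfolded T_def], of "\<lambda>k. h k * (t ^ k / (1 - t ^ k))"] geo
    by (simp add: T_def)
  hence "((\<lambda>k. h k * (t ^ k / (1 - t ^ k))) has_sum (\<Sum>\<^sub>\<infinity>m\<in>{1..}. A m * t ^ m)) (range Suc)"
    unfolding e1 e2 by (metis One_nat_def atLeast_Suc_greaterThan greaterThan_0)
  hence "((\<lambda>k. h (Suc k) * (t ^ Suc k / (1 - t ^ Suc k))) has_sum (\<Sum>\<^sub>\<infinity>m\<in>{1..}. A m * t ^ m)) UNIV"
    by (subst (asm) has_sum_reindex) (auto simp: o_def)
  thus "(\<lambda>k. h (Suc k) * (t ^ Suc k / (1 - t ^ Suc k))) sums (\<Sum>\<^sub>\<infinity>m\<in>{1..}. A m * t ^ m)"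
    by (rule has_sum_imp_sums)
qed

text \<open>Arithmetic-geometric mean: the average of \<open>1, q^2, ..., q^(2k)\<close> is at least
  their geometric mean \<open>q^k\<close>. The induction uses Bernoulli's inequality
  instead.\<close>

lemma one_minus_power_ge:
  fixes q :: real assumes q: "0 < q" "q < 1"
  shows "1 - q ^ (2 * Suc k) \<ge> real (Suc k) * q ^ k * (1 - q\<^sup>2)"
proof (induction k)
  case 0
  show ?case by (simp add: power2_eq_square)
next
  case (Suc k)
  define r where "r = real (Suc k)"
  have "1 + r * (q - 1) \<le> q ^ Suc k"
    using Bernoulli_inequality[of "q - 1" "Suc k"] q by (simp add: r_def)
  hence "1 - q ^ Suc k \<le> r * (1 - q)" by (simp add: algebra_simps)
  hence "q * (1 - q ^ Suc k) \<le> 1 * (r * (1 - q))"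
    using q power_le_one[of q "Suc k"] by (intro mult_mono) auto
  hence "q ^ k * (q * (1 - q ^ Suc k)) \<le> q ^ k * (r * (1 - q))"
    using q by (intro mult_left_mono) auto
  hence "(r + 1) * q ^ Suc k \<le> r * q ^ k + q ^ (2 * Suc k)"
    by (simp add: algebra_simps power_add[symmetric] mult_2 mult_2_right)
  hence "(r + 1) * q ^ Suc k * (1 - q\<^sup>2) \<le> (r * q ^ k + q ^ (2 * Suc k)) * (1 - q\<^sup>2)"
    using q by (intro mult_right_mono) (auto simp: power_le_one)
  also have "\<dots> = r * q ^ k * (1 - q\<^sup>2) + q ^ (2 * Suc k) * (1 - q\<^sup>2)" by (simp only: distrib_right)
  also have "\<dots> \<le> (1 - q ^ (2 * Suc k)) + q ^ (2 * Suc k) * (1 - q\<^sup>2)"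
    using Suc.IH by (simp add: r_def)
  also have "\<dots> = 1 - q ^ (2 * Suc (Suc k))" by (simp add: algebra_simps power2_eq_square)
  finally show ?case by (simp add: r_def)
qed

text \<open>With \<open>K = Suc k\<close>, the terms \<open>t^K / (1 - t^K)\<close> drop by
  \<open>t^K (1 - t) / ((1 - t^K) (1 - t^(K+1)))\<close>, and the mean inequality bounds the
  denominator from below. Writing \<open>t\<close> as a square avoids the half-integral powers of
  \<open>t\<close> in that bound.\<close>

lemma lambert_weight_decreasing:
  fixes q :: real assumes q: "0 < q" "q < 1"
  defines "t \<equiv> q\<^sup>2"
  defines "b \<equiv> \<lambda>k. 1 / (real (Suc k) * (1 - t)) - t ^ Suc k / (1 - t ^ Suc k)"
  shows "b (Suc k) \<le> b k"
proof -
  have t: "0 < t" "t < 1" using q by (auto simp: t_def power_less_one_iff)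
  define x y K where "x = 1 - t ^ Suc k" and "y = 1 - t ^ Suc (Suc k)" and "K = real (Suc k)"
  have K: "K > 0" "real (Suc (Suc k)) = K + 1" by (simp_all add: K_def)
  have x: "x \<ge> K * q ^ k * (1 - t)" and y: "y \<ge> (K + 1) * q ^ Suc k * (1 - t)"
    using one_minus_power_ge[OF q, of k] one_minus_power_ge[OF q, of "Suc k"]
    unfolding x_def y_def t_def power_mult[symmetric] K(2) K_def[symmetric] by blast+
  have xp: "x > 0" "y > 0" using t by (auto simp: x_def y_def power_less_one_iff simp del: power_Suc)
  have "K * (K + 1) * t ^ Suc k * (1 - t)\<^sup>2 \<le> K * (K + 1) * q ^ (k + Suc k) * (1 - t)\<^sup>2"
    using q K unfolding t_def power_mult[symmetric]
    by (intro mult_right_mono mult_left_mono power_decreasing) auto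
  also have "\<dots> = (K * q ^ k * (1 - t)) * ((K + 1) * q ^ Suc k * (1 - t))"
    by (simp only: power_add power2_eq_square mult_ac)
  also have "\<dots> \<le> x * y" using q K t xp by (intro mult_mono x y) auto
  finally have xy: "K * (K + 1) * t ^ Suc k * (1 - t)\<^sup>2 \<le> x * y" .
  have "t ^ Suc k / x - t ^ Suc (Suc k) / y = t ^ Suc k * (1 - t) / (x * y)"
    using xp by (simp add: divide_simps) (simp add: x_def y_def algebra_simps)
  also have "\<dots> \<le> 1 / (K * (K + 1) * (1 - t))"
    using xy xp t K by (simp add: divide_simps power2_eq_square mult_ac)
  also have "\<dots> = 1 / (K * (1 - t)) - 1 / ((K + 1) * (1 - t))"
    using t K by (simp add: divide_simps)
  finally show ?thesis unfolding b_def K(2) x_def y_def K_def by linarith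
qed

context dirichlet_character
begin

text \<open>
  Monsky's argument. Let \<open>A m = (\<Sum>d | d dvd m. h d)\<close>. If \<open>L(1) = 0\<close>, the Lambert series \<open>\<Sum> A m t^m\<close>
  equals \<open>- \<Sum> b k h (k + 1)\<close> with decreasing weights \<open>b\<close> and \<open>b 0 = 1\<close>, so it is bounded by \<open>n\<close>
  for all \<open>t < 1\<close>; but \<open>A m \<ge> 0\<close> and \<open>A (j^2) \<ge> 1\<close> make it unbounded as \<open>t\<close> tends to \<open>1\<close>.
\<close>

theorem L1_nonzero_of_real:
  assumes sum0: "(\<Sum>k<n. \<psi> k) = 0" and real: "\<And>k. coprime k n \<Longrightarrow> (\<psi> k)\<^sup>2 = 1"
  shows "\<not> (\<lambda>k. \<psi> (Suc k) / of_nat (Suc k)) sums 0"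
proof
  assume L1: "(\<lambda>k. \<psi> (Suc k) / of_nat (Suc k)) sums 0"
  define h where "h k = Re (\<psi> k)" for k
  have psi: "\<psi> k \<in> {-1, 0, 1}" for k
    using real[of k] nonzero_iff[of k] power2_eq_1_iff[of "\<psi> k"] by blast
  have ph: "\<psi> k = of_real (h k)" for k using psi[of k] by (auto simp: h_def)
  have h: "h k \<in> {-1, 0, 1}" for k using psi[of k] by (auto simp: h_def)
  have h_le: "\<bar>h k\<bar> \<le> 1" for k using h[of k] by auto
  have hm: "h (a * b) = h a * h b" for a b using mult[of a b] unfolding ph by (metis of_real_eq_iff of_real_mult)
  have h1: "h 1 = 1" by (simp add: h_def)
  define A where "A m = (\<Sum>d | d dvd m. h d)" for m
  have A: "m > 0 \<Longrightarrow> A m \<ge> 0" "m > 0 \<Longrightarrow> A (m\<^sup>2) \<ge> 1" for m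
    using divisor_sum_real_character[OF hm h1 h] by (auto simp: A_def)
  \<comment> \<open>The squares up to \<open>J^2\<close> contribute at least \<open>1/2\<close>
    each, so \<open>J = 2 * n + 1\<close> terms exceed \<open>n\<close>. The choice of
    \<open>q\<close> makes \<open>q ^ (2 * j^2) \<ge> 1/2\<close> for all \<open>j \<le> J\<close>
    by Bernoulli's inequality.\<close>
  define J where "J = 2 * n + 1"
  define q where "q = 1 - 1 / (4 * real J ^ 2)"
  have J: "real J \<ge> 1" by (simp add: J_def)
  have J2: "real J ^ 2 \<ge> 1" using J by simp
  have "1 / (4 * real J ^ 2) < 1" using J2 by (subst divide_less_eq) auto
  moreover have "1 / (4 * real J ^ 2) > 0" using J by (intro divide_pos_pos) auto
  ultimately have q: "0 < q" "q < 1" unfolding q_def by linarith+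
  define t where "t = q\<^sup>2"
  have t: "0 < t" "t < 1" using q by (auto simp: t_def power_less_one_iff)
  define f where "f = (\<Sum>\<^sub>\<infinity>m\<in>{1..}. A m * t ^ m)"
  have lam: "(\<lambda>m. A m * t ^ m) summable_on {1..}"
    "(\<lambda>k. h (Suc k) * (t ^ Suc k / (1 - t ^ Suc k))) sums f"
    unfolding f_def A_def by (rule lambert_series[OF t h_le])+
  \<comment> \<open>As \<open>t\<close> tends to \<open>1\<close>, \<open>t^K / (1 - t^K)\<close>
    blows up like \<open>1 / (K * (1 - t))\<close>. Subtracting it from the latter, a multiple of
    the weights of the vanishing \<open>L(1)\<close>, leaves weights bounded uniformly in
    \<open>t\<close>.\<close>
  define b where "b k = 1 / (real (Suc k) * (1 - t)) - t ^ Suc k / (1 - t ^ Suc k)" for k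
  have "b (Suc k) \<le> b k" for k
    unfolding b_def t_def by (rule lambert_weight_decreasing[OF q])
  moreover have "b \<longlonglongrightarrow> 0" unfolding b_def using t by real_asymp
  moreover have "norm (\<Sum>k<N. h (Suc k)) \<le> n" for N
    using norm_partial_sum_Suc_le[OF sum0, of N] unfolding ph of_real_sum[symmetric] norm_of_real by simp
  ultimately have "norm (\<Sum>k. b k *\<^sub>R h (Suc k)) \<le> n * b 0"
    by (intro summation_by_parts_decreasing(2))
  moreover have "b 0 = 1" using t by (simp add: b_def field_simps)
  moreover have "(\<lambda>k. b k *\<^sub>R h (Suc k)) sums (0 / (1 - t) - f)"
  proof -
    have "(\<lambda>k. Re (\<psi> (Suc k) / of_nat (Suc k))) sums Re 0" by (rule sums_Re[OF L1])
    hence "(\<lambda>k. h (Suc k) / real (Suc k)) sums 0" unfolding ph by (simp del: of_nat_Suc)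
    hence "(\<lambda>k. h (Suc k) / real (Suc k) / (1 - t) - h (Suc k) * (t ^ Suc k / (1 - t ^ Suc k))) sums (0 / (1 - t) - f)"
      by (intro sums_diff sums_divide lam)
    thus ?thesis by (simp add: b_def algebra_simps del: of_nat_Suc power_Suc)
  qed
  ultimately have "\<bar>f\<bar> \<le> n" by (simp add: sums_iff)
  moreover have "f \<ge> J / 2"
  proof -
    have "real J / 2 = (\<Sum>j\<in>{1..J}. 1 / 2)" by simp
    also have "\<dots> \<le> (\<Sum>j\<in>{1..J}. A (j\<^sup>2) * t ^ j\<^sup>2)"
    proof (rule sum_mono)
      fix j assume j: "j \<in> {1..J}"
      have "1 + real (2 * j\<^sup>2) * (q - 1) \<le> q ^ (2 * j\<^sup>2)"
        using Bernoulli_inequality[of "q - 1" "2 * j\<^sup>2"] q by simp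
      moreover have "real (j\<^sup>2) \<le> real J ^ 2" using j by (simp add: power_mono)
      hence "real (j\<^sup>2) / real J ^ 2 \<le> 1" using J by (subst divide_le_eq_1_pos) auto
      hence "1 / 2 \<le> 1 + real (2 * j\<^sup>2) * (q - 1)" by (simp add: q_def algebra_simps)
      ultimately have "1 * (1 / 2) \<le> A (j\<^sup>2) * t ^ j\<^sup>2"
        using A(2)[of j] j by (intro mult_mono) (auto simp: t_def power_mult)
      thus "1 / 2 \<le> A (j\<^sup>2) * t ^ j\<^sup>2" by simp
    qed
    also have "\<dots> = (\<Sum>m\<in>power2 ` {1..J}. A m * t ^ m)"
      by (subst sum.reindex) (auto simp: inj_on_def o_def)
    also have "\<dots> \<le> f" unfolding f_def
      using t A by (intro finite_sum_le_infsum lam) auto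
    finally show ?thesis .
  qed
  ultimately show False by (simp add: J_def)
qed

text \<open>If the square of the character is not \<open>1\<close> at some unit \<open>u\<close>,
  multiplication by \<open>u\<close> permutes the residues and scales the sum of
  \<open>(\<psi> k)^2\<close> by a factor other than \<open>1\<close>, so that sum vanishes.\<close>

theorem L1_nonzero:
  assumes sum0: "(\<Sum>k<n. \<psi> k) = 0"
  shows "\<not> (\<lambda>k. \<psi> (Suc k) / of_nat (Suc k)) sums 0"
proof (cases "\<forall>k. coprime k n \<longrightarrow> (\<psi> k)\<^sup>2 = 1")
  case True
  thus ?thesis using L1_nonzero_of_real[OF sum0] by blast
next
  case False
  then obtain u where u: "coprime u n" "(\<psi> u)\<^sup>2 \<noteq> 1" by blast
  have "bij_betw (\<lambda>k. u * k mod n) {..<n} {..<n}"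
  proof (rule bij_betwI')
    fix k l assume "k \<in> {..<n}" "l \<in> {..<n}"
    thus "(u * k mod n = u * l mod n) = (k = l)"
      using cong_mult_lcancel_nat[OF u(1), of k l] by (auto simp: cong_def)
  next
    fix l assume l: "l \<in> {..<n}"
    obtain v where "[u * v = 1] (mod n)" using cong_solve_coprime_nat[OF u(1)] by auto
    hence "[u * v * l = 1 * l] (mod n)" by (rule cong_scalar_right)
    hence "[u * (v * l mod n) = l] (mod n)" by (simp add: cong_def mod_mult_right_eq mult.assoc)
    thus "\<exists>k\<in>{..<n}. l = u * k mod n" using l n_gt_1
      by (intro bexI[of _ "v * l mod n"]) (auto simp: cong_def)
  qed (use n_gt_1 in auto)
  hence "(\<Sum>k<n. (\<psi> k)\<^sup>2) = (\<Sum>k<n. (\<psi> (u * k mod n))\<^sup>2)" by (rule sum.reindex_bij_betw[symmetric])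
  also have "\<dots> = (\<psi> u)\<^sup>2 * (\<Sum>k<n. (\<psi> k)\<^sup>2)"
    by (simp add: psi_mod mult power_mult_distrib sum_distrib_left)
  finally have "(\<Sum>k<n. (\<psi> k)\<^sup>2) = 0" using u(2) by simp
  thus ?thesis by (rule L1_nonzero_of_nonprincipal_square[OF sum0])
qed

end

section \<open>Joint eigenfunctions of translations\<close>

context dirichlet_character
begin

text \<open>Abel's theorem with an explicit error: the weights \<open>(1 - r^K) / K\<close> decrease
  from \<open>1 - r\<close>, so the series at \<open>r\<close> is within \<open>n * (1 - r)\<close>
  of the one at \<open>1\<close>.\<close>

lemma L1_sums_zero_of_abel_limit:
  assumes sum0: "(\<Sum>k<n. \<psi> k) = 0"
    and lim: "((\<lambda>r::real. \<Sum>k. (r ^ Suc k / real (Suc k)) *\<^sub>R \<psi> (Suc k)) \<longlongrightarrow> 0) (at_left (1::real))"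
  shows "(\<lambda>k. \<psi> (Suc k) / of_nat (Suc k)) sums 0"
proof -
  have s1: "summable (\<lambda>k. (1 / real (Suc k)) *\<^sub>R \<psi> (Suc k))"
  proof (rule summation_by_parts_decreasing(1)[OF norm_partial_sum_Suc_le[OF sum0]])
    show "(\<lambda>k. 1 / real (Suc k)) \<longlonglongrightarrow> 0" by real_asymp
  qed (simp add: field_simps)
  define L where "L = (\<Sum>k. (1 / real (Suc k)) *\<^sub>R \<psi> (Suc k))"
  have bound: "norm (L - (\<Sum>k. (r ^ Suc k / real (Suc k)) *\<^sub>R \<psi> (Suc k))) \<le> n * (1 - r)"
    if r: "0 < r" "r < 1" for r :: real
  proof -
    have aux: "real (Suc k) * r ^ Suc k * (1 - r) \<le> 1 - r ^ Suc k" for k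
    proof (induction k)
      case 0
      have "r * (1 - r) \<le> 1 * (1 - r)" using r by (intro mult_right_mono) auto
      thus ?case by simp
    next
      case (Suc k)
      have "real (Suc (Suc k)) * r ^ Suc (Suc k) * (1 - r) =
          r * (real (Suc k) * r ^ Suc k * (1 - r)) + r ^ Suc (Suc k) * (1 - r)"
        by (simp add: algebra_simps)
      also have "\<dots> \<le> r * (1 - r ^ Suc k) + r ^ Suc (Suc k) * (1 - r)"
        using Suc.IH r by (intro add_right_mono mult_left_mono) auto
      also have "\<dots> = (r - 1 + r ^ Suc (Suc k) * (1 - r)) + (1 - r ^ Suc (Suc k))"
        by (simp add: algebra_simps)
      also have "r ^ Suc (Suc k) * (1 - r) \<le> 1 * (1 - r)"
        using r power_le_one[of r "Suc (Suc k)"] by (intro mult_right_mono) auto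
      finally show ?case by simp
    qed
    define w where "w k = (1 - r ^ Suc k) / real (Suc k)" for k
    have dec: "w (Suc k) \<le> w k" for k
    proof -
      define K where "K = real (Suc k)"
      have K: "K > 0" "real (Suc (Suc k)) = K + 1" by (simp_all add: K_def)
      have "K * r ^ Suc k * (1 - r) \<le> 1 - r ^ Suc k" unfolding K_def by (rule aux)
      thus ?thesis unfolding w_def K(2) K_def[symmetric] using K(1)
        by (simp add: divide_simps) (simp add: algebra_simps)
    qed
    have w0: "w \<longlonglongrightarrow> 0" unfolding w_def using r by real_asymp
    have sr: "summable (\<lambda>k. (r ^ Suc k / real (Suc k)) *\<^sub>R \<psi> (Suc k))"
    proof (rule summation_by_parts_decreasing(1)[OF norm_partial_sum_Suc_le[OF sum0]])
      show "(\<lambda>k. r ^ Suc k / real (Suc k)) \<longlonglongrightarrow> 0" using r by real_asymp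
      fix k show "r ^ Suc (Suc k) / real (Suc (Suc k)) \<le> r ^ Suc k / real (Suc k)"
        using r by (intro frac_le power_decreasing) auto
    qed
    have "L - (\<Sum>k. (r ^ Suc k / real (Suc k)) *\<^sub>R \<psi> (Suc k)) = (\<Sum>k. w k *\<^sub>R \<psi> (Suc k))"
      unfolding L_def suminf_diff[OF s1 sr] by (simp add: w_def scaleR_diff_left diff_divide_distrib)
    also have "norm \<dots> \<le> n * w 0"
      by (rule summation_by_parts_decreasing(2)[OF norm_partial_sum_Suc_le[OF sum0] w0 dec])
    finally show ?thesis by (simp add: w_def)
  qed
  have "((\<lambda>r::real. L - (\<Sum>k. (r ^ Suc k / real (Suc k)) *\<^sub>R \<psi> (Suc k))) \<longlongrightarrow> 0) (at_left (1::real))"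
  proof (rule Lim_null_comparison)
    show "\<forall>\<^sub>F r in at_left (1::real). norm (L - (\<Sum>k. (r ^ Suc k / real (Suc k)) *\<^sub>R \<psi> (Suc k))) \<le> n * (1 - r)"
      by (rule eventually_mono[OF eventually_at_left_real[OF zero_less_one]]) (rule bound, auto)
    have "((\<lambda>r::real. real n * (1 - r)) \<longlongrightarrow> real n * (1 - 1)) (at_left (1::real))" by (intro tendsto_intros)
    thus "((\<lambda>r::real. real n * (1 - r)) \<longlongrightarrow> 0) (at_left (1::real))" by simp
  qed
  from tendsto_add[OF this lim] have "((\<lambda>r::real. L) \<longlongrightarrow> 0) (at_left (1::real))" by simp
  hence "L = 0" by (simp add: tendsto_const_iff)
  hence "(\<lambda>k. (1 / real (Suc k)) *\<^sub>R \<psi> (Suc k)) sums 0" using summable_sums[OF s1] by (simp add: L_def)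
  thus ?thesis by (simp add: scaleR_conv_of_real)
qed

end

section \<open>Orders of units and orthogonality of roots of unity\<close>

lemma exists_power_cong_1:
  fixes n u :: int
  assumes n: "n > 0" and u: "coprime u n"
  obtains m :: nat where "m > 0" "[u ^ m = 1] (mod n)"
proof -
  have "\<not> inj (\<lambda>k::nat. u ^ k mod n)"
  proof
    assume "inj (\<lambda>k::nat. u ^ k mod n)"
    moreover have "range (\<lambda>k::nat. u ^ k mod n) \<subseteq> {0..<n}" using n by auto
    ultimately show False by (metis finite_atLeastLessThan_int finite_subset infinite_UNIV_nat finite_imageD)
  qed
  then obtain i j :: nat where ij: "i < j" "u ^ i mod n = u ^ j mod n"
    unfolding inj_def by (metis linorder_neqE_nat)
  have "[u ^ i * u ^ (j - i) = u ^ i * 1] (mod n)"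
    using ij by (simp add: cong_def flip: power_add)
  hence "[u ^ (j - i) = 1] (mod n)"
    using cong_mult_lcancel[of "u ^ i" n "u ^ (j - i)" 1] u by simp
  thus ?thesis using ij that[of "j - i"] by simp
qed

lemma cis_2pi_frac_eq_1_iff:
  fixes m :: nat and c :: int
  assumes "m > 0"
  shows "cis (2 * pi * c / m) = 1 \<longleftrightarrow> int m dvd c"
proof
  assume "int m dvd c"
  then obtain d where "c = int m * d" by (elim dvdE)
  thus "cis (2 * pi * c / m) = 1" using assms cis_multiple_2pi[of d] by (simp add: mult_ac)
next
  assume "cis (2 * pi * c / m) = 1"
  hence "cos (2 * pi * c / m) = 1" by (metis cis.simps(1) one_complex.simps(1))
  then obtain k :: int where "2 * pi * c / m = of_int k * 2 * pi" using cos_one_2pi_int by auto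
  hence "real_of_int c = real_of_int (k * int m)" using assms by (simp add: field_simps)
  hence "c = k * int m" by (simp only: of_int_eq_iff)
  thus "int m dvd c" by simp
qed

lemma sum_cis_powers:
  fixes m :: nat and c :: int
  assumes "m > 0"
  shows "(\<Sum>j<m. cis (2 * pi * c / m) ^ j) = (if int m dvd c then of_nat m else 0)"
proof (cases "int m dvd c")
  case True
  thus ?thesis using cis_2pi_frac_eq_1_iff[OF assms, of c] by simp
next
  case False
  moreover have "cis (2 * pi * c / m) ^ m = 1"
    using assms cis_multiple_2pi[of c] by (simp add: Complex.DeMoivre mult.commute)
  ultimately show ?thesis using cis_2pi_frac_eq_1_iff[OF assms, of c] by (simp add: geometric_sum)
qed

text \<open>
  Translation by \<open>u\<close> has finite order on functions modulo \<open>n\<close>, so every function is a sum of its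
  eigenfunctions; treating the units one at a time keeps the eigenproperties already obtained.
\<close>

lemma exists_joint_eigenfunction:
  fixes n :: int and v :: "int \<Rightarrow> complex"
  assumes n: "n > 0" and v: "W v" "v \<noteq> (\<lambda>_. 0)"
    and add: "\<And>v w. W v \<Longrightarrow> W w \<Longrightarrow> W (\<lambda>a. v a + w a)"
    and scale: "\<And>v c. W v \<Longrightarrow> W (\<lambda>a. c * v a)"
    and trans: "\<And>v u. W v \<Longrightarrow> coprime u n \<Longrightarrow> W (\<lambda>a. v (u * a))"
    and per: "\<And>v a. W v \<Longrightarrow> v (a mod n) = v a"
  shows "\<exists>w. W w \<and> w \<noteq> (\<lambda>_. 0) \<and> (\<forall>u. coprime u n \<longrightarrow> (\<exists>c. \<forall>a. w (u * a) = c * w a))"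
proof -
  have joint: "\<exists>w. W w \<and> w \<noteq> (\<lambda>_. 0) \<and> (\<forall>u\<in>A. \<exists>c. \<forall>a. w (u * a) = c * w a)"
    if "finite A" "\<forall>u\<in>A. coprime u n" for A
    using that
  proof (induction A rule: finite_induct)
    case empty
    thus ?case using v by auto
  next
    case (insert u A)
    then obtain w where w: "W w" "w \<noteq> (\<lambda>_. 0)" "\<forall>u\<in>A. \<exists>c. \<forall>a. w (u * a) = c * w a" by auto
    have u: "coprime u n" using insert by simp
    obtain m where m: "m > 0" "[u ^ m = 1] (mod n)" using exists_power_cong_1[OF n u] .
    define om where "om j = cis (2 * pi * of_int (- int j) / m)" for j :: nat
    have om: "om j ^ m = 1" "om j \<noteq> 0" for j
      using m(1) cis_multiple_2pi[of "- int j"] by (simp_all add: om_def Complex.DeMoivre mult_ac)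
    \<comment> \<open>Up to the factor \<open>m\<close>, \<open>y j\<close> is the projection of
      \<open>w\<close> to the eigenspace of translation by \<open>u\<close> with eigenvalue
      \<open>inverse (om j)\<close>. By orthogonality the \<open>y j\<close> add up to
      \<open>m * w\<close>, so one of them is nonzero.\<close>
    define y where "y j a = (\<Sum>k<m. om j ^ k * w (u ^ k * a))" for j a
    have Wsum: "W (\<lambda>a. \<Sum>k<l. om j ^ k * w (u ^ k * a))" for j l
    proof (induction l)
      case 0
      show ?case using scale[OF w(1), of 0] by simp
    next
      case (Suc l)
      have "W (\<lambda>a. w (u ^ l * a))" using u by (intro trans w) simp
      from add[OF Suc scale[OF this]] show ?case by simp
    qed
    have Wy: "W (y j)" for j unfolding y_def by (rule Wsum)
    have "\<exists>j. y j \<noteq> (\<lambda>_. 0)"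
    proof (rule ccontr)
      assume "\<nexists>j. y j \<noteq> (\<lambda>_. 0)"
      hence y0: "y j a = 0" for j a by (auto simp: fun_eq_iff)
      have "of_nat m * w a = 0" for a
      proof -
        have om_swap: "om j ^ k = cis (2 * pi * of_int (- int k) / m) ^ j" for j k
          by (simp add: om_def Complex.DeMoivre mult_ac)
        have "0 = (\<Sum>j<m. y j a)" using y0 by simp
        also have "\<dots> = (\<Sum>k<m. \<Sum>j<m. om j ^ k * w (u ^ k * a))"
          unfolding y_def by (rule sum.swap)
        also have "\<dots> = (\<Sum>k<m. (\<Sum>j<m. cis (2 * pi * of_int (- int k) / m) ^ j) * w (u ^ k * a))"
          by (simp only: om_swap sum_distrib_right)
        also have "\<dots> = (\<Sum>k<m. (if k = 0 then of_nat m else 0) * w (u ^ k * a))"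
        proof (intro sum.cong refl arg_cong2[of _ _ _ _ "(*)"])
          fix k assume k: "k \<in> {..<m}"
          have "int m dvd - int k \<longleftrightarrow> k = 0"
            using k by (auto dest: nat_dvd_not_less)
          thus "(\<Sum>j<m. cis (2 * pi * of_int (- int k) / m) ^ j) = (if k = 0 then of_nat m else 0)"
            using sum_cis_powers[OF m(1), of "- int k"] by simp
        qed
        also have "\<dots> = of_nat m * w a" using m(1) by (simp add: if_distrib[of "\<lambda>x. x * _"] cong: if_cong)
        finally show ?thesis by simp
      qed
      thus False using w(2) m(1) by auto
    qed
    then obtain j where j: "y j \<noteq> (\<lambda>_. 0)" by blast
    have "om j * y j (u * a) = y j a" for a
    proof -
      have "om j * y j (u * a) = (\<Sum>k<m. om j ^ Suc k * w (u ^ Suc k * a))"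
        by (simp add: y_def sum_distrib_left mult_ac)
      also have "\<dots> = (\<Sum>k<Suc m. om j ^ k * w (u ^ k * a)) - w a"
        by (subst sum.lessThan_Suc_shift) simp
      also have "\<dots> = y j a + om j ^ m * w (u ^ m * a) - w a" by (simp add: y_def)
      also have "w (u ^ m * a) = w a"
      proof -
        have "(u ^ m * a) mod n = (1 * a) mod n" using m(2) by (metis cong_def cong_scalar_right)
        thus ?thesis using per[OF w(1)] by (metis mult_1)
      qed
      finally show ?thesis by (simp add: om)
    qed
    hence eig: "y j (u * a) = inverse (om j) * y j a" for a using om(2) by (metis (no_types) left_inverse mult.assoc mult_1)
    have "\<exists>c. \<forall>a. y j (u' * a) = c * y j a" if u': "u' \<in> A" for u'
    proof -
      obtain c where c: "\<And>a. w (u' * a) = c * w a" using w(3) u' by blast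
      \<comment> \<open>Translations commute, so the projection keeps the eigenvalue for
        \<open>u'\<close>.\<close>
      have "w (u ^ k * (u' * a)) = c * w (u ^ k * a)" for k a
        using c[of "u ^ k * a"] by (simp add: mult_ac)
      hence "y j (u' * a) = c * y j a" for a by (simp add: y_def sum_distrib_left mult_ac)
      thus ?thesis by blast
    qed
    thus ?case using Wy j eig by (intro exI[of _ "y j"]) auto
  qed
  have "finite {u \<in> {0..<n}. coprime u n}" by (rule finite_subset[of _ "{0..<n}"]) auto
  then obtain w where
    w: "W w" "w \<noteq> (\<lambda>_. 0)" "\<forall>u\<in>{u \<in> {0..<n}. coprime u n}. \<exists>c. \<forall>a. w (u * a) = c * w a"
    using joint[of "{u \<in> {0..<n}. coprime u n}"] by blast
  have "\<exists>c. \<forall>a. w (u * a) = c * w a" if u: "coprime u n" for u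
  proof -
    have "u mod n \<in> {u \<in> {0..<n}. coprime u n}" using n u by simp
    then obtain c where c: "\<And>a. w ((u mod n) * a) = c * w a" using w(3) by blast
    have "w (u * a) = c * w a" for a
      using c[of a] per[OF w(1)] by (metis mod_mult_left_eq)
    thus ?thesis by blast
  qed
  thus ?thesis using w by blast
qed

section \<open>Relations between tangents and Gauss sums\<close>

lemma sum_residues_mult:
  fixes n u :: int and g :: "int \<Rightarrow> 'a :: comm_monoid_add"
  assumes n: "n > 0" and u: "coprime u n" and g: "\<And>a. g (a mod n) = g a"
  shows "(\<Sum>a\<in>{0..<n}. g (u * a)) = (\<Sum>a\<in>{0..<n}. g a)"
proof -
  have "bij_betw (\<lambda>a. u * a mod n) {0..<n} {0..<n}"
  proof (rule bij_betwI')
    fix k l assume "k \<in> {0..<n}" "l \<in> {0..<n}"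
    thus "(u * k mod n = u * l mod n) = (k = l)"
      using cong_mult_lcancel[of u n k l] u by (auto simp: cong_def)
  next
    fix l assume l: "l \<in> {0..<n}"
    obtain v where "[u * v = 1] (mod n)" using cong_solve_coprime_int[OF u] by auto
    hence "[u * v * l = 1 * l] (mod n)" by (rule cong_scalar_right)
    hence "[u * (v * l mod n) = l] (mod n)" by (simp add: cong_def mod_mult_right_eq mult.assoc)
    thus "\<exists>k\<in>{0..<n}. l = u * k mod n" using l n
      by (intro bexI[of _ "v * l mod n"]) (auto simp: cong_def)
  qed (use n in auto)
  hence "(\<Sum>a\<in>{0..<n}. g a) = (\<Sum>a\<in>{0..<n}. g (u * a mod n))" by (rule sum.reindex_bij_betw[symmetric])
  thus ?thesis by (simp add: g)
qed

definition root_unity :: "nat \<Rightarrow> int \<Rightarrow> complex" where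
  "root_unity N a = cis (2 * pi * a / N)"

lemma root_unity_add: "root_unity N (a + b) = root_unity N a * root_unity N b"
  by (simp add: root_unity_def cis_mult add_divide_distrib distrib_left)

lemma root_unity_0 [simp]: "root_unity N 0 = 1"
  by (simp add: root_unity_def)

lemma root_unity_uminus: "root_unity N (- a) = cnj (root_unity N a)"
  by (simp add: root_unity_def cis_cnj)

lemma norm_root_unity [simp]: "norm (root_unity N a) = 1"
  by (simp add: root_unity_def)

lemma root_unity_eq_1_iff: "N > 0 \<Longrightarrow> root_unity N a = 1 \<longleftrightarrow> int N dvd a"
  unfolding root_unity_def by (rule cis_2pi_frac_eq_1_iff)

lemma root_unity_power: "root_unity N a ^ k = root_unity N (a * int k)"
  by (simp add: root_unity_def Complex.DeMoivre mult_ac)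

lemma root_unity_cong:
  assumes "N > 0" "[a = b] (mod int N)"
  shows "root_unity N a = root_unity N b"
proof -
  have "root_unity N (a - b) = 1" using assms by (simp add: root_unity_eq_1_iff cong_iff_dvd_diff)
  thus ?thesis using root_unity_add[of N "a - b" b] by simp
qed

text \<open>For odd \<open>N > 1\<close> and \<open>a\<close> prime to \<open>N\<close> this is
  \<open>ln |tan (pi * a / N)|\<close>: with \<open>z = root_unity N a\<close>,
  \<open>|1 - z|\<close> and \<open>|1 + z|\<close> are twice the moduli of sine and cosine of
  \<open>pi * a / N\<close>.\<close>

definition log_tan :: "nat \<Rightarrow> int \<Rightarrow> real" where
  "log_tan N a = ln (norm (1 - root_unity N a)) - ln (norm (1 + root_unity N a))"

text \<open>
  When \<open>Q\<close> consists of all primes dividing \<open>N\<close>, the last clause says that only primitive characters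
  modulo \<open>N\<close> (for squarefree \<open>N\<close>) occur in \<open>v\<close>.
\<close>

definition tan_relation :: "nat \<Rightarrow> int set \<Rightarrow> (int \<Rightarrow> complex) \<Rightarrow> bool" where
  "tan_relation N Q v \<longleftrightarrow>
     (\<forall>a. v (a mod int N) = v a) \<and> (\<forall>a. v (- a) = v a) \<and> (\<forall>a. \<not> coprime a (int N) \<longrightarrow> v a = 0) \<and>
     (\<forall>b. coprime b (int N) \<longrightarrow> (\<Sum>a\<in>{0..<int N}. v a * of_real (log_tan N (a * b))) = 0) \<and>
     (\<forall>q\<in>Q. \<forall>b. (\<Sum>a\<in>{0..<int N}. if [a = b] (mod (int N div q)) then v a else 0) = 0)"

section \<open>Closure of the relations under linear combinations and translations\<close>

lemma tan_relation_add:
  assumes "tan_relation N Q v" "tan_relation N Q w"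
  shows "tan_relation N Q (\<lambda>a. v a + w a)"
proof -
  have "(\<Sum>a\<in>{0..<int N}. if [a = b] (mod d) then v a + w a else 0) =
      (\<Sum>a\<in>{0..<int N}. if [a = b] (mod d) then v a else 0) + (\<Sum>a\<in>{0..<int N}. if [a = b] (mod d) then w a else 0)" for b d
    unfolding sum.distrib[symmetric] by (intro sum.cong) auto
  thus ?thesis using assms unfolding tan_relation_def by (simp add: distrib_right sum.distrib)
qed

lemma tan_relation_scale:
  assumes "tan_relation N Q v"
  shows "tan_relation N Q (\<lambda>a. c * v a)"
proof -
  have "(\<Sum>a\<in>{0..<int N}. if [a = b] (mod d) then c * v a else 0) =
      c * (\<Sum>a\<in>{0..<int N}. if [a = b] (mod d) then v a else 0)" for b d
    unfolding sum_distrib_left by (intro sum.cong) auto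
  moreover have "(\<Sum>a\<in>{0..<int N}. c * v a * of_real (log_tan N (a * b))) =
      c * (\<Sum>a\<in>{0..<int N}. v a * of_real (log_tan N (a * b)))" for b
    by (simp add: sum_distrib_left mult.assoc)
  ultimately show ?thesis using assms unfolding tan_relation_def by simp
qed

lemma log_tan_cong:
  assumes "N > 0" "[a = b] (mod int N)"
  shows "log_tan N a = log_tan N b"
  unfolding log_tan_def root_unity_cong[OF assms] ..

lemma tan_relation_translate:
  assumes N: "N > 0" and Q: "\<forall>q\<in>Q. q dvd int N" and v: "tan_relation N Q v" and u: "coprime u (int N)"
  shows "tan_relation N Q (\<lambda>a. v (u * a))"
proof -
  have per: "v (a mod int N) = v a" for a using v by (simp add: tan_relation_def)
  have N': "int N > 0" using N by simp
  obtain u' where u': "[u * u' = 1] (mod int N)" using cong_solve_coprime_int[OF u] by auto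
  have cu': "coprime u' (int N)" using u' by (metis coprime_iff_invertible_int mult.commute)
  have T: "(\<Sum>a\<in>{0..<int N}. v (u * a) * of_real (log_tan N (a * b))) = 0" if b: "coprime b (int N)" for b
  proof -
    define g where "g a = v a * of_real (log_tan N (a * (u' * b)))" for a
    have "g (a mod int N) = g a" for a
      using log_tan_cong[OF N, of "(a mod int N) * (u' * b)" "a * (u' * b)"]
      by (simp add: g_def per cong_def mod_mult_left_eq)
    hence "(\<Sum>a\<in>{0..<int N}. g (u * a)) = (\<Sum>a\<in>{0..<int N}. g a)" by (rule sum_residues_mult[OF N' u])
    also have "\<dots> = 0" using v b cu' unfolding g_def tan_relation_def by simp
    finally have "(\<Sum>a\<in>{0..<int N}. g (u * a)) = 0" .
    moreover have "g (u * a) = v (u * a) * of_real (log_tan N (a * b))" for a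
    proof -
      have "[u * u' * (a * b) = 1 * (a * b)] (mod int N)" using u' by (rule cong_scalar_right)
      hence "[u * a * (u' * b) = a * b] (mod int N)" by (simp add: mult_ac)
      thus ?thesis unfolding g_def by (simp add: log_tan_cong[OF N])
    qed
    ultimately show ?thesis by simp
  qed
  have Z: "(\<Sum>a\<in>{0..<int N}. if [a = b] (mod (int N div q)) then v (u * a) else 0) = 0" if q: "q \<in> Q" for q b
  proof -
    define d where "d = int N div q"
    have "d * q = int N" using Q q by (simp add: d_def)
    hence dN: "d dvd int N" by (metis dvd_triv_left)
    define g where "g a = (if [a = u * b] (mod d) then v a else 0)" for a
    have "coprime u d" using u dN by (meson coprime_divisors dvd_refl)
    hence gu: "g (u * a) = (if [a = b] (mod d) then v (u * a) else 0)" for a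
      unfolding g_def by (simp add: cong_mult_lcancel)
    have "g (a mod int N) = g a" for a
      using dN by (simp add: g_def per cong_def mod_mod_cancel)
    hence "(\<Sum>a\<in>{0..<int N}. g (u * a)) = (\<Sum>a\<in>{0..<int N}. g a)" by (rule sum_residues_mult[OF N' u])
    also have "\<dots> = 0" using v q unfolding g_def d_def tan_relation_def by blast
    finally show ?thesis unfolding gu d_def .
  qed
  have P: "v (u * (a mod int N)) = v (u * a)" for a using per[of "u * a"] per[of "u * (a mod int N)"] by (simp add: mod_mult_right_eq)
  have E: "v (u * - a) = v (u * a)" for a
    using v unfolding tan_relation_def by (metis mult_minus_right)
  have U: "v (u * a) = 0" if "\<not> coprime a (int N)" for a
    using v that unfolding tan_relation_def by (simp add: coprime_mult_left_iff)
  show ?thesis unfolding tan_relation_def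
    by (intro conjI allI ballI impI P E U T Z)
qed

text \<open>\<open>prim\<close> says that \<open>\<psi>\<close> is nontrivial on the kernel of the
  reduction of units from \<open>N\<close> to \<open>N div q\<close>, so that it is not induced from
  there. Being linear in \<open>\<psi>\<close>, the condition also makes sense for arbitrary
  functions, as in \<open>tan_relation\<close>.\<close>

locale even_primitive_character =
  fixes N :: nat and \<psi> :: "int \<Rightarrow> complex"
  assumes N: "N > 1"
    and per: "\<psi> (a mod int N) = \<psi> a"
    and mult: "\<psi> (a * b) = \<psi> a * \<psi> b"
    and nonzero_iff: "\<psi> a \<noteq> 0 \<longleftrightarrow> coprime a (int N)"
    and even: "\<psi> (- a) = \<psi> a"
    and prim: "prime q \<Longrightarrow> q dvd int N \<Longrightarrow>
      (\<Sum>a\<in>{0..<int N}. if [a = b] (mod (int N div q)) then \<psi> a else 0) = 0"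
begin

lemma N_pos: "N > 0" "int N > 0" using N by auto

sublocale D: dirichlet_character N "\<lambda>k. \<psi> (int k)"
proof unfold_locales
  fix k show "\<psi> (int (k + N)) = \<psi> (int k)"
    using per[of "int k + int N"] per[of "int k"] by simp
  show "(\<psi> (int k) \<noteq> 0) = coprime k N" using nonzero_iff[of "int k"] by simp
qed (use N in \<open>simp_all add: mult\<close>)

lemma norm_eq_1:
  assumes "coprime a (int N)" shows "norm (\<psi> a) = 1"
proof -
  have le: "norm (\<psi> a) \<le> 1" for a
    using D.norm_le_1[of "nat (a mod int N)"] N_pos by (simp add: per)
  obtain b where "[a * b = 1] (mod int N)" using cong_solve_coprime_int[OF assms] by auto
  hence "\<psi> (a * b) = \<psi> 1" by (metis cong_def per)
  hence "\<psi> a * \<psi> b = 1" using D.psi_1 by (simp add: mult)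
  hence "norm (\<psi> a) * norm (\<psi> b) = 1" by (metis norm_mult norm_one)
  thus ?thesis using le[of a] le[of b]
    by (metis mult_left_le norm_ge_zero order_antisym)
qed

definition gauss :: "int \<Rightarrow> complex" where
  "gauss k = (\<Sum>a\<in>{0..<int N}. \<psi> a * root_unity N (a * k))"

lemma root_unity_mod: "root_unity N ((a mod int N) * k) = root_unity N (a * k)"
  by (rule root_unity_cong[OF N_pos(1)]) (simp add: cong_def mod_mult_left_eq)

text \<open>For units this is a substitution. If a prime \<open>q\<close> divides \<open>k\<close>
  and \<open>N\<close>, then \<open>root_unity N (a * k)\<close> depends only on \<open>a\<close>
  modulo \<open>N div q\<close>, and the sums of \<open>\<psi>\<close> over these classes vanish by
  \<open>prim\<close>.\<close>

lemma gauss_eq: "gauss k = cnj (\<psi> k) * gauss 1"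
proof (cases "coprime k (int N)")
  case True
  have "\<psi> k * gauss k = (\<Sum>a\<in>{0..<int N}. \<psi> (k * a) * root_unity N ((k * a) * 1))"
    by (simp add: gauss_def sum_distrib_left mult mult_ac)
  also have "\<dots> = gauss 1" unfolding gauss_def
    by (rule sum_residues_mult[OF N_pos(2) True]) (simp add: per root_unity_mod[of _ 1, simplified])
  finally have "cnj (\<psi> k) * (\<psi> k * gauss k) = cnj (\<psi> k) * gauss 1" by simp
  moreover have "cnj (\<psi> k) * \<psi> k = 1"
    using norm_eq_1[OF True] complex_norm_square[of "\<psi> k"] by (simp add: mult.commute)
  ultimately show ?thesis by (metis mult.assoc mult_1)
next
  case False
  then obtain q where q: "prime q" "q dvd k" "q dvd int N"
  proof -
    have "gcd k (int N) \<noteq> 0" "\<not> is_unit (gcd k (int N))" using N_pos False by (auto simp: coprime_iff_gcd_eq_1)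
    then obtain q where "prime q" "q dvd gcd k (int N)"
      using prime_divisor_exists[of "gcd k (int N)"] by blast
    thus ?thesis using that[of q] by simp
  qed
  define d where "d = int N div q"
  have Nd: "int N = d * q" using q(3) by (simp add: d_def)
  have d: "d > 0" using Nd N_pos(2) prime_gt_0_int[OF q(1)] zero_less_mult_pos2 by metis
  have pick: "(\<Sum>b\<in>{0..<d}. if [a = b] (mod d) then x else 0) = x" for a and x :: complex
  proof -
    have "(\<Sum>b\<in>{0..<d}. if [a = b] (mod d) then x else 0) = (\<Sum>b\<in>{0..<d}. if b = a mod d then x else 0)"
      by (intro sum.cong) (auto simp: cong_def)
    thus ?thesis using d by simp
  qed
  have "gauss k = (\<Sum>a\<in>{0..<int N}. \<Sum>b\<in>{0..<d}. if [a = b] (mod d) then \<psi> a * root_unity N (a * k) else 0)"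
    unfolding gauss_def pick ..
  also have "\<dots> = (\<Sum>b\<in>{0..<d}. \<Sum>a\<in>{0..<int N}. if [a = b] (mod d) then \<psi> a * root_unity N (a * k) else 0)"
    by (rule sum.swap)
  also have "\<dots> = (\<Sum>b\<in>{0..<d}. root_unity N (b * k) * (\<Sum>a\<in>{0..<int N}. if [a = b] (mod d) then \<psi> a else 0))"
    unfolding sum_distrib_left
  proof (intro sum.cong refl)
    fix a b
    have "root_unity N (a * k) = root_unity N (b * k)" if "[a = b] (mod d)"
    proof (rule root_unity_cong[OF N_pos(1)])
      have "d * q dvd (a - b) * k" using that q(2) by (intro mult_dvd_mono) (simp_all add: cong_iff_dvd_diff)
      thus "[a * k = b * k] (mod int N)" by (simp add: Nd cong_iff_dvd_diff algebra_simps)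
    qed
    thus "(if [a = b] (mod d) then \<psi> a * root_unity N (a * k) else 0) =
        root_unity N (b * k) * (if [a = b] (mod d) then \<psi> a else 0)" by simp
  qed
  also have "\<dots> = 0" unfolding d_def by (simp add: prim[OF q(1,3)])
  finally show ?thesis using False nonzero_iff[of k] by auto
qed

text \<open>Fourier inversion at \<open>1\<close>: if all Gauss sums vanished, so would
  \<open>N * \<psi> 1 = N\<close>.\<close>

lemma gauss_nonzero: "gauss 1 \<noteq> 0"
proof
  assume "gauss 1 = 0"
  hence "gauss k = 0" for k using gauss_eq[of k] by simp
  hence "0 = (\<Sum>k<N. gauss (int k) * root_unity N (- int k))" by simp
  also have "\<dots> = (\<Sum>k<N. \<Sum>a\<in>{0..<int N}. \<psi> a * root_unity N (a - 1) ^ k)"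
    unfolding gauss_def sum_distrib_right
    by (intro sum.cong refl) (simp add: root_unity_power left_diff_distrib root_unity_add[symmetric] mult.assoc)
  also have "\<dots> = (\<Sum>a\<in>{0..<int N}. \<psi> a * (\<Sum>k<N. root_unity N (a - 1) ^ k))"
    unfolding sum_distrib_left by (rule sum.swap)
  also have "\<dots> = (\<Sum>a\<in>{0..<int N}. if a = 1 then \<psi> a * of_nat N else 0)"
  proof (intro sum.cong refl)
    fix a assume a: "a \<in> {0..<int N}"
    have "a = 0 \<or> a = 1 \<or> a > 1" using a by auto
    hence "int N dvd a - 1 \<longleftrightarrow> a = 1"
      using a N zdvd_not_zless[of "a - 1" "int N"] by (elim disjE) auto
    thus "\<psi> a * (\<Sum>k<N. root_unity N (a - 1) ^ k) = (if a = 1 then \<psi> a * of_nat N else 0)"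
      unfolding root_unity_def using sum_cis_powers[OF N_pos(1), of "a - 1"] by simp
  qed
  also have "\<dots> = of_nat N" using N D.psi_1 by simp
  finally show False using N by simp
qed

lemma sum_eq_0: "(\<Sum>k<N. \<psi> (int k)) = 0"
proof -
  have "(\<Sum>k<N. \<psi> (int k)) = (\<Sum>a\<in>{0..<int N}. \<psi> a)"
    by (rule sum.reindex_bij_witness[of _ nat int]) auto
  also have "\<dots> = gauss 0" by (simp add: gauss_def)
  also have "\<dots> = 0" using gauss_eq[of 0] D.psi_0 by simp
  finally show ?thesis .
qed

text \<open>Expanding the logarithm in powers of \<open>r\<close> turns the coefficients into sums
  of \<open>\<psi> a\<close> against real parts of roots of unity; evenness makes the conjugate half
  equal to the other, so each is a Gauss sum.\<close>

lemma log_sum_abel: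
  assumes r: "0 < r" "r < 1"
  shows "(\<lambda>k. (r ^ Suc k / real (Suc k)) *\<^sub>R cnj (\<psi> (int (Suc k)))) sums
    (- (\<Sum>a\<in>{0..<int N}. \<psi> a * of_real (ln (norm (1 - of_real r * root_unity N a)))) / gauss 1)"
proof -
  have "(\<lambda>k. Re ((of_real r * root_unity N a) ^ Suc k) / real (Suc k)) sums
      (- ln (norm (1 - of_real r * root_unity N a)))" for a
  proof (subst sums_Suc_iff)
    show "(\<lambda>k. Re ((of_real r * root_unity N a) ^ k) / real k) sums
      (- ln (norm (1 - of_real r * root_unity N a)) + Re ((of_real r * root_unity N a) ^ 0) / real 0)"
      using r ln_norm_one_minus_sums[of "of_real r * root_unity N a"] by (simp add: norm_mult)
  qed
  hence "(\<lambda>k. \<Sum>a\<in>{0..<int N}. \<psi> a * of_real (Re ((of_real r * root_unity N a) ^ Suc k) / real (Suc k))) sums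
      (\<Sum>a\<in>{0..<int N}. \<psi> a * of_real (- ln (norm (1 - of_real r * root_unity N a))))"
    by (intro sums_sum sums_mult sums_of_real)
  moreover have "(\<Sum>a\<in>{0..<int N}. \<psi> a * of_real (Re ((of_real r * root_unity N a) ^ k) / real k)) =
      (r ^ k / real k) *\<^sub>R (cnj (\<psi> (int k)) * gauss 1)" for k
  proof -
    have conj: "(\<Sum>a\<in>{0..<int N}. \<psi> a * cnj (root_unity N (a * int k))) = gauss (int k)"
    proof -
      have "(\<Sum>a\<in>{0..<int N}. \<psi> a * cnj (root_unity N (a * int k))) =
          (\<Sum>a\<in>{0..<int N}. \<psi> (- 1 * a) * root_unity N ((- 1 * a) * int k))"
        by (simp add: even flip: root_unity_uminus)
      also have "\<dots> = gauss (int k)" unfolding gauss_def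
        by (rule sum_residues_mult[OF N_pos(2)]) (simp_all add: per root_unity_mod)
      finally show ?thesis .
    qed
    have "(\<Sum>a\<in>{0..<int N}. \<psi> a * of_real (Re ((of_real r * root_unity N a) ^ k) / real k)) =
      (\<Sum>a\<in>{0..<int N}. of_real (r ^ k / real k / 2) * (\<psi> a * root_unity N (a * int k) + \<psi> a * cnj (root_unity N (a * int k))))"
    proof (intro sum.cong refl)
      fix a
      define z where "z = root_unity N (a * int k)"
      have "Re ((of_real r * root_unity N a) ^ k) = r ^ k * Re z"
        by (simp add: z_def power_mult_distrib root_unity_power flip: of_real_power)
      hence "of_real (Re ((of_real r * root_unity N a) ^ k) / real k) = of_real (r ^ k / real k / 2) * (z + cnj z)"
        by (simp only: complex_add_cnj flip: of_real_mult) simp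
      thus "\<psi> a * of_real (Re ((of_real r * root_unity N a) ^ k) / real k) =
        of_real (r ^ k / real k / 2) * (\<psi> a * root_unity N (a * int k) + \<psi> a * cnj (root_unity N (a * int k)))"
        unfolding z_def by (simp only: algebra_simps)
    qed
    also have "\<dots> = of_real (r ^ k / real k / 2) * (gauss (int k) + gauss (int k))"
      unfolding sum_distrib_left[symmetric] sum.distrib conj gauss_def[symmetric] ..
    also have "\<dots> = of_real (r ^ k / real k) * gauss (int k)" by simp
    finally show ?thesis unfolding gauss_eq[of "int k"] by (simp add: scaleR_conv_of_real)
  qed
  ultimately have "(\<lambda>k. (r ^ Suc k / real (Suc k)) *\<^sub>R (cnj (\<psi> (int (Suc k))) * gauss 1)) sums
      (\<Sum>a\<in>{0..<int N}. \<psi> a * of_real (- ln (norm (1 - of_real r * root_unity N a))))"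
    by (simp only:)
  hence "(\<lambda>k. (r ^ Suc k / real (Suc k)) *\<^sub>R (cnj (\<psi> (int (Suc k))) * gauss 1) / gauss 1) sums
      ((\<Sum>a\<in>{0..<int N}. \<psi> a * of_real (- ln (norm (1 - of_real r * root_unity N a)))) / gauss 1)"
    by (rule sums_divide)
  moreover have "(r ^ Suc k / real (Suc k)) *\<^sub>R (cnj (\<psi> (int (Suc k))) * gauss 1) / gauss 1 =
      (r ^ Suc k / real (Suc k)) *\<^sub>R cnj (\<psi> (int (Suc k)))" for k
    by (simp only: mult_scaleR_left[symmetric] nonzero_mult_div_cancel_right[OF gauss_nonzero])
  ultimately show ?thesis by (simp add: sum_negf del: of_nat_Suc power_Suc)
qed

theorem sum_log_nonzero:
  "(\<Sum>a\<in>{0..<int N}. \<psi> a * of_real (ln (norm (1 - root_unity N a)))) \<noteq> 0"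
proof
  assume 0: "(\<Sum>a\<in>{0..<int N}. \<psi> a * of_real (ln (norm (1 - root_unity N a)))) = 0"
  interpret C: dirichlet_character N "\<lambda>k. cnj (\<psi> (int k))"
    by unfold_locales (use N D.periodic D.nonzero_iff in \<open>simp_all add: mult\<close>)
  have csum: "(\<Sum>k<N. cnj (\<psi> (int k))) = 0" using sum_eq_0 by (simp flip: cnj_sum)
  define F where "F r = (\<Sum>a\<in>{0..<int N}. \<psi> a * of_real (ln (norm (1 - of_real r * root_unity N a))))" for r :: real
  have "(F \<longlongrightarrow> (\<Sum>a\<in>{0..<int N}. \<psi> a * of_real (ln (norm (1 - of_real 1 * root_unity N a))))) (at_left 1)"
    unfolding F_def
  proof (intro tendsto_sum)
    fix a assume "a \<in> {0..<int N}"
    show "((\<lambda>r. \<psi> a * of_real (ln (norm (1 - of_real r * root_unity N a)))) \<longlongrightarrow>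
        \<psi> a * of_real (ln (norm (1 - of_real 1 * root_unity N a)))) (at_left 1)"
    \<comment> \<open>At \<open>a = 0\<close> the logarithm diverges as \<open>r\<close> tends to
      \<open>1\<close>, but there \<open>\<psi> a = 0\<close>; where \<open>\<psi>\<close> is
      nonzero the limit argument of \<open>ln\<close> is positive.\<close>
    proof (cases "\<psi> a = 0")
      case False
      hence "coprime a (int N)" using nonzero_iff by blast
      hence "\<not> int N dvd a" using coprime_common_divisor[of a "int N" "int N"] N by auto
      hence "root_unity N a \<noteq> 1" using root_unity_eq_1_iff N_pos by blast
      thus ?thesis by (intro tendsto_intros) auto
    qed simp
  qed
  hence "((\<lambda>r. - F r / gauss 1) \<longlongrightarrow> - 0 / gauss 1) (at_left 1)"
    using 0 gauss_nonzero by (intro tendsto_intros) simp_all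
  moreover have "\<forall>\<^sub>F r in at_left (1::real). - F r / gauss 1 =
     (\<Sum>k. (r ^ Suc k / real (Suc k)) *\<^sub>R cnj (\<psi> (int (Suc k))))"
    by (rule eventually_mono[OF eventually_at_left_real[OF zero_less_one]])
       (use log_sum_abel in \<open>auto simp: F_def sums_iff\<close>)
  ultimately have "((\<lambda>r. \<Sum>k. (r ^ Suc k / real (Suc k)) *\<^sub>R cnj (\<psi> (int (Suc k)))) \<longlongrightarrow> 0) (at_left 1)"
    using tendsto_cong by fastforce
  hence "(\<lambda>k. cnj (\<psi> (int (Suc k))) / of_nat (Suc k)) sums 0"
    by (rule C.L1_sums_zero_of_abel_limit[OF csum])
  thus False using C.L1_nonzero[OF csum] by blast
qed

end

text \<open>A joint eigenfunction normalised at \<open>1\<close> is an even primitive character.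
  With \<open>l a = ln |1 - root_unity N a|\<close>, on units
  \<open>log_tan N a = 2 * l a - l (2 * a)\<close>, because
  \<open>(1 - z) (1 + z) = 1 - z^2\<close>. Translation by \<open>2\<close> turns the relation into
  \<open>(1 - 2 * \<psi> 2) * S = 0\<close>.\<close>

theorem tan_relation_trivial:
  assumes N: "N > 1" and odd: "odd N" and Q: "Q = {q. prime q \<and> q dvd int N}" and v: "tan_relation N Q v"
  shows "v = (\<lambda>_. 0)"
proof (rule ccontr)
  assume nz: "v \<noteq> (\<lambda>_. 0)"
  have N': "N > 0" "int N > 0" using N by auto
  have rel_per: "w (a mod int N) = w a" if "tan_relation N Q w" for w a
    using that unfolding tan_relation_def by blast
  obtain w where w: "tan_relation N Q w" "w \<noteq> (\<lambda>_. 0)"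
    and eig: "\<And>u. coprime u (int N) \<Longrightarrow> \<exists>c. \<forall>a. w (u * a) = c * w a"
    using exists_joint_eigenfunction[of "int N" "tan_relation N Q" v, OF N'(2) v nz
        tan_relation_add tan_relation_scale tan_relation_translate rel_per] N' Q by blast
  have w_unit: "w a = 0" if "\<not> coprime a (int N)" for a
    using w(1) that unfolding tan_relation_def by blast
  obtain a0 where "w a0 \<noteq> 0" using w(2) by blast
  hence "coprime a0 (int N)" using w_unit by blast
  \<comment> \<open>Units form a single orbit under translation, so an eigenfunction that is nonzero
    at one unit is nonzero at \<open>1\<close>.\<close>
  then obtain c where "w (a0 * 1) = c * w 1" using eig by blast
  hence w1: "w 1 \<noteq> 0" using \<open>w a0 \<noteq> 0\<close> by auto
  define \<psi> where "\<psi> a = (1 / w 1) * w a" for a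
  have rel: "tan_relation N Q \<psi>"
    using tan_relation_scale[OF w(1), of "1 / w 1"] unfolding \<psi>_def .
  have mult: "\<psi> (a * b) = \<psi> a * \<psi> b" for a b
  proof (cases "coprime a (int N)")
    case True
    then obtain c where c: "\<And>b. w (a * b) = c * w b" using eig by blast
    show ?thesis using c[of b] c[of 1] w1 by (simp add: \<psi>_def)
  next
    case False
    thus ?thesis using w_unit[of a] w_unit[of "a * b"] by (simp add: \<psi>_def)
  qed
  have "\<psi> a \<noteq> 0" if a: "coprime a (int N)" for a
  proof -
    obtain b where "[a * b = 1] (mod int N)" using cong_solve_coprime_int[OF a] by auto
    hence "\<psi> (a * b) = \<psi> 1" using rel_per[OF rel] by (metis cong_def)
    moreover have "\<psi> 1 = 1" using w1 by (simp add: \<psi>_def)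
    ultimately show ?thesis using mult[of a b] by auto
  qed
  hence nonzero_iff: "\<psi> a \<noteq> 0 \<longleftrightarrow> coprime a (int N)" for a
    using rel unfolding tan_relation_def by blast
  interpret even_primitive_character N \<psi>
  proof
    show "(\<Sum>a\<in>{0..<int N}. if [a = b] (mod int N div q) then \<psi> a else 0) = 0"
      if "prime q" "q dvd int N" for q b
      using rel that Q unfolding tan_relation_def by blast
    show "\<psi> (- a) = \<psi> a" for a using rel unfolding tan_relation_def by blast
  qed (use N rel_per[OF rel] mult nonzero_iff in auto)
  define l where "l a = complex_of_real (ln (norm (1 - root_unity N a)))" for a
  define S where "S = (\<Sum>a\<in>{0..<int N}. \<psi> a * l a)"
  define X where "X = (\<Sum>a\<in>{0..<int N}. \<psi> a * l (2 * a))"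
  have l_mod: "l (a mod int N) = l a" for a
    unfolding l_def using root_unity_cong[OF N'(1), of "a mod int N" a] by simp
  have c2: "coprime 2 (int N)" using odd by simp
  have "\<psi> 2 * X = (\<Sum>a\<in>{0..<int N}. \<psi> (2 * a) * l (2 * a))"
    by (simp add: X_def sum_distrib_left mult mult.assoc)
  also have "\<dots> = S" unfolding S_def
    by (rule sum_residues_mult[OF N'(2) c2]) (simp add: rel_per[OF rel] l_mod)
  finally have X: "\<psi> 2 * X = S" .
  have "0 = (\<Sum>a\<in>{0..<int N}. \<psi> a * of_real (log_tan N (a * 1)))"
    using rel unfolding tan_relation_def by (metis coprime_1_left)
  also have "\<dots> = (\<Sum>a\<in>{0..<int N}. 2 * (\<psi> a * l a) - \<psi> a * l (2 * a))"
  proof (intro sum.cong refl)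
    fix a
    show "\<psi> a * of_real (log_tan N (a * 1)) = 2 * (\<psi> a * l a) - \<psi> a * l (2 * a)"
    proof (cases "\<psi> a = 0")
      case False
      hence co: "coprime a (int N)" using nonzero_iff by blast
      hence "\<not> int N dvd 2 * a"
        using coprime_common_divisor[of "2 * a" "int N" "int N"] N c2 by (auto simp: coprime_mult_left_iff)
      hence "root_unity N (2 * a) \<noteq> 1" using root_unity_eq_1_iff N' by blast
      moreover have eq: "(1 - root_unity N a) * (1 + root_unity N a) = 1 - root_unity N (2 * a)"
        using root_unity_add[of N a a] by (simp add: algebra_simps mult_2)
      ultimately have "1 - root_unity N a \<noteq> 0" "1 + root_unity N a \<noteq> 0" by auto
      hence "ln (norm (1 - root_unity N (2 * a))) = ln (norm (1 - root_unity N a)) + ln (norm (1 + root_unity N a))"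
        unfolding eq[symmetric] norm_mult by (simp add: ln_mult)
      thus ?thesis by (simp add: log_tan_def l_def algebra_simps)
    qed simp
  qed
  also have "\<dots> = 2 * S - X" by (simp add: S_def X_def sum_subtractf sum_distrib_left)
  finally have "X = 2 * S" by simp
  hence "(1 - 2 * \<psi> 2) * S = 0" using X by (simp add: algebra_simps)
  moreover have "1 - 2 * \<psi> 2 \<noteq> 0"
  proof
    assume "1 - 2 * \<psi> 2 = 0"
    hence "norm (2 * \<psi> 2) = norm (1 :: complex)" by (simp only: right_minus_eq)
    thus False using norm_eq_1[OF c2] by (simp add: norm_mult)
  qed
  ultimately have "S = 0" by simp
  thus False using sum_log_nonzero unfolding S_def l_def by blast
qed

section \<open>Supports of functions killed by iterated differences\<close>

text \<open>The difference along \<open>u\<close> kills the characters that factor through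
  \<open>n div q\<close> and scales every other one by its value at \<open>u\<close> minus
  \<open>1\<close>. Using one for each prime isolates the primitive part.\<close>

fun vanishes_mod :: "'a :: comm_ring_1 \<Rightarrow> int \<Rightarrow> int list \<Rightarrow> (int \<Rightarrow> 'a) \<Rightarrow> int \<Rightarrow> bool" where
  "vanishes_mod m n [] c a \<longleftrightarrow> m dvd c a"
| "vanishes_mod m n (q # qs) c a \<longleftrightarrow>
     (\<forall>u. coprime u n \<longrightarrow> [u = 1] (mod (n div q)) \<longrightarrow> vanishes_mod m n qs (\<lambda>x. c (u * x) - c x) a)"

text \<open>In characteristic zero the vanishing already holds over the integers, hence modulo every
  \<open>m\<close>; this carries the analytic result over to parities.\<close>

lemma vanishes_mod_of_int:
  assumes "vanishes_mod 0 n qs (\<lambda>x. of_int (c x) :: 'a :: {comm_ring_1, ring_char_0}) a"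
  shows "vanishes_mod m n qs c a"
  using assms by (induction qs arbitrary: c) (simp_all flip: of_int_diff)

text \<open>If \<open>u\<close> is \<open>1\<close> modulo \<open>N div q\<close>, translation by
  \<open>u\<close> preserves the sums over classes modulo \<open>N div q\<close>, so the difference
  satisfies the extra clause for \<open>q\<close>. When all primes have moved into \<open>Q\<close>,
  the relation is trivial.\<close>

lemma tan_relation_vanishes:
  assumes N: "N > 1" "odd N" and "tan_relation N Q v" and "Q \<union> set qs = {q. prime q \<and> q dvd int N}"
  shows "vanishes_mod 0 (int N) qs v a"
  using assms(3-)
proof (induction qs arbitrary: Q v)
  case Nil
  thus ?case using tan_relation_trivial[OF N, of Q v] by simp
next
  case (Cons q qs)
  have q: "q dvd int N" and Q: "\<forall>q\<in>Q. q dvd int N" using Cons.prems(2) by auto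
  have N': "N > 0" "int N > 0" using N by auto
  define d where "d = int N div q"
  have "d * q = int N" using q by (simp add: d_def)
  hence dN: "d dvd int N" by (metis dvd_triv_left)
  show ?case
    unfolding vanishes_mod.simps
  proof (intro allI impI)
    fix u assume u: "coprime u (int N)" "[u = 1] (mod int N div q)"
    have ud: "[u * a = a] (mod d)" for a
      using cong_scalar_right[OF u(2), of a] by (simp add: d_def)
    define w where "w x = v (u * x) + (-1) * v x" for x
    have w: "tan_relation N Q w"
      unfolding w_def by (intro tan_relation_add tan_relation_scale tan_relation_translate N' Q u Cons.prems)
    have per: "v (a mod int N) = v a" for a using Cons.prems(1) unfolding tan_relation_def by blast
    have "(\<Sum>a\<in>{0..<int N}. if [a = b] (mod d) then w a else 0) = 0" for b
    proof -
      define g where "g a = (if [a = b] (mod d) then v a else 0)" for a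
      have gu: "g (u * a) = (if [a = b] (mod d) then v (u * a) else 0)" for a
        using ud[of a] unfolding g_def by (metis cong_sym cong_trans)
      have "g (a mod int N) = g a" for a
        using dN by (simp add: g_def per cong_def mod_mod_cancel)
      hence "(\<Sum>a\<in>{0..<int N}. g (u * a)) = (\<Sum>a\<in>{0..<int N}. g a)"
        by (rule sum_residues_mult[OF N'(2) u(1)])
      moreover have "(\<Sum>a\<in>{0..<int N}. if [a = b] (mod d) then w a else 0) =
          (\<Sum>a\<in>{0..<int N}. g (u * a)) - (\<Sum>a\<in>{0..<int N}. g a)"
        unfolding gu sum_subtractf[symmetric] by (intro sum.cong) (auto simp: g_def w_def)
      ultimately show ?thesis by simp
    qed
    hence "tan_relation N (insert q Q) w" using w unfolding tan_relation_def d_def by blast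
    moreover have "insert q Q \<union> set qs = {q. prime q \<and> q dvd int N}" using Cons.prems(2) by auto
    ultimately have "vanishes_mod 0 (int N) qs w a" by (rule Cons.IH)
    thus "vanishes_mod 0 (int N) qs (\<lambda>x. v (u * x) - v x) a" by (simp add: w_def[abs_def])
  qed
qed

text \<open>
  Induction on the primes. Either some difference \<open>c (u x) - c x\<close> with \<open>u \<equiv> 1\<close> modulo \<open>n / q\<close> is nonzero;
  its support injects into that of \<open>c\<close>, since \<open>x\<close> and \<open>u x\<close> lie in different classes modulo \<open>q\<close>. Or \<open>c\<close>
  is invariant under all such \<open>u\<close>, of which there are \<open>q - 1\<close>. The modulus \<open>m\<close> plays the role of zero,
  so that \<open>m = 0\<close> and \<open>m = 2\<close> are both covered.
\<close>

lemma support_lower_bound: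
  fixes n :: int and c :: "int \<Rightarrow> 'a :: comm_ring_1"
  assumes n: "n > 0" "squarefree n"
    and "distinct qs" and "\<forall>q\<in>set qs. prime q \<and> q dvd n \<and> int M < q"
    and "\<And>a. c (a mod n) = c a" and "\<And>a. coprime a n \<Longrightarrow> vanishes_mod m n qs c a"
    and "coprime a0 n" "\<not> m dvd c a0"
  shows "M \<le> card {a \<in> {0..<n}. coprime a n \<and> \<not> m dvd c a \<and>
    (\<forall>r. prime r \<longrightarrow> r dvd n \<longrightarrow> r \<notin> set qs \<longrightarrow> [a = a0] (mod r))}"
  using assms(3-)
proof (induction qs arbitrary: c a0)
  case Nil
  thus ?case by simp
next
  case (Cons q qs)
  define d where "d = n div q"
  define C where "C qs c a0 = {a \<in> {0..<n}. coprime a n \<and> \<not> m dvd c a \<and>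
    (\<forall>r. prime r \<longrightarrow> r dvd n \<longrightarrow> r \<notin> set qs \<longrightarrow> [a = a0] (mod r))}" for qs and c :: "int \<Rightarrow> 'a" and a0
  have q: "prime q" "q dvd n" "int M < q" using Cons.prems(2) by auto
  have nd: "n = q * d" using q(2) by (simp add: d_def)
  have "\<not> q dvd d"
  proof
    assume "q dvd d"
    hence "q ^ 2 dvd n" unfolding nd power2_eq_square by (intro mult_dvd_mono) auto
    hence "q dvd 1" using n(2) by (simp add: squarefree_def)
    thus False using q(1) by auto
  qed
  hence cop: "coprime q d" using q(1) by (simp add: prime_imp_coprime)
  have fin: "finite (C qs c a0)" for qs c a0
    by (rule finite_subset[of _ "{0..<n}"]) (auto simp: C_def)
  have cong_r: "[u = 1] (mod r)" if "[u = 1] (mod d)" "prime r" "r dvd n" "r \<noteq> q" for u r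
  proof -
    have "r dvd q \<or> r dvd d" using that(2,3) nd by (simp add: prime_dvd_mult_iff)
    moreover have "\<not> r dvd q" using that(2,4) q(1) primes_dvd_imp_eq by blast
    ultimately show ?thesis using that(1) cong_dvd_modulus by blast
  qed
  have mod_n: "a \<in> C qs c a0 \<longleftrightarrow> a \<in> {0..<n} \<and> coprime a n \<and> \<not> m dvd c a \<and>
    (\<forall>r. prime r \<longrightarrow> r dvd n \<longrightarrow> r \<notin> set qs \<longrightarrow> [a = a0] (mod r))" for a qs c a0
    by (simp add: C_def)
  show ?case
  proof (cases "\<exists>u a. coprime u n \<and> [u = 1] (mod d) \<and> coprime a n \<and>
      (\<forall>r. prime r \<longrightarrow> r dvd n \<longrightarrow> r \<notin> set (q # qs) \<longrightarrow> [a = a0] (mod r)) \<and> \<not> m dvd c (u * a) - c a")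
    case True
    then obtain u a where u: "coprime u n" "[u = 1] (mod d)" and a: "coprime a n"
      "\<And>r. prime r \<Longrightarrow> r dvd n \<Longrightarrow> r \<notin> set (q # qs) \<Longrightarrow> [a = a0] (mod r)" "\<not> m dvd c (u * a) - c a"
      by blast
    define cu where "cu x = c (u * x) - c x" for x
    have per: "cu (x mod n) = cu x" for x
      using Cons.prems(3)[of "u * x"] Cons.prems(3)[of "u * (x mod n)"] Cons.prems(3)[of x]
      by (simp add: cu_def mod_mult_right_eq)
    have "M \<le> card (C qs cu a)"
      unfolding C_def
    proof (rule Cons.IH[of cu a, OF _ _ per])
      show "vanishes_mod m n qs cu x" if "coprime x n" for x
        using Cons.prems(4)[OF that] u unfolding cu_def d_def by simp
    qed (use Cons.prems(1,2) a(1,3) in \<open>auto simp: cu_def\<close>)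
    also have "card (C qs cu a) \<le> card (C (q # qs) c a0)"
    proof (rule card_inj_on_le[OF _ _ fin])
      \<comment> \<open>If \<open>c (u * x) - c x\<close> is nonzero modulo \<open>m\<close>, then
        so is \<open>c\<close> at \<open>x\<close> or at \<open>u * x\<close>; \<open>\<phi>\<close>
        picks such a point.\<close>
      define \<phi> where "\<phi> x = (if m dvd c x then u * x mod n else x)" for x
      have u_ne: "\<not> [u = 1] (mod q)"
      proof
        assume "[u = 1] (mod q)"
        hence "[u = 1] (mod q * d)" using u(2) cop by (intro coprime_cong_mult)
        hence "[u * a = 1 * a] (mod n)" unfolding nd by (rule cong_scalar_right)
        hence "c (u * a) = c a" using Cons.prems(3) by (metis cong_def mult_1)
        thus False using a(3) by simp
      qed
      \<comment> \<open>This is where the congruence clause of the statement is used: as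
        \<open>q\<close> is not in \<open>qs\<close>, all points counted for \<open>cu\<close> are
        congruent to \<open>a\<close> modulo \<open>q\<close>, and multiplication by
        \<open>u\<close> leaves that class.\<close>
      have mixed: False if x: "x \<in> C qs cu a" and y: "y \<in> C qs cu a" and eq: "x = u * y mod n" for x y
      proof -
        have qq: "q \<notin> set qs" using Cons.prems(1) by simp
        have "[x = a] (mod q)" "[y = a] (mod q)" using x y q(1,2) qq unfolding mod_n by blast+
        moreover have "[x = u * y] (mod q)" unfolding eq using q(2) by (simp add: cong_def mod_mod_cancel)
        ultimately have "[a * u = a * 1] (mod q)"
          by (metis cong_scalar_left cong_sym cong_trans mult.commute mult_1_right)
        moreover have "coprime a q" using a(1) q(2) by (meson coprime_divisors dvd_refl)
        ultimately show False using u_ne cong_mult_lcancel by blast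
      qed
      show "inj_on \<phi> (C qs cu a)"
      proof (rule inj_onI)
        fix x y assume xy: "x \<in> C qs cu a" "y \<in> C qs cu a" "\<phi> x = \<phi> y"
        have rng: "x \<in> {0..<n}" "y \<in> {0..<n}" using xy(1,2) unfolding mod_n by blast+
        have "x = y" if "u * x mod n = u * y mod n"
          using that rng cong_mult_lcancel[of u n x y] u(1) by (auto simp: cong_def)
        moreover have "x \<noteq> u * y mod n" "y \<noteq> u * x mod n" using mixed xy(1,2) by blast+
        ultimately show "x = y" using xy(3) unfolding \<phi>_def by (metis (full_types))
      qed
      show "\<phi> ` C qs cu a \<subseteq> C (q # qs) c a0"
      proof (intro image_subsetI)
        fix x assume x: "x \<in> C qs cu a"
        have x': "x \<in> {0..<n}" "coprime x n" "\<not> m dvd c (u * x) - c x"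
          "\<And>r. prime r \<Longrightarrow> r dvd n \<Longrightarrow> r \<notin> set qs \<Longrightarrow> [x = a] (mod r)"
          using x unfolding mod_n cu_def by blast+
        have r: "[x = a0] (mod r)" "[u * x = a0] (mod r)" if r: "prime r" "r dvd n" "r \<notin> set (q # qs)" for r
        proof -
          show 1: "[x = a0] (mod r)" using x'(4)[of r] a(2)[of r] r cong_trans by auto
          have "[u = 1] (mod r)" using cong_r[OF u(2)] r by auto
          hence "[u * x = 1 * x] (mod r)" by (rule cong_scalar_right)
          thus "[u * x = a0] (mod r)" using 1 cong_trans by auto
        qed
        show "\<phi> x \<in> C (q # qs) c a0"
        proof (cases "m dvd c x")
          case True
          hence "\<not> m dvd c (u * x)" using x'(3) by auto
          moreover have "coprime (u * x mod n) n" using u(1) x'(2) n(1) by simp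
          moreover have "[u * x mod n = a0] (mod r)" if "prime r" "r dvd n" "r \<notin> set (q # qs)" for r
            using r(2)[OF that] that(2) by (simp add: cong_def mod_mod_cancel)
          ultimately show ?thesis unfolding mod_n \<phi>_def using True n(1) Cons.prems(3)[of "u * x"] by simp
        next
          case False
          thus ?thesis using x' r(1) unfolding mod_n \<phi>_def by simp
        qed
      qed
    qed
    finally show ?thesis unfolding C_def .
  next
    case False
    \<comment> \<open>Every nonzero residue modulo \<open>q\<close> lifts to a unit that is
      \<open>1\<close> modulo \<open>d\<close>; the \<open>q - 1\<close> translates of
      \<open>a0\<close> by these units stay in the support.\<close>
    have "\<forall>j\<in>{1..<q}. \<exists>u. [u = j] (mod q) \<and> [u = 1] (mod d)"
      using binary_chinese_remainder_int[OF cop] by blast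
    then obtain f where f: "\<And>j. j \<in> {1..<q} \<Longrightarrow> [f j = j] (mod q)" "\<And>j. j \<in> {1..<q} \<Longrightarrow> [f j = 1] (mod d)"
      by metis
    have fu: "coprime (f j) n" if j: "j \<in> {1..<q}" for j
    proof -
      have "\<not> q dvd j" using j zdvd_not_zless by auto
      hence "coprime (f j) q" using f(1)[OF j] q(1)
        by (metis cong_imp_coprime cong_sym coprime_commute prime_imp_coprime)
      moreover have "coprime (f j) d" using f(2)[OF j] by (metis cong_imp_coprime cong_sym coprime_1_left)
      ultimately show ?thesis unfolding nd by simp
    qed
    have "M \<le> card {1..<q}" using q(3) by simp
    also have "\<dots> \<le> card (C (q # qs) c a0)"
    proof (rule card_inj_on_le[of "\<lambda>j. f j * a0 mod n", OF _ _ fin])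
      show "inj_on (\<lambda>j. f j * a0 mod n) {1..<q}"
      proof (rule inj_onI)
        fix i j assume ij: "i \<in> {1..<q}" "j \<in> {1..<q}" "f i * a0 mod n = f j * a0 mod n"
        have "[a0 * f i = a0 * f j] (mod n)" using ij(3) by (simp add: cong_def mult.commute)
        hence "[f i = f j] (mod n)" using cong_mult_lcancel Cons.prems(5) by blast
        hence "[f i = f j] (mod q)" using q(2) cong_dvd_modulus by blast
        hence "[i = j] (mod q)" using f(1)[OF ij(1)] f(1)[OF ij(2)] by (metis cong_sym cong_trans)
        thus "i = j" using ij by (auto simp: cong_def)
      qed
      show "(\<lambda>j. f j * a0 mod n) ` {1..<q} \<subseteq> C (q # qs) c a0"
      proof (intro image_subsetI)
        fix j assume j: "j \<in> {1..<q}"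
        have "m dvd c (f j * a0) - c a0" using False fu[OF j] f(2)[OF j] Cons.prems(5) cong_refl by blast
        hence "\<not> m dvd c (f j * a0)" using Cons.prems(6) by (metis dvd_diff_right_iff dvd_diff_commute)
        moreover have "coprime (f j * a0 mod n) n" using fu[OF j] Cons.prems(5) n(1) by simp
        moreover have "[f j * a0 mod n = a0] (mod r)" if "prime r" "r dvd n" "r \<notin> set (q # qs)" for r
        proof -
          have "[f j * a0 = 1 * a0] (mod r)" using cong_r[OF f(2)[OF j], of r] that by (intro cong_scalar_right) auto
          thus ?thesis using that(2) by (simp add: cong_def mod_mod_cancel)
        qed
        ultimately show "f j * a0 mod n \<in> C (q # qs) c a0"
          unfolding mod_n using n(1) Cons.prems(3)[of "f j * a0"] by simp
      qed
    qed
    finally show ?thesis unfolding C_def .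
  qed
qed

section \<open>Angles and relations between tangents\<close>

lemma log_tan_uminus: "log_tan N (- a) = log_tan N a"
proof -
  have "norm (1 - cnj z) = norm (1 - z)" "norm (1 + cnj z) = norm (1 + z)" for z :: complex
    using complex_mod_cnj[of "1 - z"] complex_mod_cnj[of "1 + z"] by simp_all
  thus ?thesis by (simp add: log_tan_def root_unity_uminus)
qed

lemma one_pm_root_unity_nonzero:
  assumes N: "N > 1" "odd N" and a: "coprime a (int N)"
  shows "1 - root_unity N a \<noteq> 0" "1 + root_unity N a \<noteq> 0"
proof -
  have "coprime (2 * a) (int N)" using N(2) a by (simp add: coprime_mult_left_iff)
  hence "\<not> int N dvd 2 * a"
    using coprime_common_divisor[of "2 * a" "int N" "int N"] N by auto
  hence "root_unity N (2 * a) \<noteq> 1" using root_unity_eq_1_iff N by simp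
  moreover have "(1 - root_unity N a) * (1 + root_unity N a) = 1 - root_unity N (2 * a)"
    using root_unity_add[of N a a] by (simp add: algebra_simps mult_2)
  ultimately show "1 - root_unity N a \<noteq> 0" "1 + root_unity N a \<noteq> 0" by auto
qed

lemma int_eval_prod: "int_eval (\<Prod>i\<in>I. P i) z = (\<Prod>i\<in>I. int_eval (P i) z)"
  by (induction I rule: infinite_finite_induct) simp_all

text \<open>For odd \<open>N\<close>, \<open>e = -1\<close> encodes the denominator
  \<open>2 * N\<close>: \<open>pi/2 - pi * b / N = pi * (N - 2 * b) / (2 * N)\<close>, with odd
  numerator. In both cases the tangent is \<open>tan (pi * b / N)\<close> to the power
  \<open>e\<close>.\<close>

definition signed_angle :: "nat \<Rightarrow> int \<Rightarrow> int \<Rightarrow> real" where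
  "signed_angle N b e = (if e = 1 then pi * b / N else pi / 2 - pi * b / N)"

lemma exists_signed_angle:
  assumes N: "odd N" and x: "x \<in> rational_angles" "0 < x" "x < pi / 2" "den x \<in> {int N, 2 * int N}"
  shows "\<exists>b e. coprime b (int N) \<and> 0 < b \<and> 2 * b < int N \<and> e \<in> {1, -1} \<and> x = signed_angle N b e"
proof -
  obtain q where q: "x = of_rat q * pi" using x(1) unfolding rational_angles_def by auto
  obtain a d where ad: "quotient_of q = (a, d)" by (cases "quotient_of q")
  have d: "d > 0" "coprime a d" using quotient_of_denom_pos[OF ad] quotient_of_coprime[OF ad] .
  have xad: "x = pi * a / d"
    using quotient_of_div[OF ad] by (simp add: q of_rat_divide)
  have dd: "d \<in> {int N, 2 * int N}" using x(4) unfolding q den_of_rat_pi ad by simp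
  have a: "a > 0" "2 * a < d"
  proof -
    show "a > 0" using x(2) d(1) unfolding xad by (simp add: zero_less_divide_iff zero_less_mult_iff)
    have "2 * real_of_int a < d" using x(3) d(1) unfolding xad by (simp add: field_simps)
    thus "2 * a < d" by linarith
  qed
  show ?thesis
  proof (cases "d = int N")
    case True
    thus ?thesis using a d xad by (intro exI[of _ a] exI[of _ 1]) (auto simp: signed_angle_def)
  next
    case False
    hence dN: "d = 2 * int N" using dd by simp
    have "odd a" using d(2) unfolding dN by simp
    then obtain b where b: "int N - a = 2 * b" using N by (metis dvdE even_diff even_of_nat odd_even_add)
    have "coprime a (int N)" using d(2) unfolding dN by simp
    hence "coprime (2 * b) (int N)" unfolding b[symmetric]
      by (metis coprime_iff_gcd_eq_1 gcd.commute gcd_diff2)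
    hence "coprime b (int N)" by simp
    moreover have "x = signed_angle N b (-1)"
    proof -
      have ab: "real_of_int a = N - 2 * b" using b by linarith
      have "N > 0" using d(1) dN by simp
      thus ?thesis unfolding xad dN signed_angle_def ab by (simp add: field_simps)
    qed
    ultimately show ?thesis using a b dN by (intro exI[of _ b] exI[of _ "-1"]) auto
  qed
qed

text \<open>At \<open>root_unity N 1\<close>, the quotient of \<open>numer_poly b e\<close> by
  \<open>numer_poly b (- e)\<close> is the tangent of the signed angle up to a factor
  \<open>\<plusminus>i\<close>, so squares of tangents have integer coefficients.\<close>

definition numer_poly :: "int \<Rightarrow> int \<Rightarrow> int poly" where
  "numer_poly b e = (if e = 1 then 1 - monom 1 (nat b) else 1 + monom 1 (nat b))"

lemma int_eval_numer_poly:
  assumes "b > 0"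
  shows "int_eval (numer_poly b e) (root_unity N k) = 1 - of_int (if e = 1 then 1 else -1) * root_unity N (b * k)"
  using assms by (simp add: numer_poly_def root_unity_power mult.commute)

lemma tan_signed_angle_sq:
  assumes N: "N > 1" "odd N" and b: "coprime b (int N)" "b > 0" "2 * b < int N" and e: "e \<in> {1, -1}"
  shows "of_real ((tan (signed_angle N b e))\<^sup>2) * (int_eval (numer_poly b (- e)) (root_unity N 1))\<^sup>2 =
    - (int_eval (numer_poly b e) (root_unity N 1))\<^sup>2"
proof -
  define \<theta> where "\<theta> = pi * b / N"
  have \<theta>: "0 < \<theta>" "\<theta> < pi / 2"
  proof -
    show "0 < \<theta>" using N b by (simp add: \<theta>_def)
    have "real_of_int (2 * b) < real_of_int (int N)" using b(3) by (simp only: of_int_less_iff)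
    thus "\<theta> < pi / 2" using N by (simp add: \<theta>_def field_simps)
  qed
  have sc: "sin \<theta> > 0" "cos \<theta> > 0" using \<theta> by (auto intro: sin_gt_zero cos_gt_zero)
  define z where "z = cis \<theta>"
  have rho: "root_unity N b = z\<^sup>2"
    by (simp add: root_unity_def z_def \<theta>_def Complex.DeMoivre mult_ac)
  have m: "1 - z\<^sup>2 = - 2 * \<i> * of_real (sin \<theta>) * z" and p: "1 + z\<^sup>2 = 2 * of_real (cos \<theta>) * z"
    using sin_cos_squared_add[of \<theta>]
    by (simp_all add: z_def complex_eq_iff power2_eq_square algebra_simps)
  consider "e = 1" | "e = -1" using e by auto
  thus ?thesis
  proof cases
    case 1
    have "signed_angle N b e = \<theta>" using 1 by (simp add: signed_angle_def \<theta>_def)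
    thus ?thesis using 1 b sc by (simp add: int_eval_numer_poly rho m p tan_def power_mult_distrib power_divide)
  next
    case 2
    have "signed_angle N b e = pi / 2 - \<theta>" using 2 by (simp add: signed_angle_def \<theta>_def)
    thus ?thesis using 2 b sc
      by (simp add: int_eval_numer_poly rho m p tan_def power_mult_distrib power_divide sin_diff cos_diff)
  qed
qed

text \<open>The squared relation becomes an integer polynomial vanishing at
  \<open>root_unity N 1\<close>, hence at all its conjugates. Signs are lost by squaring, but only
  logarithms of absolute values are wanted.\<close>

lemma log_tan_galois:
  fixes b e :: "nat \<Rightarrow> int"
  assumes N: "N > 1" "odd N" and I: "finite I" "j \<notin> I"
    and b: "\<And>i. i \<in> insert j I \<Longrightarrow> coprime (b i) (int N) \<and> 0 < b i \<and> 2 * b i < int N \<and> e i \<in> {1, -1}"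
    and rel: "(tan (signed_angle N (b j) (e j)))\<^sup>2 = (\<Prod>i\<in>I. tan (signed_angle N (b i) (e i)))"
    and k: "coprime k (int N)"
  shows "2 * (e j * log_tan N (b j * k)) = (\<Sum>i\<in>I. e i * log_tan N (b i * k))"
proof -
  define num den where "num i = numer_poly (b i) (e i)" and "den i = numer_poly (b i) (- e i)" for i
  define ev where "ev p k = int_eval p (root_unity N k)" for p k
  define T where "T i = tan (signed_angle N (b i) (e i))" for i
  \<comment> \<open>The fourth powers come from squaring \<open>(T j)^2\<close>; the sign collects
    one \<open>-1\<close> for each squared tangent on the right.\<close>
  define P where "P = num j ^ 4 * (\<Prod>i\<in>I. den i ^ 2) - den j ^ 4 * smult ((-1) ^ card I) (\<Prod>i\<in>I. num i ^ 2)"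
  have evP: "ev P k = ev (num j) k ^ 4 * (\<Prod>i\<in>I. ev (den i) k ^ 2) - ev (den j) k ^ 4 * ((-1) ^ card I * (\<Prod>i\<in>I. ev (num i) k ^ 2))" for k
    by (simp add: P_def ev_def int_eval_prod)
  have T: "of_real ((T i)\<^sup>2) * (ev (den i) 1)\<^sup>2 = - (ev (num i) 1)\<^sup>2" if "i \<in> insert j I" for i
    using tan_signed_angle_sq[OF N, of "b i" "e i"] b[OF that] unfolding T_def ev_def num_def den_def by blast
  have "ev P 1 = 0"
  proof -
    have "ev (num j) 1 ^ 4 = (of_real ((T j)\<^sup>2) * (ev (den j) 1)\<^sup>2)\<^sup>2"
      using T[of j] by (simp add: power2_eq_square power4_eq_xxxx)
    also have "\<dots> = of_real (((T j)\<^sup>2)\<^sup>2) * ev (den j) 1 ^ 4"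
      by (simp add: power_mult_distrib)
    also have "((T j)\<^sup>2)\<^sup>2 = (\<Prod>i\<in>I. (T i)\<^sup>2)" using rel unfolding T_def by (simp add: prod_power_distrib)
    finally have "ev (num j) 1 ^ 4 * (\<Prod>i\<in>I. ev (den i) 1 ^ 2) =
        ev (den j) 1 ^ 4 * (\<Prod>i\<in>I. of_real ((T i)\<^sup>2) * (ev (den i) 1)\<^sup>2)"
      by (simp add: prod.distrib mult_ac)
    also have "(\<Prod>i\<in>I. of_real ((T i)\<^sup>2) * (ev (den i) 1)\<^sup>2) = (\<Prod>i\<in>I. (-1) * (ev (num i) 1)\<^sup>2)"
      using T by (intro prod.cong) auto
    also have "\<dots> = (-1) ^ card I * (\<Prod>i\<in>I. (ev (num i) 1)\<^sup>2)" by (simp only: prod.distrib prod_constant)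
    finally show ?thesis unfolding evP by simp
  qed
  define k' where "k' = nat (k mod int N)"
  have k': "int k' = k mod int N" using N by (simp add: k'_def)
  have cop: "coprime k' N"
  proof -
    have "coprime (int k') (int N)" unfolding k' using k N by simp
    thus ?thesis by simp
  qed
  have "k' > 0" using cop N by (cases k') auto
  hence "int_eval P (root_unity N 1 ^ k') = 0"
  proof (intro root_of_unity_conj_root[of N])
    show "root_unity N 1 ^ N = 1" using N by (simp add: root_unity_power root_unity_eq_1_iff)
  qed (use N cop \<open>ev P 1 = 0\<close> in \<open>simp_all add: ev_def\<close>)
  moreover have "root_unity N 1 ^ k' = root_unity N k"
    unfolding root_unity_power k' using N by (intro root_unity_cong) (auto simp: cong_def)
  ultimately have "ev P k = 0" by (simp add: ev_def)
  hence eq: "ev (num j) k ^ 4 * (\<Prod>i\<in>I. ev (den i) k ^ 2) = ev (den j) k ^ 4 * ((-1) ^ card I * (\<Prod>i\<in>I. ev (num i) k ^ 2))"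
    unfolding evP by simp
  have nz: "ev (num i) k \<noteq> 0" "ev (den i) k \<noteq> 0"
    and lt: "ln (norm (ev (num i) k)) - ln (norm (ev (den i) k)) = e i * log_tan N (b i * k)"
    if i: "i \<in> insert j I" for i
  proof -
    have "coprime (b i * k) (int N)" using b[OF i] k by (simp add: coprime_mult_left_iff)
    note * = one_pm_root_unity_nonzero[OF N this]
    have "- root_unity N (b i * k) \<noteq> 1" using *(2) by (metis add.left_inverse)
    have ei: "e i = 1 \<or> e i = -1" using b[OF i] by auto
    show "ev (num i) k \<noteq> 0" "ev (den i) k \<noteq> 0"
      using * \<open>- root_unity N (b i * k) \<noteq> 1\<close> ei b[OF i] by (auto simp: ev_def num_def den_def int_eval_numer_poly)
    show "ln (norm (ev (num i) k)) - ln (norm (ev (den i) k)) = e i * log_tan N (b i * k)"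
      using ei b[OF i] by (auto simp: ev_def num_def den_def int_eval_numer_poly log_tan_def)
  qed
  have "norm (ev (num j) k) ^ 4 * (\<Prod>i\<in>I. norm (ev (den i) k) ^ 2) = norm (ev (den j) k) ^ 4 * (\<Prod>i\<in>I. norm (ev (num i) k) ^ 2)"
    using arg_cong[OF eq, of norm] by (simp add: norm_mult norm_power prod_norm[symmetric])
  hence "ln (norm (ev (num j) k) ^ 4 * (\<Prod>i\<in>I. norm (ev (den i) k) ^ 2)) = ln (norm (ev (den j) k) ^ 4 * (\<Prod>i\<in>I. norm (ev (num i) k) ^ 2))"
    by simp
  moreover have ln_prod4: "ln (norm (f j) ^ 4 * (\<Prod>i\<in>I. norm (g i) ^ 2)) = 4 * ln (norm (f j)) + 2 * (\<Sum>i\<in>I. ln (norm (g i)))"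
    if "\<And>i. i \<in> insert j I \<Longrightarrow> f i \<noteq> 0" "\<And>i. i \<in> insert j I \<Longrightarrow> g i \<noteq> 0" for f g :: "nat \<Rightarrow> complex"
  proof -
    have "(\<Prod>i\<in>I. norm (g i) ^ 2) > 0" using that by (intro prod_pos) auto
    moreover have "ln (\<Prod>i\<in>I. norm (g i) ^ 2) = (\<Sum>i\<in>I. ln (norm (g i) ^ 2))"
      using that I by (intro ln_prod) auto
    moreover have "(\<Sum>i\<in>I. ln (norm (g i) ^ 2)) = (\<Sum>i\<in>I. 2 * ln (norm (g i)))"
      using that by (intro sum.cong) (auto simp: ln_realpow)
    ultimately show ?thesis using that[of j] by (simp add: ln_mult ln_realpow sum_distrib_left)
  qed
  ultimately have "4 * ln (norm (ev (num j) k)) + 2 * (\<Sum>i\<in>I. ln (norm (ev (den i) k))) =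
      4 * ln (norm (ev (den j) k)) + 2 * (\<Sum>i\<in>I. ln (norm (ev (num i) k)))"
    using nz ln_prod4[of "\<lambda>i. ev (num i) k" "\<lambda>i. ev (den i) k"]
      ln_prod4[of "\<lambda>i. ev (den i) k" "\<lambda>i. ev (num i) k"] by simp
  hence "2 * (ln (norm (ev (num j) k)) - ln (norm (ev (den j) k))) =
      (\<Sum>i\<in>I. ln (norm (ev (num i) k)) - ln (norm (ev (den i) k)))"
    by (simp add: sum_subtractf)
  thus ?thesis using lt by simp
qed

section \<open>Relations of small weight\<close>

text \<open>Since \<open>log_tan\<close> is even, only the orbit of \<open>b\<close> under sign
  matters; symmetrising makes the combination even, as \<open>tan_relation\<close> demands.\<close>

definition pm_indicator :: "nat \<Rightarrow> int \<Rightarrow> int \<Rightarrow> int" where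
  "pm_indicator N b a = (if [a = b] (mod int N) \<or> [a = - b] (mod int N) then 1 else 0)"

lemma pm_indicator_support:
  assumes "N > 0"
  shows "{a \<in> {0..<int N}. pm_indicator N b a \<noteq> 0} = {b mod int N, - b mod int N}"
  using assms by (auto simp: pm_indicator_def cong_def)

lemma card_pm_indicator_support:
  assumes "N > 0"
  shows "card {a \<in> {0..<int N}. pm_indicator N b a \<noteq> 0} \<le> 2"
  unfolding pm_indicator_support[OF assms] by (simp add: card_insert_if del: zmod_zminus1_eq_if)

lemma sum_pm_indicator:
  fixes g :: "int \<Rightarrow> 'a :: comm_ring_1"
  assumes N: "N > 1" "odd N" and b: "coprime b (int N)" and g: "\<And>a. g (a mod int N) = g a"
  shows "(\<Sum>a\<in>{0..<int N}. of_int (pm_indicator N b a) * g a) = g b + g (- b)"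
proof -
  have ne: "b mod int N \<noteq> - b mod int N"
  proof
    assume "b mod int N = - b mod int N"
    hence "int N dvd b - (- b)" by (simp only: mod_eq_dvd_iff)
    hence "int N dvd 2 * b" by simp
    moreover have "coprime (2 * b) (int N)" using N(2) b by (simp add: coprime_mult_left_iff)
    ultimately show False using coprime_common_divisor[of "2 * b" "int N" "int N"] N by auto
  qed
  have "(\<Sum>a\<in>{0..<int N}. of_int (pm_indicator N b a) * g a) =
      (\<Sum>a\<in>{a \<in> {0..<int N}. pm_indicator N b a \<noteq> 0}. of_int (pm_indicator N b a) * g a)"
    by (rule sum.mono_neutral_right) auto
  also have "\<dots> = (\<Sum>a\<in>{a \<in> {0..<int N}. pm_indicator N b a \<noteq> 0}. g a)"
    by (intro sum.cong) (auto simp: pm_indicator_def)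
  also have "\<dots> = g (b mod int N) + g (- b mod int N)"
    unfolding pm_indicator_support[OF less_trans[OF zero_less_one N(1)]] using ne by simp
  finally show ?thesis by (simp only: g)
qed

lemma pm_combination_zero:
  fixes b e :: "nat \<Rightarrow> int"
  assumes N: "N > 1" "odd N" "squarefree (int N)" "\<forall>p. prime p \<and> p dvd int N \<longrightarrow> p > 7"
    and j: "j \<notin> I" and I: "card I = 4"
    and b: "\<And>i. i \<in> insert j I \<Longrightarrow> coprime (b i) (int N) \<and> e i \<in> {1, -1}"
    and rel: "\<And>k. coprime k (int N) \<Longrightarrow>
      2 * (e j * log_tan N (b j * k)) = (\<Sum>i\<in>I. e i * log_tan N (b i * k))"
  shows "2 * e j * pm_indicator N (b j) a = (\<Sum>i\<in>I. e i * pm_indicator N (b i) a)"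
proof -
  have finI: "finite I" using I by (intro card_ge_0_finite) simp
  have N': "N > 0" "int N > 0" using N by auto
  define c where "c a = 2 * e j * pm_indicator N (b j) a - (\<Sum>i\<in>I. e i * pm_indicator N (b i) a)" for a
  have pm_mod: "pm_indicator N b (a mod int N) = pm_indicator N b a" for b a
    by (simp add: pm_indicator_def cong_def)
  have c_mod: "c (a mod int N) = c a" for a by (simp add: c_def pm_mod)
  have pm_uminus: "pm_indicator N b (- a) = pm_indicator N b a" for b a
    using cong_minus_minus_iff[of a "- b" "int N"] cong_minus_minus_iff[of a b "int N"]
    unfolding pm_indicator_def by auto
  have pm_cop: "pm_indicator N (b i) a = 0" if "\<not> coprime a (int N)" "i \<in> insert j I" for a i
  proof -
    have "coprime a (int N)" if "[a = b i] (mod int N) \<or> [a = - b i] (mod int N)"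
      using that b[OF \<open>i \<in> insert j I\<close>] cong_imp_coprime cong_sym coprime_minus_left_iff by metis
    thus ?thesis using that by (auto simp: pm_indicator_def)
  qed
  have c_cop: "c a = 0" if "\<not> coprime a (int N)" for a
    using pm_cop[OF that] by (simp add: c_def)
  have "tan_relation N {} (\<lambda>a. of_int (c a))"
    unfolding tan_relation_def
  proof (intro conjI allI impI)
    fix k assume k: "coprime k (int N)"
    define g where "g a = complex_of_real (log_tan N (a * k))" for a
    have g: "g (a mod int N) = g a" for a
      unfolding g_def using log_tan_cong[OF N'(1), of "(a mod int N) * k" "a * k"]
      by (simp add: cong_def mod_mult_left_eq)
    have s: "(\<Sum>a\<in>{0..<int N}. of_int (pm_indicator N (b i) a) * g a) = 2 * g (b i)" if "i \<in> insert j I" for i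
      using sum_pm_indicator[OF N(1,2), of "b i" g] b[OF that] g log_tan_uminus[of N "b i * k"]
      by (simp add: g_def)
    have "(\<Sum>a\<in>{0..<int N}. of_int (c a) * g a) =
        2 * of_int (e j) * (\<Sum>a\<in>{0..<int N}. of_int (pm_indicator N (b j) a) * g a) -
        (\<Sum>i\<in>I. of_int (e i) * (\<Sum>a\<in>{0..<int N}. of_int (pm_indicator N (b i) a) * g a))"
    proof -
      have "(\<Sum>i\<in>I. of_int (e i) * (\<Sum>a\<in>{0..<int N}. of_int (pm_indicator N (b i) a) * g a)) =
          (\<Sum>a\<in>{0..<int N}. (\<Sum>i\<in>I. of_int (e i) * of_int (pm_indicator N (b i) a)) * g a)"
        unfolding sum_distrib_left sum_distrib_right by (subst sum.swap) (simp only: mult.assoc)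
      thus ?thesis unfolding c_def
        by (simp add: sum_subtractf left_diff_distrib sum_distrib_left mult.assoc)
    qed
    also have "\<dots> = 2 * of_int (e j) * (2 * g (b j)) - (\<Sum>i\<in>I. of_int (e i) * (2 * g (b i)))"
      using s by simp
    also have "\<dots> = of_real (2 * (2 * (e j * log_tan N (b j * k)) - (\<Sum>i\<in>I. e i * log_tan N (b i * k))))"
      by (simp add: g_def sum_distrib_left algebra_simps)
    also have "\<dots> = 0" using rel[OF k] by simp
    finally show "(\<Sum>a\<in>{0..<int N}. of_int (c a) * complex_of_real (log_tan N (a * k))) = 0"
      by (simp add: g_def)
  qed (use c_mod c_cop in \<open>simp_all add: c_def pm_uminus\<close>)
  moreover define qs where "qs = sorted_list_of_set {q. prime q \<and> q dvd int N}"
  have "finite {q. prime q \<and> q dvd int N}"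
    by (rule finite_subset[of _ "{0..int N}"]) (use N' in \<open>auto simp: prime_ge_0_int zdvd_imp_le\<close>)
  hence qs: "set qs = {q. prime q \<and> q dvd int N}" "distinct qs" by (simp_all add: qs_def)
  ultimately have van: "vanishes_mod m (int N) qs c a" for m a
    using tan_relation_vanishes[OF N(1,2), of "{}" "\<lambda>a. of_int (c a)" qs] by (intro vanishes_mod_of_int) auto
  have big: "\<forall>q\<in>set qs. prime q \<and> q dvd int N \<and> int 10 < q"
  proof
    fix q assume "q \<in> set qs"
    hence q: "prime q" "q dvd int N" by (simp_all add: qs)
    hence "q > 7" using N(4) by blast
    \<comment> \<open>Only \<open>11\<close> and larger remain: \<open>8\<close> and
      \<open>10\<close> are even, \<open>9\<close> is not prime.\<close>
    moreover have "q \<noteq> 8" "q \<noteq> 10" using q(2) N(2) by (auto dest: dvd_trans[of 2, rotated])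
    moreover have "q \<noteq> 9" using q(1) primes_dvd_imp_eq[of 3 q] by auto
    ultimately show "prime q \<and> q dvd int N \<and> int 10 < q" using q by auto
  qed
  have fin: "finite {a \<in> {0..<int N}. P a}" for P
    by (rule finite_subset[of _ "{0..<int N}"]) auto
  have lower: "10 \<le> card {a \<in> {0..<int N}. \<not> m dvd c a}" if "coprime a0 (int N)" "\<not> m dvd c a0" for m a0
  proof -
    have "10 \<le> card {a \<in> {0..<int N}. coprime a (int N) \<and> \<not> m dvd c a \<and>
        (\<forall>r. prime r \<longrightarrow> r dvd int N \<longrightarrow> r \<notin> set qs \<longrightarrow> [a = a0] (mod r))}"
      by (rule support_lower_bound[OF N'(2) N(3) qs(2) big c_mod van that])
    also have "\<dots> \<le> card {a \<in> {0..<int N}. \<not> m dvd c a}" by (rule card_mono[OF fin]) auto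
    finally show ?thesis .
  qed
  have even: "2 dvd c a" for a
  proof (rule ccontr)
    assume odd: "\<not> 2 dvd c a"
    hence "coprime a (int N)" by (rule contrapos_np) (simp add: c_cop)
    hence "10 \<le> card {a \<in> {0..<int N}. \<not> 2 dvd c a}" using odd by (rule lower)
    \<comment> \<open>Modulo 2 the doubled term at \<open>j\<close> disappears, leaving four orbits
      of at most two points each.\<close>
    also have "\<dots> \<le> card (\<Union>i\<in>I. {a \<in> {0..<int N}. pm_indicator N (b i) a \<noteq> 0})"
    proof (rule card_mono)
      show "{a \<in> {0..<int N}. \<not> 2 dvd c a} \<subseteq> (\<Union>i\<in>I. {a \<in> {0..<int N}. pm_indicator N (b i) a \<noteq> 0})"
      proof
        fix a assume a: "a \<in> {a \<in> {0..<int N}. \<not> 2 dvd c a}"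
        have "\<exists>i\<in>I. pm_indicator N (b i) a \<noteq> 0"
        proof (rule ccontr)
          assume "\<not> (\<exists>i\<in>I. pm_indicator N (b i) a \<noteq> 0)"
          hence "c a = 2 * (e j * pm_indicator N (b j) a)" by (simp add: c_def)
          thus False using a by simp
        qed
        thus "a \<in> (\<Union>i\<in>I. {a \<in> {0..<int N}. pm_indicator N (b i) a \<noteq> 0})" using a by blast
      qed
    qed (intro finite_UN_I finI fin)
    also have "\<dots> \<le> (\<Sum>i\<in>I. card {a \<in> {0..<int N}. pm_indicator N (b i) a \<noteq> 0})"
      by (rule card_UN_le[OF finI])
    also have "\<dots> \<le> (\<Sum>i\<in>I. 2)" by (intro sum_mono card_pm_indicator_support N')
    finally show False using I by simp
  qed
  have "c a = 0" for a
  proof (rule ccontr)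
    assume nz: "c a \<noteq> 0"
    hence "coprime a (int N)" using c_cop by blast
    hence "10 \<le> card {a \<in> {0..<int N}. \<not> 0 dvd c a}" using nz by (intro lower) auto
    \<comment> \<open>Ten nonzero even values have total size at least \<open>20\<close>, whereas
      the triangle inequality bounds the total by \<open>2 * 2 + 4 * 2 = 12\<close>.\<close>
    hence "int 10 * 2 \<le> (\<Sum>a\<in>{a \<in> {0..<int N}. c a \<noteq> 0}. 2)" by simp
    also have "\<dots> \<le> (\<Sum>a\<in>{a \<in> {0..<int N}. c a \<noteq> 0}. \<bar>c a\<bar>)"
    proof (rule sum_mono)
      fix a assume "a \<in> {a \<in> {0..<int N}. c a \<noteq> 0}"
      thus "2 \<le> \<bar>c a\<bar>" using even[of a] by (auto elim!: dvdE simp: abs_mult)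
    qed
    also have "\<dots> \<le> (\<Sum>a\<in>{0..<int N}. \<bar>c a\<bar>)" by (rule sum_mono2) auto
    also have "\<dots> \<le> (\<Sum>a\<in>{0..<int N}. 2 * pm_indicator N (b j) a + (\<Sum>i\<in>I. pm_indicator N (b i) a))"
    proof (rule sum_mono)
      fix a
      have abs: "\<bar>e i * pm_indicator N (b i) a\<bar> = pm_indicator N (b i) a" if "i \<in> insert j I" for i
        using b[OF that] by (auto simp: abs_mult pm_indicator_def)
      have "\<bar>c a\<bar> \<le> \<bar>2 * e j * pm_indicator N (b j) a\<bar> + \<bar>\<Sum>i\<in>I. e i * pm_indicator N (b i) a\<bar>"
        unfolding c_def by (rule abs_triangle_ineq4)
      also have "\<bar>\<Sum>i\<in>I. e i * pm_indicator N (b i) a\<bar> \<le> (\<Sum>i\<in>I. \<bar>e i * pm_indicator N (b i) a\<bar>)"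
        by (rule sum_abs)
      also have "\<dots> = (\<Sum>i\<in>I. pm_indicator N (b i) a)" using abs by (intro sum.cong) auto
      also have "\<bar>2 * e j * pm_indicator N (b j) a\<bar> = 2 * pm_indicator N (b j) a"
        using abs[of j] by (simp add: abs_mult mult.assoc)
      finally show "\<bar>c a\<bar> \<le> 2 * pm_indicator N (b j) a + (\<Sum>i\<in>I. pm_indicator N (b i) a)" by simp
    qed
    also have "\<dots> = 2 * (\<Sum>a\<in>{0..<int N}. pm_indicator N (b j) a) + (\<Sum>i\<in>I. \<Sum>a\<in>{0..<int N}. pm_indicator N (b i) a)"
      by (simp add: sum.distrib sum_distrib_left sum.swap[of _ _ I])
    also have "\<dots> = 2 * 2 + (\<Sum>i\<in>I. 2)"
      using sum_pm_indicator[OF N(1,2), of _ "\<lambda>_. 1 :: int"] b by simp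
    also have "\<dots> = 12" using I by simp
    finally show False by simp
  qed
  thus ?thesis by (simp add: c_def)
qed

text \<open>At \<open>B 0\<close>, after multiplication by \<open>E 0\<close>, four terms from
  \<open>{-1, 0, 1}\<close> add up to \<open>2\<close>, so at least two of them equal
  \<open>1\<close>. Removing these two leaves a relation that forces the other two to
  cancel.\<close>

lemma signed_indicator_cancel:
  fixes B E :: "nat \<Rightarrow> int"
  assumes E: "\<And>i. i \<in> {0..4} \<Longrightarrow> E i \<in> {1, -1}"
    and eq: "\<And>a. a \<in> B ` {0..4} \<Longrightarrow>
      2 * E 0 * (if B 0 = a then 1 else 0) = (\<Sum>i\<in>{1..4}. E i * (if B i = a then 1 else 0))"
  shows "\<exists>i j k l. distinct [i, j, k, l] \<and> set [i, j, k, l] = {1..4} \<and>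
    B i = B 0 \<and> E i = E 0 \<and> B j = B 0 \<and> E j = E 0 \<and> B k = B l \<and> E k = - E l"
proof -
  have four: "{1..4} = {1, 2, 3, 4::nat}" by auto
  have E': "E 0 = 1 \<or> E 0 = -1" "E 1 = 1 \<or> E 1 = -1" "E 2 = 1 \<or> E 2 = -1" "E 3 = 1 \<or> E 3 = -1" "E 4 = 1 \<or> E 4 = -1"
    using E by auto
  define t where "t i a = (if B i = a then E i else 0)" for i a
  have eq': "2 * t 0 a = t 1 a + t 2 a + t 3 a + t 4 a" if "a \<in> B ` {0..4}" for a
  proof -
    have "y * (if P then 1 else 0) = (if P then y else 0)" for y :: int and P by simp
    thus ?thesis using eq[OF that] unfolding four mult.assoc t_def by simp
  qed
  have pair: ?thesis if d: "distinct [i, j, k, l]" "set [i, j, k, l] = {1..4}"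
    and ij: "B i = B 0" "E i = E 0" "B j = B 0" "E j = E 0" for i j k l
  proof -
    have k: "k \<in> {0..4}" "l \<in> {0..4}" using d(2) by auto
    have "2 * t 0 a = t i a + t j a + t k a + t l a" if "a \<in> B ` {0..4}" for a
    proof -
      have "t 1 a + t 2 a + t 3 a + t 4 a = (\<Sum>i\<in>{1..4}. t i a)" unfolding four by simp
      also have "\<dots> = (\<Sum>i\<in>set [i, j, k, l]. t i a)" using d(2) by simp
      also have "\<dots> = t i a + t j a + t k a + t l a" using d(1) by simp
      finally show ?thesis using eq'[OF that] by simp
    qed
    from this[of "B k"] this[of "B l"] have "t k (B k) + t l (B k) = 0"
      using k ij by (auto simp: t_def split: if_splits)
    hence "B k = B l" "E k = - E l" using E[OF k(1)] E[OF k(2)] by (auto simp: t_def split: if_splits)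
    thus ?thesis using d ij by blast
  qed
  have ti: "B i = B 0 \<and> E i = E 0" if "t i (B 0) = E 0" for i
    using that E'(1) unfolding t_def by (auto split: if_splits)
  have tv: "t i (B 0) = E 0 \<or> E 0 * t i (B 0) \<le> 0" "E 0 * t i (B 0) \<le> 1" if "i \<in> {0..4}" for i
    using E[OF that] E'(1) by (auto simp: t_def)
  have "2 * E 0 = t 1 (B 0) + t 2 (B 0) + t 3 (B 0) + t 4 (B 0)"
    using eq'[of "B 0"] by (simp add: t_def)
  hence "E 0 * (2 * E 0) = E 0 * t 1 (B 0) + E 0 * t 2 (B 0) + E 0 * t 3 (B 0) + E 0 * t 4 (B 0)"
    by (simp add: algebra_simps)
  hence sum2: "E 0 * t 1 (B 0) + E 0 * t 2 (B 0) + E 0 * t 3 (B 0) + E 0 * t 4 (B 0) = 2"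
    using E'(1) by auto
  consider "t 1 (B 0) = E 0" "t 2 (B 0) = E 0" | "t 1 (B 0) = E 0" "t 3 (B 0) = E 0"
    | "t 1 (B 0) = E 0" "t 4 (B 0) = E 0" | "t 2 (B 0) = E 0" "t 3 (B 0) = E 0"
    | "t 2 (B 0) = E 0" "t 4 (B 0) = E 0" | "t 3 (B 0) = E 0" "t 4 (B 0) = E 0"
    using tv[of 1] tv[of 2] tv[of 3] tv[of 4] sum2 by auto
  moreover have sets: "set [1, 2, 3, 4] = {1..4::nat}" "set [1, 3, 2, 4] = {1..4::nat}" "set [1, 4, 2, 3] = {1..4::nat}" "set [2, 3, 1, 4] = {1..4::nat}" "set [2, 4, 1, 3] = {1..4::nat}" "set [3, 4, 1, 2] = {1..4::nat}"
    unfolding four by auto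
  ultimately show ?thesis
  proof cases
    case 1
    thus ?thesis using ti[of 1] ti[of 2] by (intro pair[OF _ sets(1)]) simp_all
  next
    case 2
    thus ?thesis using ti[of 1] ti[of 3] by (intro pair[OF _ sets(2)]) simp_all
  next
    case 3
    thus ?thesis using ti[of 1] ti[of 4] by (intro pair[OF _ sets(3)]) simp_all
  next
    case 4
    thus ?thesis using ti[of 2] ti[of 3] by (intro pair[OF _ sets(4)]) simp_all
  next
    case 5
    thus ?thesis using ti[of 2] ti[of 4] by (intro pair[OF _ sets(5)]) simp_all
  next
    case 6
    thus ?thesis using ti[of 3] ti[of 4] by (intro pair[OF _ sets(6)]) simp_all
  qed
qed

lemma exists_permutation_of_four:
  assumes "distinct [i, j, k, l]" "set [i, j, k, l] = {1..4::nat}"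
  shows "\<exists>\<sigma>. \<sigma> permutes {1..4} \<and> \<sigma> 1 = i \<and> \<sigma> 2 = j \<and> \<sigma> 3 = k \<and> \<sigma> 4 = l"
proof -
  define \<sigma> where "\<sigma> m = (if m = 1 then i else if m = 2 then j else if m = 3 then k else if m = 4 then l else m)" for m
  have four: "{1..4} = {1, 2, 3, 4::nat}" by auto
  have "inj_on \<sigma> {1..4}" using assms(1) unfolding four inj_on_def \<sigma>_def by auto
  moreover have "\<sigma> ` {1..4} = {1..4}" unfolding assms(2)[symmetric] by (subst (1) assms(2), unfold four) (auto simp: \<sigma>_def)
  ultimately have "\<sigma> permutes {1..4}" by (intro bij_imp_permutes) (auto simp: bij_betw_def \<sigma>_def)
  thus ?thesis by (intro exI[of _ \<sigma>]) (auto simp: \<sigma>_def)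
qed

theorem theorem10p1:
  fixes n :: int and x :: "nat \<Rightarrow> real"
  assumes "n > 3" and "odd n" and "squarefree n" and "\<not> prime n"
    and "\<forall>p. prime p \<and> p dvd n \<longrightarrow> p > 7"
    and "\<forall>i\<in>{0..4}. x i \<in> rational_angles"
    and "(tan (x 0))\<^sup>2 = tan (x 1) * tan (x 2) * tan (x 3) * tan (x 4)"
    and "\<forall>i\<in>{0..4}. 0 < x i \<and> x i < pi / 2"
    and "\<forall>i\<in>{0..4}. den (x i) \<in> {n, 2 * n}"
  shows "\<exists>\<sigma> (s::rat) (t::rat). \<sigma> permutes {1..4} \<and>
           0 < s \<and> s < 1/2 \<and> 0 < t \<and> t \<le> 1/4 \<and>
           x 0 = of_rat s * pi \<and> x (\<sigma> 1) = of_rat s * pi \<and> x (\<sigma> 2) = of_rat s * pi \<and>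
           x (\<sigma> 3) = of_rat t * pi \<and> x (\<sigma> 4) = of_rat (1/2 - t) * pi"
proof -
  define N where "N = nat n"
  have n: "n = int N" using assms(1) by (simp add: N_def)
  have N: "N > 1" "odd N" "squarefree (int N)" "\<forall>p. prime p \<and> p dvd int N \<longrightarrow> p > 7"
    using assms(1,2,3,5) by (simp_all add: n)
  have "\<forall>i\<in>{0..4}. \<exists>b e. coprime b (int N) \<and> 0 < b \<and> 2 * b < int N \<and> e \<in> {1, -1} \<and> x i = signed_angle N b e"
    using assms(6,8,9) unfolding n by (intro ballI exists_signed_angle N(2)) auto
  then obtain b e where be: "\<And>i. i \<in> {0..4} \<Longrightarrow> coprime (b i) (int N) \<and> 0 < b i \<and> 2 * b i < int N \<and> e i \<in> {1, -1}"
    and x: "\<And>i. i \<in> {0..4} \<Longrightarrow> x i = signed_angle N (b i) (e i)"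
    by metis
  have four: "{1..4} = {1, 2, 3, 4::nat}" by auto
  have ins: "insert 0 {1..4} = {0..4::nat}" by auto
  have rel: "(tan (signed_angle N (b 0) (e 0)))\<^sup>2 = (\<Prod>i\<in>{1..4}. tan (signed_angle N (b i) (e i)))"
    using assms(7) x unfolding four by (simp add: mult.assoc)
  have zero: "2 * e 0 * pm_indicator N (b 0) a = (\<Sum>i\<in>{1..4}. e i * pm_indicator N (b i) a)" for a
  proof (rule pm_combination_zero[OF N])
    fix k assume "coprime k (int N)"
    thus "2 * (e 0 * log_tan N (b 0 * k)) = (\<Sum>i\<in>{1..4}. e i * log_tan N (b i * k))"
      using be rel by (intro log_tan_galois[OF N(1,2)]) (simp_all only: ins, auto)
  qed (use be in \<open>simp_all only: ins, auto\<close>)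
  \<comment> \<open>All \<open>b i\<close> lie strictly between \<open>0\<close> and
    \<open>N / 2\<close>, so an orbit under sign determines its representative.\<close>
  have pm: "pm_indicator N (b i) (b j) = (if b i = b j then 1 else 0)" if "i \<in> {0..4}" "j \<in> {0..4}" for i j
  proof -
    have "0 < b i" "2 * b i < int N" "0 < b j" "2 * b j < int N" using be that by blast+
    hence "b i = b j" if "[b j = b i] (mod int N)"
      using that cong_less_imp_eq_int[of "b j" "int N" "b i"] by simp
    moreover have "\<not> [b j = - b i] (mod int N)"
      using zdvd_not_zless[of "b j + b i" "int N"] \<open>0 < b i\<close> \<open>0 < b j\<close> \<open>2 * b i < int N\<close> \<open>2 * b j < int N\<close>
      by (simp add: cong_iff_dvd_diff)
    ultimately show ?thesis by (auto simp: pm_indicator_def)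
  qed
  have ind: "2 * e 0 * (if b 0 = a then 1 else 0) = (\<Sum>i\<in>{1..4}. e i * (if b i = a then 1 else 0))"
    if a: "a \<in> b ` {0..4}" for a
  proof -
    obtain j where j: "a = b j" "j \<in> {0..4}" using a by blast
    have "(\<Sum>i\<in>{1..4}. e i * pm_indicator N (b i) a) = (\<Sum>i\<in>{1..4}. e i * (if b i = a then 1 else 0))"
      unfolding j(1) by (intro sum.cong) (use pm j(2) in auto)
    thus ?thesis using zero[of a] pm[of 0 j] j by simp
  qed
  then obtain i j k l where d: "distinct [i, j, k, l]" "set [i, j, k, l] = {1..4}"
    and ijkl: "b i = b 0" "e i = e 0" "b j = b 0" "e j = e 0" "b k = b l" "e k = - e l"
    using signed_indicator_cancel[of e b, OF _ ind] be by blast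
  have mem: "i \<in> {0..4}" "j \<in> {0..4}" "k \<in> {0..4}" "l \<in> {0..4}" using d(2) by auto
  have xij: "x i = x 0" "x j = x 0" using x mem ijkl by simp_all
  \<comment> \<open>Equal \<open>b\<close> and opposite exponents mean complementary angles.\<close>
  have xkl: "x k + x l = pi / 2"
    using be[OF mem(4)] x[OF mem(3)] x[OF mem(4)] ijkl by (auto simp: signed_angle_def)
  \<comment> \<open>Ordering the complementary pair puts the smaller angle at
    \<open>t \<le> 1/4\<close>.\<close>
  obtain k' l' where kl: "{k', l'} = {k, l}" "x k' \<le> x l'" by (metis insert_commute linear)
  hence kl': "distinct [i, j, k', l']" "set [i, j, k', l'] = {1..4}" "x k' + x l' = pi / 2"
    using d xkl by (auto simp: doubleton_eq_iff)
  have "x 0 \<in> rational_angles" using assms(6) by simp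
  then obtain s where s: "x 0 = of_rat s * pi" unfolding rational_angles_def by auto
  have k': "k' \<in> {0..4}" using mem(3,4) kl(1) by (auto simp: doubleton_eq_iff)
  hence "x k' \<in> rational_angles" using assms(6) by blast
  then obtain t where t: "x k' = of_rat t * pi" unfolding rational_angles_def by auto
  have "0 < x 0" "x 0 < pi / 2" using assms(8) by auto
  hence s': "0 < s" "s < 1/2"
    using of_rat_less[of s "1/2", where ?'a = real] unfolding s by (simp_all add: zero_less_mult_iff of_rat_divide)
  have "0 < x k'" using assms(8) k' by blast
  moreover have "x k' \<le> pi / 4" using kl(2) kl'(3) by simp
  ultimately have t': "0 < t" "t \<le> 1/4"
    using of_rat_less_eq[of t "1/4", where ?'a = real] unfolding t by (simp_all add: zero_less_mult_iff of_rat_divide)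
  have l': "x l' = of_rat (1/2 - t) * pi"
    using kl'(3) unfolding t by (simp add: of_rat_diff of_rat_divide algebra_simps)
  obtain \<sigma> where \<sigma>: "\<sigma> permutes {1..4}" "\<sigma> 1 = i" "\<sigma> 2 = j" "\<sigma> 3 = k'" "\<sigma> 4 = l'"
    using exists_permutation_of_four[OF kl'(1,2)] by blast
  show ?thesis
    using \<sigma> s s' t t' l' xij by (intro exI[of _ \<sigma>] exI[of _ s] exI[of _ t]) simp
qed

end
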